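(* Let $\mathbf{k}$ be a field of characteristic $0$ and $B$ a normal affine $\mathbf{k}$-domain graded over $\mathbf{k}$ by an abelian group $G$. Assume that $\mathbb{G}(B)/\bar{\mathbb{G}}(B)$ is not torsion and define $r = \mathrm{rank}\big(\mathbb{G}(B)/\bar{\mathbb{G}}(B)\big)$ and $W = \mathrm{torc}(\bar{\mathbb{G}}(B),\mathbb{G}(B))$. (a) There exists $\mathfrak{p} \in \mathrm{Spec}^1(B)$ such that $\mathbb{G}(B)/\overline{\mathbb{M}}(B,\mathfrak{p})$ is not torsion. For any such $\mathfrak{p}$, define $\mathcal{H}_{\mathfrak{p}} = \mathcal{H}\big(\overline{\mathbb{M}}(B,\mathfrak{p}),\mathbb{G}(B)\big)$ and $T_{\mathfrak{p}} = \mathrm{torc}(\overline{\mathbb{M}}(B,\mathfrak{p}),\mathbb{G}(B))$. Then the following hold. (i) $\mathcal{H}_{\mathfrak{p}} \neq \emptyset$. (ii) For each $H \in \mathcal{H}_{\mathfrak{p}}$, there exists $D \in \mathrm{LND}(B)$ such that $\ker(D) = B^{(H)}$. (iii) There exists a subset $\Delta_{\mathfrak{p}}$ of $\mathrm{LND}(B)$ such that $\bigcap_{D \in \Delta_{\mathfrak{p}}} \ker(D) = B^{(T_{\mathfrak{p}})}$. (b) There exists a subset $\Delta$ of $\mathrm{LND}(B)$ such that $\bigcap_{D \in \Delta} \ker(D) = B^{(W)}$. (c) There exists a field $K$ such that $\mathrm{ML}(B) \subseteq B^{(W)} \subseteq K \subseteq \mathrm{Frac}(B)$ and $\mathrm{Frac}(B)$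 is a purely transcendental extension of $K$ of transcendence degree $r$. In particular, $\mathrm{trdeg}(B:\mathrm{ML}(B)) \ge r$. (d) $B$ is non-rigid, and if $G$ is torsion-free then $\mathcal{X}(B) = \mathbb{T}(B)$.
   Context: Rings are commutative, associative and unital; "domain" means integral domain; a domain is normal if it is integrally closed in its field of fractions $\mathrm{Frac}$. An affine $\mathbf{k}$-domain is a domain that is a finitely generated $\mathbf{k}$-algebra. For an abelian group $G$ (written additively), a $G$-graded ring is a ring $B=\bigoplus_{i\in G}B_i$ with $B_iB_j\subseteq B_{i+j}$. A $\mathbf{k}$-algebra $B$ is graded over $\mathbf{k}$ by $G$ if it is $G$-graded and $\mathbf{k}\subseteq B_0$. For a $G$-graded domain $B$, $\mathbb{G}(B)$ is the subgroup of $G$ generated by $\{i\in G : B_i\neq 0\}$. For a subgroup $H$ of $G$, $B^{(H)}=\bigoplus_{i\in H}B_i$, an $H$-graded ring. $\mathbb{T}(B)$ is the set of subgroups $H$ of $G$ such that $\mathbb{G}(B)/(H\cap\mathbb{G}(B))$ is a torsion group. Let $\mathrm{Spec}^1(B)$ be the set of all prime ideals of $B$ of height $1$ (not necessarily homogeneous). For $\mathfrak{p}\in\mathrm{Spec}(B)$, $\mathbb{M}(B,\mathfrak{p})=\{i\in G: B_i\nsubseteq\mathfrak{p}\}$, a submonoid of $\mathbb{G}(B)$, and $\overline{\mathbb{M}}(B,\mathfrak{p})$ is the subgroup it generates. Define $\bar{\mathbb{G}}(B)=\bigcap_{\mathfrak{p}\in\mathrm{Spec}^1(B)}\overline{\mathbb{M}}(B,\mathfrak{p})$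 if $\mathrm{Spec}^1(B)\neq\emptyset$, and $\bar{\mathbb{G}}(B)=\mathbb{G}(B)$ if $\mathrm{Spec}^1(B)=\emptyset$. The rank of an abelian group $A$ is $\dim_{\mathbb{Q}}(\mathbb{Q}\otimes_{\mathbb{Z}}A)$. For a subgroup $H$ of an abelian group $A$, $\mathrm{torc}(H,A)=\{x\in A: mx\in H\text{ for some integer }m\ge1\}$, and $\mathcal{H}(H,A)$ is the set of all subgroups $H'$ of $A$ such that $H\subseteq H'\subset A$ and $A/H'\cong\mathbb{Z}$. A derivation $D:B\to B$ is locally nilpotent if for each $b\in B$ there is $n>0$ with $D^n(b)=0$; $\mathrm{LND}(B)$ is the set of locally nilpotent derivations of $B$, and $B$ is rigid if $\mathrm{LND}(B)=\{0\}$. $\mathrm{ML}(B)=\bigcap_{D\in\mathrm{LND}(B)}\ker D$. A derivation of a graded ring is homogeneous if there is $d$ in the grading group with $D(B_i)\subseteq B_{i+d}$ for all $i$; $\mathrm{HLND}(B)$ is the set of homogeneous elements of $\mathrm{LND}(B)$. $\mathcal{X}(B)=\{H\in\mathbb{T}(B):\mathrm{HLND}(B^{(H)})\neq\{0\}\}$. For domains $A\subseteq B$, $\mathrm{trdeg}(B:A)$ is the transcendence degree of $B$ over $A$. *)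

theory Defs
  imports
    "HOL-Algebra.Algebra"
    "HOL-Algebra.Algebraic_Closure_Type"
    "HOL-Computational_Algebra.Computational_Algebra"
    "HOL-Library.Extended_Nat"
    "HOL-Library.Poly_Mapping"
    "Jordan_Normal_Form.Missing_VectorSpace"
begin

text \<open>Rings and groups that live on a whole type (\<^typ>\<open>'b\<close> for the domain, its
  fraction field \<^typ>\<open>'b fract\<close>, and \<^typ>\<open>'g\<close> for the grading group) are viewed as
  HOL-Algebra structures through \<^const>\<open>ring_of_type_algebra\<close> and the following record.\<close>

definition additive_group :: "'g::ab_group_add monoid"
  where "additive_group = \<lparr>carrier = UNIV, monoid.mult = (+), one = 0\<rparr>"

lemma comm_group_additive_group: "comm_group (additive_group :: 'g::ab_group_add monoid)"
proof (rule comm_groupI)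
  show "\<exists>y\<in>carrier additive_group. y \<otimes>\<^bsub>additive_group\<^esub> x = \<one>\<^bsub>additive_group\<^esub>" for x :: 'g
    by (rule bexI[of _ "- x"]) (simp_all add: additive_group_def)
qed (simp_all add: additive_group_def ac_simps)

definition quotient_group :: "'g::ab_group_add set \<Rightarrow> 'g set \<Rightarrow> 'g set monoid"
  where "quotient_group A H = (additive_group\<lparr>carrier := A\<rparr>) Mod H"

definition torsion_group :: "('a, 'm) monoid_scheme \<Rightarrow> bool"
  where "torsion_group Q \<longleftrightarrow> (\<forall>x\<in>carrier Q. \<exists>n::nat. n \<ge> 1 \<and> x [^]\<^bsub>Q\<^esub> n = \<one>\<^bsub>Q\<^esub>)"

definition torsion_free_group :: "('a, 'm) monoid_scheme \<Rightarrow> bool"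
  where "torsion_free_group Q \<longleftrightarrow>
    (\<forall>x\<in>carrier Q. \<forall>n::nat. n \<ge> 1 \<longrightarrow> x [^]\<^bsub>Q\<^esub> n = \<one>\<^bsub>Q\<^esub> \<longrightarrow> x = \<one>\<^bsub>Q\<^esub>)"

definition torc :: "'g::ab_group_add set \<Rightarrow> 'g set \<Rightarrow> 'g set"
  where "torc H A = {x \<in> A. \<exists>m::nat. m \<ge> 1 \<and> x [^]\<^bsub>additive_group\<^esub> m \<in> H}"

definition cocyclic_overgroups :: "'g::ab_group_add set \<Rightarrow> 'g set \<Rightarrow> 'g set set"
  where "cocyclic_overgroups H A =
    {H'. subgroup H' (additive_group\<lparr>carrier := A\<rparr>) \<and> H \<subseteq> H' \<and> H' \<subset> A \<and>
         quotient_group A H' \<cong> integer_group}"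


section \<open>Rank of an abelian group\<close>

text \<open>The tensor product of the rationals with an abelian group \<open>A\<close>, taken over the integers: the
  free abelian group on pairs \<open>(q, a)\<close> modulo biadditivity.  The group \<open>A\<close> is
  an arbitrary (multiplicatively written) record.  The ring fields \<open>mult\<close> and \<open>one\<close>
  that a \<^typ>\<open>('a, 'b) module\<close> record carries along play no role.\<close>

definition tensor_relations ::
  "('a, 'm) monoid_scheme \<Rightarrow> ((rat \<times> 'a) \<Rightarrow>\<^sub>0 int) set"
  where "tensor_relations A =
    {frag_of (p + q, a) - frag_of (p, a) - frag_of (q, a) |p q a. a \<in> carrier A} \<union>
    {frag_of (q, a \<otimes>\<^bsub>A\<^esub> b) - frag_of (q, a) - frag_of (q, b) |q a b.
       a \<in> carrier A \<and> b \<in> carrier A}"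

definition rat_tensor ::
  "('a, 'm) monoid_scheme \<Rightarrow> (rat, ((rat \<times> 'a) \<Rightarrow>\<^sub>0 int) set) module"
  where "rat_tensor A =
    (let F = free_Abelian_group (UNIV \<times> carrier A);
         N = generate F (tensor_relations A);
         T = F Mod N
     in \<lparr>carrier = carrier T, monoid.mult = undefined, one = undefined,
         ring.zero = \<one>\<^bsub>T\<^esub>, ring.add = monoid.mult T,
         module.smult = (\<lambda>q C. \<Union>x\<in>C. N #>\<^bsub>F\<^esub> frag_extend (\<lambda>(p, a). frag_of (q * p, a)) x)\<rparr>)"

definition group_rank :: "('a, 'm) monoid_scheme \<Rightarrow> enat"
  where "group_rank A =
    (if vectorspace.fin_dim ring_of_type_algebra (rat_tensor A)
     then enat (vectorspace.dim ring_of_type_algebra (rat_tensor A)) else \<infinity>)"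

text \<open>\<^const>\<open>vectorspace.dim\<close> is specified only for vector spaces, hence the following check.\<close>

lemma vectorspace_rat_tensor:
  assumes "comm_group A"
  shows "vectorspace ring_of_type_algebra (rat_tensor A)"
proof -
  define F where "F = free_Abelian_group ((UNIV :: rat set) \<times> carrier A)"
  define N where "N = generate F (tensor_relations A)"
  define T where "T = F Mod N"
  define sc :: "rat \<Rightarrow> ((rat \<times> 'a) \<Rightarrow>\<^sub>0 int) \<Rightarrow> ((rat \<times> 'a) \<Rightarrow>\<^sub>0 int)"
    where "sc q = frag_extend (\<lambda>(p, a). frag_of (q * p, a))" for q
  interpret A: comm_group A by fact
  interpret F: comm_group F unfolding F_def by (rule abelian_free_Abelian_group)
  have F_simps: "x \<otimes>\<^bsub>F\<^esub> y = x + y" "\<one>\<^bsub>F\<^esub> = 0"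
    "x \<in> carrier F \<longleftrightarrow> Poly_Mapping.keys x \<subseteq> UNIV \<times> carrier A" for x y
    by (simp_all add: F_def)
  have F_inv: "inv\<^bsub>F\<^esub> x = - x" if "x \<in> carrier F" for x
    using that by (simp add: F_def)
  have diff_closed: "x - y \<in> carrier F" if "x \<in> carrier F" "y \<in> carrier F" for x y
    using that keys_diff[of x y] by (auto simp: F_simps)
  have of_closed: "frag_of (q, a) \<in> carrier F" if "a \<in> carrier A" for q a
    using that by (simp add: F_simps)
  have rel: "tensor_relations A \<subseteq> carrier F"
    unfolding tensor_relations_def by (auto intro!: diff_closed of_closed)
  have N: "subgroup N F" unfolding N_def by (rule F.generate_is_subgroup[OF rel])
  interpret N: normal N F by (rule F.subgroup_imp_normal[OF N])
  interpret T: comm_group T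
    unfolding T_def by (rule F.abelian_FactGroup[OF N])
  have sc_add: "sc q (x + y) = sc q x + sc q y" and sc_diff: "sc q (x - y) = sc q x - sc q y"
    and sc_minus: "sc q (- x) = - sc q x" and sc_0: "sc q 0 = 0"
    and sc_of: "sc q (frag_of (p, a)) = frag_of (q * p, a)" for q x y p a
    by (simp_all add: sc_def frag_extend_add frag_extend_diff frag_extend_minus)
  have sc_closed: "sc q x \<in> carrier F" if "x \<in> carrier F" for q x
    using that[unfolded F_simps]
  proof (induction rule: frag_induction)
    case (one x)
    then show ?case by (cases x) (auto simp: sc_of of_closed)
  next
    case (diff a b)
    then show ?case by (simp add: sc_diff diff_closed)
  qed (simp add: sc_0 F_simps)
  have N_diff: "x - y \<in> N" if "x \<in> N" "y \<in> N" for x y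
    using N.m_closed[OF that(1) N.m_inv_closed[OF that(2)]] that
    by (simp add: F_simps(1,2) F_inv N.mem_carrier)
  have sc_rel: "sc q x \<in> tensor_relations A" if "x \<in> tensor_relations A" for q x
    using that[unfolded tensor_relations_def]
  proof (elim UnE CollectE exE conjE)
    fix p p' a assume "x = frag_of (p + p', a) - frag_of (p, a) - frag_of (p', a)"
      and a: "a \<in> carrier A"
    then have "sc q x = frag_of (q * p + q * p', a) - frag_of (q * p, a) - frag_of (q * p', a)"
      by (simp add: sc_diff sc_of distrib_left)
    with a show ?thesis unfolding tensor_relations_def by blast
  next
    fix p a b
    assume "x = frag_of (p, a \<otimes>\<^bsub>A\<^esub> b) - frag_of (p, a) - frag_of (p, b)"
      and ab: "a \<in> carrier A" "b \<in> carrier A"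
    then have "sc q x = frag_of (q * p, a \<otimes>\<^bsub>A\<^esub> b) - frag_of (q * p, a) - frag_of (q * p, b)"
      by (simp add: sc_diff sc_of)
    with ab show ?thesis unfolding tensor_relations_def by blast
  qed
  have sc_N: "sc q x \<in> N" if "x \<in> N" for q x
    using that unfolding N_def
  proof (induction rule: generate.induct)
    case one
    then show ?case using generate.one[of F] by (simp add: F_simps sc_0)
  next
    case (incl h)
    then show ?case by (intro generate.incl sc_rel)
  next
    case (inv h)
    have "inv\<^bsub>F\<^esub> (sc q h) \<in> generate F (tensor_relations A)"
      using inv by (intro generate.inv sc_rel)
    moreover have "h \<in> carrier F" using inv rel by blast
    ultimately show ?case by (simp add: F_inv sc_minus sc_closed)
  next
    case (eng h1 h2)
    then show ?case using generate.eng[of "sc q h1" F _ "sc q h2"] by (simp add: F_simps sc_add)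
  qed
  have coset_eq: "N #>\<^bsub>F\<^esub> x = N #>\<^bsub>F\<^esub> y"
    if "x - y \<in> N" "x \<in> carrier F" "y \<in> carrier F" for x y
  proof -
    have "x \<in> N #>\<^bsub>F\<^esub> y"
      unfolding r_coset_def using that by (auto simp: F_simps intro!: bexI[of _ "x - y"])
    then show ?thesis using F.repr_independence[OF _ that(3) N] by blast
  qed
  let ?V = "rat_tensor A"
  have V: "carrier ?V = carrier T" "\<zero>\<^bsub>?V\<^esub> = \<one>\<^bsub>T\<^esub>" "x \<oplus>\<^bsub>?V\<^esub> y = x \<otimes>\<^bsub>T\<^esub> y"
    "q \<odot>\<^bsub>?V\<^esub> x = (\<Union>z\<in>x. N #>\<^bsub>F\<^esub> sc q z)" for x y q
    unfolding rat_tensor_def Let_def F_def[symmetric] N_def[symmetric] T_def[symmetric]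
      sc_def by simp_all
  have carrT: "c \<in> carrier T \<longleftrightarrow> (\<exists>x\<in>carrier F. c = N #>\<^bsub>F\<^esub> x)" for c
    by (auto simp: T_def FactGroup_def RCOSETS_def)
  have multT: "(N #>\<^bsub>F\<^esub> x) \<otimes>\<^bsub>T\<^esub> (N #>\<^bsub>F\<^esub> y) = N #>\<^bsub>F\<^esub> (x + y)"
    if "x \<in> carrier F" "y \<in> carrier F" for x y
    using N.rcos_sum[OF that] by (simp add: T_def FactGroup_def F_simps)
  have smT: "q \<odot>\<^bsub>?V\<^esub> (N #>\<^bsub>F\<^esub> x) = N #>\<^bsub>F\<^esub> sc q x" if x: "x \<in> carrier F" for q x
  proof -
    have "N #>\<^bsub>F\<^esub> sc q z = N #>\<^bsub>F\<^esub> sc q x" if "z \<in> N #>\<^bsub>F\<^esub> x" for z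
    proof -
      from that obtain n where n: "n \<in> N" "z = n + x"
        by (auto simp: r_coset_def F_simps)
      then have "z \<in> carrier F" using F.m_closed[OF N.mem_carrier x] by (simp add: F_simps(1))
      with n x show ?thesis by (intro coset_eq sc_closed) (simp_all add: sc_add sc_N)
    qed
    moreover have "x \<in> N #>\<^bsub>F\<^esub> x" by (rule F.rcos_self[OF x N])
    ultimately show ?thesis unfolding V by blast
  qed
  have add_closed: "x + y \<in> carrier F" if "x \<in> carrier F" "y \<in> carrier F" for x y
    using F.m_closed[OF that] by (simp add: F_simps(1))
  have distrib_N: "sc (p + q) x - (sc p x + sc q x) \<in> N" if "x \<in> carrier F" for p q x
    using that[unfolded F_simps]
  proof (induction rule: frag_induction)
    case zero
    then show ?case using N.one_closed by (simp add: sc_0 F_simps)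
  next
    case (one z)
    then obtain s a where z: "z = (s, a)" "a \<in> carrier A" by auto
    have "frag_of (p * s + q * s, a) - frag_of (p * s, a) - frag_of (q * s, a)
      \<in> tensor_relations A"
      using z unfolding tensor_relations_def by blast
    then have "frag_of (p * s + q * s, a) - frag_of (p * s, a) - frag_of (q * s, a) \<in> N"
      unfolding N_def by (rule generate.incl)
    then show ?case by (simp add: z sc_of distrib_right diff_diff_eq)
  next
    case (diff a b)
    from N_diff[OF this] show ?case by (simp add: sc_diff algebra_simps)
  qed
  have sc_assoc: "sc (p * q) x = sc p (sc q x)" if "x \<in> carrier F" for p q x
    using that[unfolded F_simps]
    by (induction rule: frag_induction) (auto simp: sc_0 sc_of sc_diff mult.assoc)
  have sc_one: "sc 1 x = x" if "x \<in> carrier F" for x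
    using that[unfolded F_simps]
    by (induction rule: frag_induction) (auto simp: sc_0 sc_of sc_diff)
  have R: "field (ring_of_type_algebra :: rat ring)" by (rule field_from_type_algebra)
  have Rsimps: "p \<oplus>\<^bsub>(ring_of_type_algebra :: rat ring)\<^esub> q = p + q"
    "p \<otimes>\<^bsub>(ring_of_type_algebra :: rat ring)\<^esub> q = p * q"
    "\<one>\<^bsub>(ring_of_type_algebra :: rat ring)\<^esub> = 1" for p q
    by (simp_all add: ring_of_type_algebra_def)
  have "module (ring_of_type_algebra :: rat ring) ?V"
  proof (rule moduleI)
    show "cring (ring_of_type_algebra :: rat ring)" by (rule cring_from_type_algebra)
    show "abelian_group ?V"
      by (rule abelian_groupI) (simp_all add: V T.l_inv_ex T.m_ac)
  next
    fix q c assume "c \<in> carrier ?V"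
    then show "q \<odot>\<^bsub>?V\<^esub> c \<in> carrier ?V"
      unfolding V(1) by (metis carrT smT sc_closed)
  next
    fix p q c assume "c \<in> carrier ?V"
    then obtain x where x: "x \<in> carrier F" "c = N #>\<^bsub>F\<^esub> x" by (auto simp: V(1) carrT)
    have "N #>\<^bsub>F\<^esub> sc (p + q) x = N #>\<^bsub>F\<^esub> (sc p x + sc q x)"
      using x by (intro coset_eq distrib_N add_closed sc_closed)
    then show "(p \<oplus>\<^bsub>ring_of_type_algebra\<^esub> q) \<odot>\<^bsub>?V\<^esub> c = p \<odot>\<^bsub>?V\<^esub> c \<oplus>\<^bsub>?V\<^esub> q \<odot>\<^bsub>?V\<^esub> c"
      using x by (simp add: Rsimps smT V(3) multT sc_closed)
    show "(p \<otimes>\<^bsub>ring_of_type_algebra\<^esub> q) \<odot>\<^bsub>?V\<^esub> c = p \<odot>\<^bsub>?V\<^esub> (q \<odot>\<^bsub>?V\<^esub> c)"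
      using x by (simp add: Rsimps smT sc_closed sc_assoc)
  next
    fix q c d assume "c \<in> carrier ?V" "d \<in> carrier ?V"
    then obtain x y where xy: "x \<in> carrier F" "c = N #>\<^bsub>F\<^esub> x" "y \<in> carrier F" "d = N #>\<^bsub>F\<^esub> y"
      by (auto simp: V(1) carrT)
    then show "q \<odot>\<^bsub>?V\<^esub> (c \<oplus>\<^bsub>?V\<^esub> d) = q \<odot>\<^bsub>?V\<^esub> c \<oplus>\<^bsub>?V\<^esub> q \<odot>\<^bsub>?V\<^esub> d"
      by (simp add: smT V(3) multT sc_closed add_closed sc_add)
  next
    fix c assume "c \<in> carrier ?V"
    then obtain x where x: "x \<in> carrier F" "c = N #>\<^bsub>F\<^esub> x" by (auto simp: V(1) carrT)
    then show "\<one>\<^bsub>ring_of_type_algebra\<^esub> \<odot>\<^bsub>?V\<^esub> c = c" by (simp add: Rsimps smT sc_one)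
  qed
  then show ?thesis using R by (rule vectorspace.intro)
qed


section \<open>Ideals, integral closure and transcendence\<close>

definition prime_spectrum :: "'b::comm_ring_1 set set"
  where "prime_spectrum = {P. primeideal P ring_of_type_algebra}"

definition height :: "'b::comm_ring_1 set \<Rightarrow> enat"
  where "height P = Sup {enat n |n. \<exists>c :: nat \<Rightarrow> 'b set.
    c n = P \<and> (\<forall>i\<le>n. c i \<in> prime_spectrum) \<and> (\<forall>i<n. c i \<subset> c (Suc i))}"

definition Spec1 :: "'b::comm_ring_1 set set"
  where "Spec1 = {P \<in> prime_spectrum. height P = 1}"

definition normal_domain :: "'b::idom itself \<Rightarrow> bool"
  where "normal_domain _ \<longleftrightarrow>
    (\<forall>x :: 'b fract. (\<exists>p :: 'b poly. lead_coeff p = 1 \<and> poly (map_poly to_fract p) x = 0)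
       \<longrightarrow> x \<in> range to_fract)"

definition affine_algebra :: "('k::field \<Rightarrow> 'b::comm_ring_1) \<Rightarrow> bool"
  where "affine_algebra \<iota> \<longleftrightarrow>
    \<iota> \<in> ring_hom ring_of_type_algebra ring_of_type_algebra \<and>
    (\<exists>S. finite S \<and> generate_ring ring_of_type_algebra (range \<iota> \<union> S) = UNIV)"

text \<open>A polynomial with coefficients in \<^typ>\<open>'a\<close> whose variables are indexed by the elements
  of \<^typ>\<open>'a\<close> themselves has type \<^typ>\<open>('a \<Rightarrow>\<^sub>0 nat) \<Rightarrow>\<^sub>0 'a\<close>; below it is evaluated
  by substituting for each variable the element that indexes it.\<close>

definition eval_tautological :: "(('a \<Rightarrow>\<^sub>0 nat) \<Rightarrow>\<^sub>0 'a) \<Rightarrow> 'a::comm_ring_1"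
  where "eval_tautological p = (\<Sum>m\<in>Poly_Mapping.keys p. Poly_Mapping.lookup p m *
    (\<Prod>x\<in>Poly_Mapping.keys m. x ^ Poly_Mapping.lookup m x))"

definition algebraically_independent :: "'a::comm_ring_1 set \<Rightarrow> 'a set \<Rightarrow> bool"
  where "algebraically_independent A S \<longleftrightarrow>
    (\<forall>p. (\<forall>m. Poly_Mapping.lookup p m \<in> A) \<and> (\<forall>m\<in>Poly_Mapping.keys p. Poly_Mapping.keys m \<subseteq> S) \<and>
         eval_tautological p = 0 \<longrightarrow> p = 0)"

text \<open>All infinite cardinalities are identified; every rank and transcendence degree that
  arises for a finitely generated domain is finite.\<close>

definition ecard :: "'a set \<Rightarrow> enat"
  where "ecard S = (if finite S then enat (card S) else \<infinity>)"

definition trdeg :: "'a::comm_ring_1 set \<Rightarrow> 'a set \<Rightarrow> enat"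
  where "trdeg B A = Sup (ecard ` {S. S \<subseteq> B \<and> algebraically_independent A S})"

definition purely_transcendental_over :: "'f::field set \<Rightarrow> enat \<Rightarrow> bool"
  where "purely_transcendental_over K d \<longleftrightarrow>
    (\<exists>S. algebraically_independent K S \<and>
         generate_field ring_of_type_algebra (K \<union> S) = UNIV \<and> ecard S = d)"


section \<open>Graded rings\<close>

text \<open>For a grading \<open>\<B>\<close> of the ring \<open>B\<close>, the sets defined below are, in usual notation,
  \<open>grading_group\<close> \<open>= G(B)\<close>, \<open>graded_part \<B> H\<close> \<open>= B^(H)\<close>, \<open>cotorsion_subgroups\<close> \<open>= T(B)\<close>,
  \<open>degree_group_off \<B> P\<close> \<open>=\<close> the group generated by the monoid \<open>M(B, P)\<close>, and, in the last section,
  \<open>nonrigid_subgroups\<close> \<open>= X(B)\<close>; \<open>cocyclic_overgroups H A\<close> above is \<open>H(H, A)\<close>.\<close>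

definition ring_grading :: "('g::ab_group_add \<Rightarrow> 'b::comm_ring_1 set) \<Rightarrow> bool"
  where "ring_grading \<B> \<longleftrightarrow>
    (\<forall>i. subgroup (\<B> i) additive_group) \<and>
    (\<forall>x. \<exists>!f :: 'g \<Rightarrow>\<^sub>0 'b. (\<forall>i. Poly_Mapping.lookup f i \<in> \<B> i) \<and>
       x = (\<Sum>i\<in>Poly_Mapping.keys f. Poly_Mapping.lookup f i)) \<and>
    (\<forall>i j. \<forall>x\<in>\<B> i. \<forall>y\<in>\<B> j. x * y \<in> \<B> (i + j))"

definition grading_group :: "('g::ab_group_add \<Rightarrow> 'b::comm_ring_1 set) \<Rightarrow> 'g set"
  where "grading_group \<B> = generate additive_group {i. \<B> i \<noteq> {0}}"

definition graded_part :: "('g::ab_group_add \<Rightarrow> 'b::comm_ring_1 set) \<Rightarrow> 'g set \<Rightarrow> 'b set"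
  where "graded_part \<B> H = {\<Sum>i\<in>Poly_Mapping.keys f. Poly_Mapping.lookup f i |f :: 'g \<Rightarrow>\<^sub>0 'b.
    Poly_Mapping.keys f \<subseteq> H \<and> (\<forall>i. Poly_Mapping.lookup f i \<in> \<B> i)}"

definition cotorsion_subgroups :: "('g::ab_group_add \<Rightarrow> 'b::comm_ring_1 set) \<Rightarrow> 'g set set"
  where "cotorsion_subgroups \<B> = {H. subgroup H additive_group \<and>
    torsion_group (quotient_group (grading_group \<B>) (H \<inter> grading_group \<B>))}"

definition degree_group_off ::
    "('g::ab_group_add \<Rightarrow> 'b::comm_ring_1 set) \<Rightarrow> 'b set \<Rightarrow> 'g set"
  where "degree_group_off \<B> P = generate additive_group {i. \<not> \<B> i \<subseteq> P}"

definition bar_grading_group :: "('g::ab_group_add \<Rightarrow> 'b::comm_ring_1 set) \<Rightarrow> 'g set"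
  where "bar_grading_group \<B> =
    (if (Spec1 :: 'b set set) = {} then grading_group \<B> else (\<Inter>P\<in>Spec1. degree_group_off \<B> P))"


section \<open>Locally nilpotent derivations\<close>

text \<open>Derivations of a subring \<open>A\<close> of the ambient ring; a function on \<open>A\<close> is represented by
  its extension by zero, so that it is determined by its values on \<open>A\<close>.\<close>

definition derivations :: "'b::comm_ring_1 set \<Rightarrow> ('b \<Rightarrow> 'b) set"
  where "derivations A = {D. (\<forall>x\<in>A. D x \<in> A) \<and> (\<forall>x. x \<notin> A \<longrightarrow> D x = 0) \<and>
    (\<forall>x\<in>A. \<forall>y\<in>A. D (x + y) = D x + D y \<and> D (x * y) = D x * y + x * D y)}"

definition LND :: "'b::comm_ring_1 set \<Rightarrow> ('b \<Rightarrow> 'b) set"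
  where "LND A = {D \<in> derivations A. \<forall>b\<in>A. \<exists>n>0. (D ^^ n) b = 0}"

definition rigid :: "'b::comm_ring_1 set \<Rightarrow> bool"
  where "rigid A \<longleftrightarrow> LND A = {\<lambda>_. 0}"

definition derivation_ker :: "('b::comm_ring_1 \<Rightarrow> 'b) \<Rightarrow> 'b set"
  where "derivation_ker D = {x. D x = 0}"

definition makar_limanov :: "'b::comm_ring_1 set"
  where "makar_limanov = (\<Inter>D\<in>LND UNIV. derivation_ker D)"

text \<open>Homogeneous elements of \<^term>\<open>LND (graded_part \<B> H)\<close>, the subring being graded by \<open>H\<close>.\<close>

definition HLND :: "('g::ab_group_add \<Rightarrow> 'b::comm_ring_1 set) \<Rightarrow> 'g set \<Rightarrow> ('b \<Rightarrow> 'b) set"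
  where "HLND \<B> H = {D \<in> LND (graded_part \<B> H). \<exists>d\<in>H. \<forall>i\<in>H. D ` \<B> i \<subseteq> \<B> (i + d)}"

definition nonrigid_subgroups :: "('g::ab_group_add \<Rightarrow> 'b::comm_ring_1 set) \<Rightarrow> 'g set set"
  where "nonrigid_subgroups \<B> = {H \<in> cotorsion_subgroups \<B>. HLND \<B> H \<noteq> {\<lambda>_. 0}}"

end

theory Submission
  imports Defs "Jordan_Normal_Form.Char_Poly"
begin

text \<open>Write \<open>A\<close> for the grading group \<open>G(B)\<close>, which is finitely generated, and let \<open>P\<close> be a
  height one prime such that \<open>A\<close> modulo the degree group off \<open>P\<close> is not torsion.  A subgroup
  \<open>H\<close> of \<open>A\<close> containing that degree group, with \<open>A/H\<close> infinite cyclic, is the kernel of a surjection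
  \<open>\<phi>\<close> from \<open>A\<close> to the integers.  For the induced integer grading, \<open>P\<close> contains all components of
  nonzero degree.  As \<open>B\<close> is normal and noetherian, the local ring at \<open>P\<close> is a discrete valuation ring;
  its uniformizer \<open>t\<close> can be taken homogeneous, and then every homogeneous element is, up to
  nonzero factors of degree \<open>0\<close>, a power of \<open>t\<close>.  Hence \<open>t\<close> has degree \<open>1\<close> or \<open>-1\<close>, after a change of sign
  the grading is nonnegative, and for a suitable common denominator \<open>s\<close> of degree \<open>0\<close> the map
  \<open>b \<mapsto> \<phi>(deg b) * s * b / t\<close> is a locally nilpotent derivation of \<open>B\<close> with kernel \<open>B^(H)\<close>.

  Only finitely many degree groups off height one primes occur, and the subgroups \<open>H\<close> above intersect
  in the torsion closure of the degree group; this gives the intersections of kernels.  Elements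
  homogeneous for the coarser grading by \<open>A/W\<close>, of degrees forming a basis of this
  free abelian group, are a transcendence basis of the fraction field over its part of degree \<open>0\<close>.
  For a cotorsion subgroup \<open>H\<close>, multiplying \<open>t\<close> and \<open>s\<close> by elements of the kernel and taking powers moves
  their degrees into \<open>H\<close>.\<close>

section \<open>Ideals\<close>

text \<open>The derivations sought act on B itself, so nothing is localised: a statement about the
  local ring at P is an identity in B with a factor s outside P. Noetherianity enters only as finite
  generation of P. Normality only excludes that g / f maps P locally into itself, where f lies in P
  and g spans the socle modulo f; otherwise g / f sends some generator of P to a unit, and that
  generator is the uniformizer.

  P need not be homogeneous for the grading by G, but it is for the integer grading by \<phi>: it
  contains all parts of nonzero degree, so with t it contains the components of t, and one of them
  is again a uniformizer. A further component, now for G, makes t homogeneous there. All values of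
  \<phi> are then multiples of the degree of t, and surjectivity of \<phi> makes that degree a unit.

  The denominator s depends at first on b. Finitely many generators suffice, because the x with
  \<open>s * euler \<phi> x\<close> divisible by t form a subring. Finiteness of the set of degree
  groups lets the torsion closure commute with the intersection in
  \<open>bar_grading_group\<close>.\<close>

lemma ring_of_type_algebra_simps [simp]:
  "carrier ring_of_type_algebra = UNIV" "x \<otimes>\<^bsub>ring_of_type_algebra\<^esub> y = x * y"
  "x \<oplus>\<^bsub>ring_of_type_algebra\<^esub> y = x + y" "\<one>\<^bsub>ring_of_type_algebra\<^esub> = 1"
  "\<zero>\<^bsub>ring_of_type_algebra\<^esub> = 0"
  by (simp_all add: ring_of_type_algebra_def)

lemma a_inv_ring_of_type_algebra [simp]: "\<ominus>\<^bsub>ring_of_type_algebra\<^esub> x = - (x::'a::comm_ring_1)"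
proof -
  interpret cring "ring_of_type_algebra :: 'a ring" by (rule cring_from_type_algebra)
  show ?thesis by (rule minus_equality) simp_all
qed

definition ideal_set :: "'a::comm_ring_1 set \<Rightarrow> bool"
  where "ideal_set I \<longleftrightarrow> 0 \<in> I \<and> (\<forall>x\<in>I. \<forall>y\<in>I. x + y \<in> I) \<and> (\<forall>r. \<forall>x\<in>I. r * x \<in> I)"

lemma ideal_setD:
  assumes "ideal_set I"
  shows "0 \<in> I" "x \<in> I \<Longrightarrow> y \<in> I \<Longrightarrow> x + y \<in> I" "x \<in> I \<Longrightarrow> r * x \<in> I" "x \<in> I \<Longrightarrow> x * r \<in> I"
  using assms unfolding ideal_set_def by (auto simp: mult.commute)

lemma ideal_set_sum: "ideal_set I \<Longrightarrow> (\<And>a. a \<in> A \<Longrightarrow> f a \<in> I) \<Longrightarrow> sum f A \<in> I"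
  by (induction A rule: infinite_finite_induct) (auto simp: ideal_setD)

lemma ideal_set_iff: "ideal_set I \<longleftrightarrow> ideal I (ring_of_type_algebra :: 'a::comm_ring_1 ring)"
proof
  interpret R: cring "ring_of_type_algebra :: 'a ring" by (rule cring_from_type_algebra)
  assume I: "ideal_set I"
  have "- x \<in> I" if "x \<in> I" for x using ideal_setD(3)[OF I that, of "-1"] by simp
  then have "subgroup I (add_monoid (ring_of_type_algebra :: 'a ring))"
    using I by (intro R.add.subgroupI)
      (auto simp: ideal_set_def a_inv_def[symmetric])
  then show "ideal I (ring_of_type_algebra :: 'a ring)"
    by (intro idealI R.ring_axioms) (auto simp: ideal_setD[OF I])
next
  assume "ideal I (ring_of_type_algebra :: 'a ring)"
  then interpret I: ideal I "ring_of_type_algebra :: 'a ring" .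
  show "ideal_set I"
    using additive_subgroup.zero_closed[OF I.is_additive_subgroup]
      additive_subgroup.a_closed[OF I.is_additive_subgroup] I.I_l_closed
    unfolding ideal_set_def by simp
qed

lemma prime_spectrum_iff:
  "P \<in> prime_spectrum \<longleftrightarrow> ideal_set P \<and> 1 \<notin> P \<and> (\<forall>x y. x * y \<in> P \<longrightarrow> x \<in> P \<or> y \<in> P)"
    (is "_ \<longleftrightarrow> ?r")
proof
  assume "P \<in> prime_spectrum"
  then have "primeideal P ring_of_type_algebra" by (simp add: prime_spectrum_def)
  then interpret primeideal P ring_of_type_algebra .
  have "1 \<notin> P" using one_imp_carrier I_notcarr by auto
  then show ?r using I_prime is_ideal by (simp add: ideal_set_iff)
next
  assume ?r
  then have "primeideal P ring_of_type_algebra"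
    by (intro primeidealI cring_from_type_algebra) (auto simp: ideal_set_iff)
  then show "P \<in> prime_spectrum" by (simp add: prime_spectrum_def)
qed

lemma prime_spectrumD:
  assumes "P \<in> prime_spectrum"
  shows "ideal_set P" "1 \<notin> P" "x * y \<in> P \<longleftrightarrow> x \<in> P \<or> y \<in> P" "0 \<in> P"
  using assms unfolding prime_spectrum_iff by (auto simp: ideal_setD)

lemma prime_spectrum_prod:
  "P \<in> prime_spectrum \<Longrightarrow> (\<And>a. a \<in> A \<Longrightarrow> f a \<notin> P) \<Longrightarrow> prod f A \<notin> P"
  by (induction A rule: infinite_finite_induct) (auto simp: prime_spectrumD)

lemma zero_in_prime_spectrum: "{0::'a::idom} \<in> prime_spectrum"
  by (auto simp: prime_spectrum_iff ideal_set_def)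

text \<open>Krull's argument: an ideal Q maximal among those that contain J and miss M is prime. If
  x and y lie outside Q, then Q + (x) and Q + (y) both meet M, and the product of two such elements
  lies in Q as soon as x * y does.\<close>

lemma prime_avoiding_multiplicative_set:
  fixes M :: "'a::comm_ring_1 set"
  assumes M: "1 \<in> M" "\<And>x y. x \<in> M \<Longrightarrow> y \<in> M \<Longrightarrow> x * y \<in> M"
    and J: "ideal_set J" "J \<inter> M = {}"
  obtains Q where "Q \<in> prime_spectrum" "J \<subseteq> Q" "Q \<inter> M = {}"
proof -
  define \<I> where "\<I> = {I. ideal_set I \<and> J \<subseteq> I \<and> I \<inter> M = {}}"
  have "\<exists>Q\<in>\<I>. \<forall>Z\<in>\<I>. Q \<subseteq> Z \<longrightarrow> Z = Q"
  proof (rule subset_Zorn_nonempty)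
    show "\<I> \<noteq> {}" using J by (auto simp: \<I>_def)
    fix C assume C: "C \<noteq> {}" "subset.chain \<I> C"
    then have sub: "C \<subseteq> \<I>" and tot: "\<And>Z Y. Z \<in> C \<Longrightarrow> Y \<in> C \<Longrightarrow> Z \<subseteq> Y \<or> Y \<subseteq> Z"
      by (auto simp: subset.chain_def)
    have idl: "ideal_set I" if "I \<in> C" for I using sub that by (auto simp: \<I>_def)
    have "ideal_set (\<Union>C)"
      unfolding ideal_set_def
    proof (intro conjI ballI allI)
      obtain I where "I \<in> C" using C(1) by blast
      then show "0 \<in> \<Union>C" using ideal_setD(1)[OF idl] by blast
    next
      fix x y assume "x \<in> \<Union>C" "y \<in> \<Union>C"
      then obtain I J where IJ: "I \<in> C" "J \<in> C" "x \<in> I" "y \<in> J" by blast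
      from tot[OF IJ(1,2)] show "x + y \<in> \<Union>C"
      proof
        assume "I \<subseteq> J"
        then have "x + y \<in> J" using IJ by (intro ideal_setD(2)[OF idl]) auto
        then show ?thesis using IJ by blast
      next
        assume "J \<subseteq> I"
        then have "x + y \<in> I" using IJ by (intro ideal_setD(2)[OF idl]) auto
        then show ?thesis using IJ by blast
      qed
    next
      fix r x assume "x \<in> \<Union>C"
      then obtain I where "I \<in> C" "x \<in> I" by blast
      then show "r * x \<in> \<Union>C" using ideal_setD(3)[OF idl] by blast
    qed
    then show "\<Union>C \<in> \<I>" using C(1) sub by (auto simp: \<I>_def)
  qed
  then obtain Q where Q: "Q \<in> \<I>" and max: "\<And>Z. Z \<in> \<I> \<Longrightarrow> Q \<subseteq> Z \<Longrightarrow> Z = Q" by blast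
  have QI: "ideal_set Q" and JQ: "J \<subseteq> Q" and QM: "Q \<inter> M = {}" using Q by (auto simp: \<I>_def)
  have ext: "\<exists>m\<in>M. \<exists>q\<in>Q. \<exists>r. m = q + r * x" if x: "x \<notin> Q" for x
  proof (rule ccontr)
    assume neg: "\<not> ?thesis"
    define Z where "Z = {q + r * x |q r. q \<in> Q}"
    have "ideal_set Z"
      unfolding ideal_set_def
    proof (intro conjI ballI allI)
      have "0 + 0 * x \<in> Z" unfolding Z_def using ideal_setD(1)[OF QI] by blast
      then show "0 \<in> Z" by simp
    next
      fix y z assume "y \<in> Z" "z \<in> Z"
      then obtain q r q' r' where "y = q + r * x" "z = q' + r' * x" "q \<in> Q" "q' \<in> Q"
        by (auto simp: Z_def)
      then have "y + z = (q + q') + (r + r') * x" "q + q' \<in> Q"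
        using QI by (auto simp: algebra_simps ideal_setD)
      then show "y + z \<in> Z" unfolding Z_def by blast
    next
      fix c y assume "y \<in> Z"
      then obtain q r where "y = q + r * x" "q \<in> Q" by (auto simp: Z_def)
      then have "c * y = c * q + (c * r) * x" "c * q \<in> Q"
        using QI by (auto simp: algebra_simps ideal_setD)
      then show "c * y \<in> Z" unfolding Z_def by blast
    qed
    moreover have QX: "Q \<subseteq> Z"
    proof
      fix q assume "q \<in> Q"
      then have "q + 0 * x \<in> Z" unfolding Z_def by blast
      then show "q \<in> Z" by simp
    qed
    moreover have "Z \<inter> M = {}" using neg by (auto simp: Z_def)
    ultimately have "Z \<in> \<I>" using JQ by (auto simp: \<I>_def)
    then have "Z = Q" using max QX by blast
    moreover have "0 + 1 * x \<in> Z" unfolding Z_def using ideal_setD(1)[OF QI] by blast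
    ultimately show False using x by simp
  qed
  have "x \<in> Q \<or> y \<in> Q" if xy: "x * y \<in> Q" for x y
  proof (rule ccontr)
    assume "\<not> ?thesis"
    then have "x \<notin> Q" "y \<notin> Q" by auto
    from ext[OF this(1)] ext[OF this(2)]
    obtain m q r m' q' r' where *: "m \<in> M" "q \<in> Q" "m = q + r * x" "m' \<in> M" "q' \<in> Q" "m' = q' + r' * y"
      by (elim bexE exE) (rule that)
    have "m * m' = q * m' + (r * x) * q' + (r * r') * (x * y)" using * by (simp add: algebra_simps)
    also have "\<dots> \<in> Q" using * xy by (intro ideal_setD(2)[OF QI]) (auto simp: ideal_setD[OF QI])
    finally show False using M(2)[OF *(1,4)] QM by blast
  qed
  then have "Q \<in> prime_spectrum" using QI QM M(1) by (auto simp: prime_spectrum_iff)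
  with JQ QM that show thesis by blast
qed

section \<open>Primes of height one in a domain\<close>

lemma Spec1_prime: "P \<in> Spec1 \<Longrightarrow> P \<in> prime_spectrum"
  by (simp add: Spec1_def)

text \<open>Otherwise {0}, Q, P would be a chain of length two below P.\<close>

lemma prime_below_Spec1:
  fixes P :: "'a::idom set"
  assumes P: "P \<in> Spec1" and Q: "Q \<in> prime_spectrum" "Q \<subseteq> P" "Q \<noteq> {0}"
  shows "Q = P"
proof (rule ccontr)
  assume "Q \<noteq> P"
  define c :: "nat \<Rightarrow> 'a set" where "c i = (if i = 0 then {0} else if i = 1 then Q else P)" for i
  have "c 2 = P \<and> (\<forall>i\<le>2. c i \<in> prime_spectrum) \<and> (\<forall>i<2. c i \<subset> c (Suc i))"
  proof (intro conjI allI impI)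
    show "c 2 = P" by (simp add: c_def)
    show "c i \<in> prime_spectrum" for i
      using Q(1) Spec1_prime[OF P] by (simp add: c_def zero_in_prime_spectrum)
    fix i :: nat assume "i < 2"
    then consider "i = 0" | "i = 1" by linarith
    then show "c i \<subset> c (Suc i)"
      by cases (use Q \<open>Q \<noteq> P\<close> prime_spectrumD(4)[OF Q(1)] in \<open>auto simp: c_def\<close>)
  qed
  then have "enat 2 \<le> height P" unfolding height_def by (intro Sup_upper) blast
  then show False using P by (simp add: Spec1_def one_enat_def)
qed

lemma Spec1_nonzero:
  fixes P :: "'a::idom set"
  assumes P: "P \<in> Spec1"
  obtains f where "f \<in> P" "f \<noteq> 0"
proof -
  have "P \<noteq> {0}"
  proof
    assume P0: "P = {0}"
    have "height P \<le> 0"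
      unfolding height_def
    proof (rule Sup_least)
      fix k assume "k \<in> {enat n |n. \<exists>c :: nat \<Rightarrow> 'a set.
        c n = P \<and> (\<forall>i\<le>n. c i \<in> prime_spectrum) \<and> (\<forall>i<n. c i \<subset> c (Suc i))}"
      then obtain n c where k: "k = enat n"
        and c: "c n = P" "\<forall>i\<le>n. c i \<in> prime_spectrum" "\<forall>i<n. c i \<subset> c (Suc i)"
        by blast
      have "n = 0"
      proof (rule ccontr)
        assume "n \<noteq> 0"
        then obtain m where m: "n = Suc m" using not0_implies_Suc by blast
        have "c m \<subset> {0}" "c m \<in> prime_spectrum"
          using c(1,2) c(3)[rule_format, of m] unfolding m P0 by auto
        then show False using prime_spectrumD(4) by blast
      qed
      then show "k \<le> 0" using k by (simp add: zero_enat_def)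
    qed
    then show False using P by (simp add: Spec1_def)
  qed
  then show thesis using that prime_spectrumD(4)[OF Spec1_prime[OF P]] by blast
qed

text \<open>Locally P is the only nonzero prime, hence the radical of f. If the multiplicative set
  of all s * x ^ n missed the ideal of f, some prime would contain f and miss that set; it would be
  nonzero and inside P, hence equal to P, and yet omit x.\<close>

lemma Spec1_power_multiple:
  fixes P :: "'a::idom set"
  assumes P: "P \<in> Spec1" and f: "f \<in> P" "f \<noteq> 0" and x: "x \<in> P"
  obtains s n c where "s \<notin> P" "s * x ^ n = f * c"
proof -
  note Pp = Spec1_prime[OF P]
  define M where "M = {s * x ^ n |s n. s \<notin> P}"
  have J: "ideal_set {f * c |c. True}"
    unfolding ideal_set_def
    by (auto intro: exI[of _ 0] simp: distrib_left[symmetric] mult.left_commute)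
  have "{f * c |c. True} \<inter> M \<noteq> {}"
  proof
    assume disj: "{f * c |c. True} \<inter> M = {}"
    have one: "s \<in> M" if "s \<notin> P" for s
    proof -
      have "s = s * x ^ 0" by simp
      with that show ?thesis unfolding M_def by blast
    qed
    have mult: "a * b \<in> M" if "a \<in> M" "b \<in> M" for a b
    proof -
      from that obtain s n s' n' where "a = s * x ^ n" "b = s' * x ^ n'" "s \<notin> P" "s' \<notin> P"
        by (auto simp: M_def)
      then have "a * b = (s * s') * x ^ (n + n')" "s * s' \<notin> P"
        by (auto simp: power_add algebra_simps prime_spectrumD[OF Pp])
      then show ?thesis unfolding M_def by blast
    qed
    obtain Q where Q: "Q \<in> prime_spectrum" "{f * c |c. True} \<subseteq> Q" "Q \<inter> M = {}"
      using prime_avoiding_multiplicative_set[OF one[OF prime_spectrumD(2)[OF Pp]] mult J disj] .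
    have "f * 1 \<in> Q" using Q(2) by blast
    then have "Q \<noteq> {0}" using f(2) by auto
    moreover have "Q \<subseteq> P" using Q(3) one by blast
    ultimately have "Q = P" using prime_below_Spec1[OF P Q(1)] by blast
    moreover have "1 * x ^ 1 \<in> M" unfolding M_def using prime_spectrumD(2)[OF Pp] by blast
    ultimately show False using x Q(3) by auto
  qed
  then obtain c s n where "f * c = s * x ^ n" "s \<notin> P" unfolding M_def by blast
  then show thesis using that[of s n c] by simp
qed


section \<open>Hilbert's basis theorem\<close>

text \<open>The coefficients form a subset of the ambient type, because the basis theorem is applied
  along a tower of subrings of B, adjoining one generator at a time.\<close>

inductive_set lin_span :: "'a::comm_ring_1 set \<Rightarrow> 'a set \<Rightarrow> 'a set" for A S where
  zero: "0 \<in> lin_span A S"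
| add: "a \<in> A \<Longrightarrow> s \<in> S \<Longrightarrow> x \<in> lin_span A S \<Longrightarrow> a * s + x \<in> lin_span A S"

definition subring_set :: "'a::comm_ring_1 set \<Rightarrow> bool"
  where "subring_set A \<longleftrightarrow> 1 \<in> A \<and> (\<forall>x\<in>A. \<forall>y\<in>A. x + y \<in> A \<and> x * y \<in> A) \<and> (\<forall>x\<in>A. - x \<in> A)"

lemma subring_setD:
  assumes "subring_set A"
  shows "0 \<in> A" "1 \<in> A" "x \<in> A \<Longrightarrow> y \<in> A \<Longrightarrow> x + y \<in> A" "x \<in> A \<Longrightarrow> y \<in> A \<Longrightarrow> x * y \<in> A"
    "x \<in> A \<Longrightarrow> - x \<in> A" "x \<in> A \<Longrightarrow> y \<in> A \<Longrightarrow> x - y \<in> A"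
proof -
  have "1 + - 1 \<in> A" using assms unfolding subring_set_def by blast
  then show "0 \<in> A" by simp
  show "x \<in> A \<Longrightarrow> y \<in> A \<Longrightarrow> x - y \<in> A"
    using assms unfolding subring_set_def diff_conv_add_uminus by blast
qed (use assms in \<open>auto simp: subring_set_def\<close>)

lemma subring_set_sum: "subring_set A \<Longrightarrow> (\<And>i. i \<in> Z \<Longrightarrow> f i \<in> A) \<Longrightarrow> sum f Z \<in> A"
  by (induction Z rule: infinite_finite_induct) (auto simp: subring_setD)

lemma lin_span_incl: "1 \<in> A \<Longrightarrow> s \<in> S \<Longrightarrow> s \<in> lin_span A S"
  by (metis lin_span.add lin_span.zero mult_1 add_0_right)

lemma lin_span_plus: "x \<in> lin_span A S \<Longrightarrow> y \<in> lin_span A S \<Longrightarrow> x + y \<in> lin_span A S"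
  by (induction rule: lin_span.induct) (auto simp: add.assoc intro: lin_span.intros)

lemma lin_span_mult: "subring_set A \<Longrightarrow> a \<in> A \<Longrightarrow> x \<in> lin_span A S \<Longrightarrow> a * x \<in> lin_span A S"
  by (rotate_tac 2, induction rule: lin_span.induct)
    (auto simp: distrib_left mult.assoc[symmetric] subring_setD intro: lin_span.intros)

lemma lin_span_sum: "(\<And>i. i \<in> Z \<Longrightarrow> f i \<in> lin_span A S) \<Longrightarrow> sum f Z \<in> lin_span A S"
  by (induction Z rule: infinite_finite_induct) (auto intro: lin_span_plus lin_span.zero)

lemma lin_span_mono: "S \<subseteq> T \<Longrightarrow> x \<in> lin_span A S \<Longrightarrow> x \<in> lin_span A T"
  by (rotate_tac 1, induction rule: lin_span.induct) (auto intro: lin_span.intros)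

lemma lin_span_closed:
  "x \<in> lin_span A S \<Longrightarrow> 0 \<in> J \<Longrightarrow> (\<And>y z. y \<in> J \<Longrightarrow> z \<in> J \<Longrightarrow> y + z \<in> J) \<Longrightarrow>
    (\<And>a s. a \<in> A \<Longrightarrow> s \<in> S \<Longrightarrow> a * s \<in> J) \<Longrightarrow> x \<in> J"
  by (induction rule: lin_span.induct) auto

lemma lin_span_finite_image:
  assumes "x \<in> lin_span A (g ` I)" "finite I" "subring_set A"
  shows "\<exists>c. (\<forall>i. c i \<in> A) \<and> x = (\<Sum>i\<in>I. c i * g i)"
  using assms(1)
proof induction
  case zero
  then show ?case using subring_setD(1)[OF assms(3)] by (intro exI[of _ "\<lambda>_. 0"]) simp
next
  case (add a s x)
  then obtain c i where c: "\<forall>i. c i \<in> A" "x = (\<Sum>i\<in>I. c i * g i)" and i: "i \<in> I" "s = g i" by blast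
  have "(\<Sum>j\<in>I. (if j = i then a + c j else c j) * g j)
      = (\<Sum>j\<in>I. c j * g j + (if j = i then a * g i else 0))"
    by (rule sum.cong) (auto simp: algebra_simps)
  also have "\<dots> = a * s + x" using i assms(2) by (simp add: sum.distrib c)
  finally show ?case
    using add c subring_setD(3)[OF assms(3)]
    by (intro exI[of _ "\<lambda>j. if j = i then a + c j else c j"]) auto
qed

text \<open>Equivalent to the finite generation of all ideals of \<open>A\<close>.\<close>

definition noetherian_set :: "'a::comm_ring_1 set \<Rightarrow> bool"
  where "noetherian_set A \<longleftrightarrow> (\<forall>x::nat \<Rightarrow> 'a. range x \<subseteq> A \<longrightarrow> (\<exists>n. x n \<in> lin_span A (x ` {..<n})))"

text \<open>Dependent choice in which a term may depend on the set of all its predecessors. It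
  produces sequences none of whose terms lies in the span of the earlier ones, which noetherianity
  forbids.\<close>

lemma sequence_choice:
  assumes "\<And>S. finite S \<Longrightarrow> S \<subseteq> J \<Longrightarrow> \<exists>r\<in>J. Q S r"
  shows "\<exists>f::nat \<Rightarrow> 'a. \<forall>n. f n \<in> J \<and> Q (f ` {..<n}) (f n)"
proof (rule dependent_wf_choice[of "{(m, n). m < n}"])
  show "wf {(m::nat, n). m < n}" by (rule wf)
  fix f g :: "nat \<Rightarrow> 'a" and n r
  assume "\<And>z. (z, n) \<in> {(m, n). m < n} \<Longrightarrow> f z = g z"
  then have "f ` {..<n} = g ` {..<n}" by (intro image_cong) auto
  then show "(r \<in> J \<and> Q (f ` {..<n}) r) = (r \<in> J \<and> Q (g ` {..<n}) r)" by simp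
next
  fix n and f :: "nat \<Rightarrow> 'a"
  assume "\<And>y. (y, n) \<in> {(m, n). m < n} \<Longrightarrow> f y \<in> J \<and> Q (f ` {..<y}) (f y)"
  then have "f ` {..<n} \<subseteq> J" by auto
  from assms[OF _ this] show "\<exists>r. r \<in> J \<and> Q (f ` {..<n}) r" by blast
qed

lemma noetherian_set_finitely_generated:
  assumes A: "noetherian_set A" "subring_set A" "J \<subseteq> A"
  obtains S where "finite S" "S \<subseteq> J" "J \<subseteq> lin_span A S"
proof (rule ccontr)
  note obt = that
  assume neg: "\<not> thesis"
  have "\<exists>f. \<forall>n::nat. f n \<in> J \<and> f n \<notin> lin_span A (f ` {..<n})"
  proof (rule sequence_choice)
    fix S assume "finite S" "S \<subseteq> J"
    then have "\<not> J \<subseteq> lin_span A S" using obt neg by metis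
    then show "\<exists>r\<in>J. r \<notin> lin_span A S" by auto
  qed
  then obtain f where f: "\<And>n::nat. f n \<in> J \<and> f n \<notin> lin_span A (f ` {..<n})" by auto
  then have "range f \<subseteq> A" using A(3) by auto
  then obtain n where "f n \<in> lin_span A (f ` {..<n})"
    using A(1) unfolding noetherian_set_def by meson
  with f show False by simp
qed

definition polys_over :: "'a::comm_ring_1 set \<Rightarrow> 'a poly set"
  where "polys_over A = {p. \<forall>i. coeff p i \<in> A}"

lemma subring_set_polys_over:
  assumes "subring_set A" shows "subring_set (polys_over A)"
  unfolding subring_set_def
proof (intro conjI ballI)
  show "1 \<in> polys_over A"
    using assms by (auto simp: polys_over_def one_pCons coeff_pCons subring_setD split: nat.splits)
  fix p assume p: "p \<in> polys_over A"
  then show "- p \<in> polys_over A" using assms by (simp add: polys_over_def subring_setD)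
  fix q assume q: "q \<in> polys_over A"
  show "p + q \<in> polys_over A" using assms p q by (simp add: polys_over_def subring_setD)
  have "coeff (p * q) n \<in> A" for n
    unfolding coeff_mult using assms p q
    by (intro subring_set_sum[OF assms] subring_setD(4)[OF assms]) (simp_all add: polys_over_def)
  then show "p * q \<in> polys_over A" by (simp add: polys_over_def)
qed

text \<open>The classical argument: pick polynomials of minimal degree outside the span of the previous
  ones; a relation between their leading coefficients lowers the degree of the last one.\<close>

lemma polys_over_finitely_generated:
  assumes A: "noetherian_set A" "subring_set A" and J: "J \<subseteq> polys_over A"
    "\<And>p q. p \<in> J \<Longrightarrow> q \<in> J \<Longrightarrow> p - q \<in> J" "\<And>p q. p \<in> polys_over A \<Longrightarrow> q \<in> J \<Longrightarrow> p * q \<in> J" "0 \<in> J"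
  obtains S where "finite S" "S \<subseteq> J" "J \<subseteq> lin_span (polys_over A) S"
proof (rule ccontr)
  let ?P = "polys_over A"
  note P = subring_set_polys_over[OF A(2)] and obt = that
  assume neg: "\<not> thesis"
  have choice: "\<exists>r\<in>J. r \<notin> lin_span ?P S \<and> (\<forall>q\<in>J. q \<notin> lin_span ?P S \<longrightarrow> degree r \<le> degree q)"
    if S: "finite S" "S \<subseteq> J" for S
  proof -
    have "\<not> J \<subseteq> lin_span ?P S" using neg S obt by metis
    then obtain r0 where "r0 \<in> J \<and> r0 \<notin> lin_span ?P S" by auto
    from ex_has_least_nat[of "\<lambda>r. r \<in> J \<and> r \<notin> lin_span ?P S", OF this, of degree]
    show ?thesis by auto
  qed
  have "\<exists>f. \<forall>n::nat. f n \<in> J \<and> f n \<notin> lin_span ?P (f ` {..<n}) \<and>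
    (\<forall>q\<in>J. q \<notin> lin_span ?P (f ` {..<n}) \<longrightarrow> degree (f n) \<le> degree q)"
    using choice by (intro sequence_choice)
  then obtain f where *: "\<forall>n::nat. f n \<in> J \<and> f n \<notin> lin_span ?P (f ` {..<n}) \<and>
    (\<forall>q\<in>J. q \<notin> lin_span ?P (f ` {..<n}) \<longrightarrow> degree (f n) \<le> degree q)" by (rule exE)
  have f: "f n \<in> J" "f n \<notin> lin_span ?P (f ` {..<n})"
    "q \<in> J \<Longrightarrow> q \<notin> lin_span ?P (f ` {..<n}) \<Longrightarrow> degree (f n) \<le> degree q" for n q
    using spec[OF *, of n] by auto
  have "range (\<lambda>n. lead_coeff (f n)) \<subseteq> A" using f(1) J(1) by (auto simp: polys_over_def)
  then obtain n where "lead_coeff (f n) \<in> lin_span A ((\<lambda>n. lead_coeff (f n)) ` {..<n})"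
    using A(1) unfolding noetherian_set_def by meson
  then obtain c where c: "\<And>i. c i \<in> A" "lead_coeff (f n) = (\<Sum>i<n. c i * lead_coeff (f i))"
    using lin_span_finite_image[OF _ _ A(2)] by blast
  \<comment> \<open>\<open>f n\<close> was already a candidate when \<open>f i\<close> was chosen
    with minimal degree.\<close>
  have deg: "degree (f i) \<le> degree (f n)" if "i < n" for i
  proof (rule f(3)[OF f(1)])
    show "f n \<notin> lin_span ?P (f ` {..<i})"
      using f(2)[of n] lin_span_mono[of "f ` {..<i}" "f ` {..<n}"] that by fastforce
  qed
  \<comment> \<open>The factor \<open>g i\<close> lifts \<open>f i\<close> to the degree of
    \<open>f n\<close>. Then \<open>h\<close> has the leading coefficient of \<open>f n\<close> in
    that degree, so \<open>f n - h\<close> has smaller degree or is 0.\<close>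
  define g where "g i = monom (c i) (degree (f n) - degree (f i))" for i
  define h where "h = (\<Sum>i<n. g i * f i)"
  have gP: "g i \<in> ?P" for i using c(1) subring_setD(1)[OF A(2)] by (auto simp: g_def polys_over_def)
  have h_span: "h \<in> lin_span ?P (f ` {..<n})"
    unfolding h_def by (intro lin_span_sum lin_span_mult[OF P gP] lin_span_incl) (auto simp: subring_setD[OF P])
  have Jplus: "p + q \<in> J" if "p \<in> J" "q \<in> J" for p q
    using J(2)[OF that(1) J(2)[OF J(4) that(2)]] by simp
  have h_J: "h \<in> J"
    using h_span by (rule lin_span_closed) (use J f(1) Jplus in auto)
  have dg: "degree (g i * f i) \<le> degree (f n)" if "i < n" for i
    using deg[OF that] degree_monom_le[of "c i" "degree (f n) - degree (f i)"]
    unfolding g_def by (intro order.trans[OF degree_mult_le]) linarith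
  have "degree h \<le> degree (f n)" unfolding h_def by (intro degree_sum_le) (use dg in auto)
  moreover have "coeff h (degree (f n)) = lead_coeff (f n)"
    unfolding h_def coeff_sum c(2) g_def by (intro sum.cong) (auto simp: coeff_monom_mult deg)
  ultimately have *: "degree (f n - h) \<le> degree (f n)" "coeff (f n - h) (degree (f n)) = 0"
    by (auto intro: degree_diff_le)
  have notin: "f n - h \<notin> lin_span ?P (f ` {..<n})"
    using f(2)[of n] lin_span_plus[OF _ h_span, of "f n - h"] by auto
  then have "degree (f n) \<le> degree (f n - h)" by (intro f(3) J(2) f(1) h_J)
  with * have "f n - h = 0" by (metis le_antisym leading_coeff_0_iff)
  with notin show False by (simp add: lin_span.zero)
qed

definition adjoin :: "'a::comm_ring_1 set \<Rightarrow> 'a \<Rightarrow> 'a set"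
  where "adjoin A b = (\<lambda>p. poly p b) ` polys_over A"

lemma subring_set_adjoin:
  assumes "subring_set A" shows "subring_set (adjoin A b)"
  unfolding subring_set_def
proof (intro conjI ballI)
  note P = subring_set_polys_over[OF assms]
  show "1 \<in> adjoin A b" unfolding adjoin_def using subring_setD(2)[OF P] by (intro image_eqI[of _ _ 1]) auto
  fix x assume "x \<in> adjoin A b"
  then obtain p where p: "x = poly p b" "p \<in> polys_over A" unfolding adjoin_def by blast
  show "- x \<in> adjoin A b" unfolding adjoin_def
    using subring_setD(5)[OF P] p by (intro image_eqI[of _ _ "- p"]) auto
  fix y assume "y \<in> adjoin A b"
  then obtain q where q: "y = poly q b" "q \<in> polys_over A" unfolding adjoin_def by blast
  show "x + y \<in> adjoin A b" unfolding adjoin_def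
    using subring_setD(3)[OF P] p q by (intro image_eqI[of _ _ "p + q"]) auto
  show "x * y \<in> adjoin A b" unfolding adjoin_def
    using subring_setD(4)[OF P] p q by (intro image_eqI[of _ _ "p * q"]) auto
qed

lemma adjoin_superset: assumes "subring_set A" shows "insert b A \<subseteq> adjoin A b"
proof -
  have "poly [:0, 1:] b \<in> adjoin A b" unfolding adjoin_def
    by (intro imageI) (auto simp: polys_over_def coeff_pCons subring_setD[OF assms] split: nat.splits)
  moreover have "poly [:a:] b \<in> adjoin A b" if "a \<in> A" for a unfolding adjoin_def
    using that by (intro imageI) (auto simp: polys_over_def coeff_pCons subring_setD[OF assms] split: nat.splits)
  ultimately show ?thesis by auto
qed

text \<open>Evaluation at b presents A[b] as a quotient of A[X]. The ideal spanned by a sequence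
  pulls back to an ideal J of polynomials, which is finitely generated; each generator needs only
  finitely many terms of the sequence, so one n serves for all.\<close>

lemma noetherian_set_adjoin:
  assumes A: "noetherian_set A" "subring_set A"
  shows "noetherian_set (adjoin A b)"
  unfolding noetherian_set_def
proof (intro allI impI)
  fix x :: "nat \<Rightarrow> 'a" assume x: "range x \<subseteq> adjoin A b"
  let ?B = "adjoin A b" and ?P = "polys_over A"
  note P = subring_set_polys_over[OF A(2)] and B = subring_set_adjoin[OF A(2), of b]
  define J where "J = {p \<in> ?P. poly p b \<in> lin_span ?B (range x)}"
  have ev: "poly p b \<in> ?B" if "p \<in> ?P" for p using that by (auto simp: adjoin_def)
  have J_mult: "p * q \<in> J" if "p \<in> ?P" "q \<in> J" for p q
    using that ev by (auto simp: J_def subring_setD[OF P] intro: lin_span_mult[OF B])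
  have J_diff: "p - q \<in> J" if "p \<in> J" "q \<in> J" for p q
  proof -
    have "poly p b + (- 1) * poly q b \<in> lin_span ?B (range x)"
      using that by (intro lin_span_plus lin_span_mult[OF B]) (auto simp: J_def subring_setD[OF B])
    then show ?thesis using that by (auto simp: J_def subring_setD[OF P])
  qed
  have "0 \<in> J" by (auto simp: J_def subring_setD[OF P] lin_span.zero)
  then obtain S where S: "finite S" "S \<subseteq> J" "J \<subseteq> lin_span ?P S"
    using polys_over_finitely_generated[OF A _ J_diff J_mult] by (auto simp: J_def)
  have fin: "\<exists>N. y \<in> lin_span ?B (x ` {..<N})" if "y \<in> lin_span ?B (range x)" for y
    using that
  proof induction
    case (add a s y)
    then obtain N i where "y \<in> lin_span ?B (x ` {..<N})" "s = x i" by blast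
    then have "a * s + y \<in> lin_span ?B (x ` {..<max N (Suc i)})"
      using add(1) by (intro lin_span.add) (auto elim: lin_span_mono[rotated])
    then show ?case by blast
  qed (auto intro: lin_span.zero)
  have "\<forall>p\<in>S. \<exists>N. poly p b \<in> lin_span ?B (x ` {..<N})"
    using S(2) fin by (auto simp: J_def)
  then obtain N where N: "\<And>p. p \<in> S \<Longrightarrow> poly p b \<in> lin_span ?B (x ` {..<N p})" by metis
  define n where "n = Max (insert 0 (N ` S))"
  have n: "poly p b \<in> lin_span ?B (x ` {..<n})" if "p \<in> S" for p
  proof (rule lin_span_mono[OF _ N[OF that]])
    have "N p \<le> n" unfolding n_def using that S(1) by (intro Max_ge) auto
    then show "x ` {..<N p} \<subseteq> x ` {..<n}" by (intro image_mono) auto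
  qed
  obtain p where p: "x n = poly p b" "p \<in> ?P" using x by (auto simp: adjoin_def)
  have "x n \<in> lin_span ?B (range x)" by (rule lin_span_incl) (auto simp: subring_setD[OF B])
  with p have "p \<in> lin_span ?P S" using S(3) by (auto simp: J_def)
  then have "poly p b \<in> lin_span ?B (x ` {..<n})"
    by induction (auto intro!: lin_span_plus lin_span_mult[OF B] n ev lin_span.zero)
  then show "\<exists>n. x n \<in> lin_span ?B (x ` {..<n})" using p(1) by metis
qed

section \<open>Finitely generated algebras over a field\<close>

lemma affine_algebra_hom:
  assumes "affine_algebra \<iota>"
  shows "\<iota> (x + y) = \<iota> x + \<iota> y" "\<iota> (x * y) = \<iota> x * \<iota> y" "\<iota> 1 = 1" "\<iota> 0 = 0" "\<iota> (- x) = - \<iota> x"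
proof -
  have \<iota>: "\<iota> \<in> Ring.ring_hom ring_of_type_algebra ring_of_type_algebra"
    using assms by (simp add: affine_algebra_def)
  show add: "\<iota> (x + y) = \<iota> x + \<iota> y" for x y using \<iota> by (simp add: Ring.ring_hom_def)
  show "\<iota> (x * y) = \<iota> x * \<iota> y" "\<iota> 1 = 1" using \<iota> by (simp_all add: Ring.ring_hom_def)
  show "\<iota> 0 = 0" using add[of 0 0] by simp
  then show "\<iota> (- x) = - \<iota> x" using add[of "- x" x] by (simp add: eq_neg_iff_add_eq_0)
qed

text \<open>Generation in the form of an induction principle: a property holds on all of B once the
  elements having it form a subring that contains the scalars and a finite set of
  generators.\<close>

lemma affine_algebra_generators:
  fixes \<iota> :: "'k::field \<Rightarrow> 'b::comm_ring_1"
  assumes "affine_algebra \<iota>"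
  obtains S where "finite S" "\<And>A. subring_set A \<Longrightarrow> range \<iota> \<subseteq> A \<Longrightarrow> S \<subseteq> A \<Longrightarrow> A = UNIV"
proof -
  obtain S where S: "finite S" "generate_ring ring_of_type_algebra (range \<iota> \<union> S) = UNIV"
    using assms by (auto simp: affine_algebra_def)
  have "A = UNIV" if A: "subring_set A" "range \<iota> \<subseteq> A" "S \<subseteq> A" for A
  proof -
    have "x \<in> A" if "x \<in> generate_ring ring_of_type_algebra (range \<iota> \<union> S)" for x
      using that by induction (use A in \<open>auto simp: subring_setD[OF A(1)]\<close>)
    then show ?thesis using S(2) by auto
  qed
  with S(1) that show thesis by simp
qed

lemma affine_noetherian:
  fixes \<iota> :: "'k::field \<Rightarrow> 'b::comm_ring_1"
  assumes aff: "affine_algebra \<iota>"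
  shows "noetherian_set (UNIV :: 'b set)"
proof -
  note \<iota>_simps = affine_algebra_hom[OF aff]
  obtain S where S: "finite S" "\<And>A. subring_set A \<Longrightarrow> range \<iota> \<subseteq> A \<Longrightarrow> S \<subseteq> A \<Longrightarrow> A = UNIV"
    using affine_algebra_generators[OF aff] by metis
  have sub: "subring_set (range \<iota>)"
    unfolding subring_set_def
    by (auto simp: \<iota>_simps(1,2,5)[symmetric] \<iota>_simps(3) intro: range_eqI[of _ _ 1])
  have "noetherian_set (range \<iota>)"
    unfolding noetherian_set_def
  proof (intro allI impI)
    fix x :: "nat \<Rightarrow> 'b" assume x: "range x \<subseteq> range \<iota>"
    \<comment> \<open>For a field the first two terms decide: a zero first term is in the span of
      the empty set, and otherwise the second term is a multiple of the first.\<close>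
    show "\<exists>n. x n \<in> lin_span (range \<iota>) (x ` {..<n})"
    proof (cases "x 0 = 0")
      case True
      then show ?thesis by (intro exI[of _ 0]) (simp add: lin_span.zero)
    next
      case False
      obtain a b where ab: "x 0 = \<iota> a" "x 1 = \<iota> b" using x by (meson rangeI subsetD rangeE)
      then have "a \<noteq> 0" using False \<iota>_simps(4) by auto
      then have "\<iota> (b / a) * x 0 + 0 = x 1" unfolding ab by (simp add: \<iota>_simps(2)[symmetric])
      moreover have "\<iota> (b / a) * x 0 + 0 \<in> lin_span (range \<iota>) (x ` {..<1})"
        by (intro lin_span.intros) auto
      ultimately show ?thesis by metis
    qed
  qed
  from S(1) this sub have "\<exists>A. noetherian_set A \<and> subring_set A \<and> range \<iota> \<union> S \<subseteq> A"
  proof (induction S)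
    case (insert b S)
    then obtain A where A: "noetherian_set A" "subring_set A" "range \<iota> \<union> S \<subseteq> A" by auto
    have "range \<iota> \<union> insert b S \<subseteq> adjoin A b"
      using A(3) adjoin_superset[OF A(2), of b] by auto
    then show ?case using noetherian_set_adjoin[OF A(1,2)] subring_set_adjoin[OF A(2)] by metis
  qed auto
  then obtain A where A: "noetherian_set A" "subring_set A" "range \<iota> \<subseteq> A" "S \<subseteq> A" by auto
  from S(2)[OF A(2-4)] A(1) show ?thesis by simp
qed

section \<open>The local ring at a height one prime of a normal noetherian domain\<close>

interpretation to_fract_hom: comm_ring_hom "to_fract :: 'a::idom \<Rightarrow> 'a fract"
  by unfold_locales auto

text \<open>\<open>g\<close> generates the socle of the localisation at \<open>P\<close> modulo \<open>f\<close>.\<close>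

lemma Spec1_socle:
  fixes P :: "'a::idom set"
  assumes P: "P \<in> Spec1" and f: "f \<in> P" "f \<noteq> 0" and S: "finite S" "S \<subseteq> P"
  shows "\<exists>g. (\<forall>s c. s \<notin> P \<longrightarrow> s * g \<noteq> f * c) \<and> (\<forall>p\<in>S. \<exists>s c. s \<notin> P \<and> s * (g * p) = f * c)"
  using S
proof (induction S)
  case empty
  have "s * 1 \<noteq> f * c" if "s \<notin> P" for s c
    using that f(1) ideal_setD(4)[OF prime_spectrumD(1)[OF Spec1_prime[OF P]] f(1), of c] by auto
  then show ?case by (intro exI[of _ 1]) auto
next
  case (insert p S)
  then obtain g where g: "\<forall>s c. s \<notin> P \<longrightarrow> s * g \<noteq> f * c"
    "\<forall>p\<in>S. \<exists>s c. s \<notin> P \<and> s * (g * p) = f * c" by auto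
  define G where "G m \<longleftrightarrow> (\<exists>s c. s \<notin> P \<and> s * (g * p ^ m) = f * c)" for m
  have "p \<in> P" using insert by auto
  from Spec1_power_multiple[OF P f this]
  obtain s n c where snc: "s \<notin> P" "s * p ^ n = f * c" by metis
  have "s * (g * p ^ n) = f * (g * c)" using arg_cong[OF snc(2), of "\<lambda>x. g * x"] by (simp add: algebra_simps)
  then have "G n" unfolding G_def using snc(1) by metis
  moreover have "\<not> G 0" using g(1) by (auto simp: G_def)
  \<comment> \<open>\<open>m\<close> is the last exponent for which g * p ^ m is not yet a local
    multiple of f.\<close>
  ultimately have "\<exists>m. \<not> G m \<and> G (Suc m)" by (induction n) auto
  then obtain m where m: "\<not> G m" "G (Suc m)" by auto
  have 1: "\<forall>s c. s \<notin> P \<longrightarrow> s * (g * p ^ m) \<noteq> f * c" using m(1) unfolding G_def by metis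
  have 2: "\<exists>s c. s \<notin> P \<and> s * (g * p ^ m * q) = f * c" if q: "q \<in> insert p S" for q
  proof (cases "q = p")
    case True
    then show ?thesis using m(2) by (simp add: G_def algebra_simps)
  next
    case False
    then have "q \<in> S" using q by simp
    then obtain s c where sc: "s \<notin> P" "s * (g * q) = f * c" using g(2) by metis
    have "s * (g * p ^ m * q) = f * (c * p ^ m)"
      using arg_cong[OF sc(2), of "\<lambda>x. x * p ^ m"] by (simp add: algebra_simps)
    then show ?thesis using sc(1) by metis
  qed
  show ?case by (rule exI[of _ "g * p ^ m"], rule conjI[OF 1], rule ballI, rule 2)
qed

text \<open>The determinant trick: the vector of the \<open>p i\<close> is an eigenvector with
  eigenvalue x of a matrix over B, so x is a root of a monic characteristic polynomial.\<close>

lemma integral_over_normal_domain: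
  fixes p :: "nat \<Rightarrow> 'b::idom" and x :: "'b fract"
  assumes normal: "normal_domain TYPE('b)"
    and rel: "\<And>i. i < n \<Longrightarrow> x * to_fract (p i) = (\<Sum>j<n. to_fract (a i j) * to_fract (p j))"
    and nz: "k < n" "p k \<noteq> 0"
  shows "x \<in> range to_fract"
proof -
  define A where "A = mat n n (\<lambda>(i, j). a i j)"
  define v where "v = vec n (\<lambda>i. to_fract (p i))"
  have A: "A \<in> carrier_mat n n" by (simp add: A_def)
  have Af: "map_mat to_fract A \<in> carrier_mat n n" using A by simp
  have "eigenvector (map_mat to_fract A) v x"
    unfolding eigenvector_def
  proof (intro conjI)
    show "v \<in> carrier_vec (dim_row (map_mat to_fract A))" by (simp add: v_def A_def)
    have "v $ k \<noteq> 0" using nz by (simp add: v_def)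
    then show "v \<noteq> 0\<^sub>v (dim_row (map_mat to_fract A))" using nz(1) by (auto simp: A_def)
    show "map_mat to_fract A *\<^sub>v v = x \<cdot>\<^sub>v v"
      by (rule eq_vecI) (auto simp: A_def v_def scalar_prod_def rel lessThan_atLeast0)
  qed
  then have "eigenvalue (map_mat to_fract A) x" by (auto simp: eigenvalue_def)
  then have "poly (char_poly (map_mat to_fract A)) x = 0"
    using eigenvalue_root_char_poly[OF Af] by simp
  then have "poly (map_poly to_fract (char_poly A)) x = 0"
    by (simp add: to_fract_hom.char_poly_hom[OF A])
  moreover have "lead_coeff (char_poly A) = 1" using degree_monic_char_poly[OF A] by simp
  ultimately show ?thesis using normal unfolding normal_domain_def by metis
qed

text \<open>With g from the socle modulo f, the module (g / f) P lies in the local ring. If it lies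
  in the maximal ideal, g / f stabilises a finitely generated module, is integral, and normality
  makes g a local multiple of f, which the choice of g excludes. Otherwise some generator p of P
  goes to a unit, and each b in P equals p times (g / f) b up to a unit.\<close>

lemma Spec1_uniformizer:
  fixes P :: "'b::idom set"
  assumes normal: "normal_domain TYPE('b)" and noeth: "noetherian_set (UNIV :: 'b set)"
    and P: "P \<in> Spec1"
  obtains t where "t \<in> P" "t \<noteq> 0" "\<And>b. b \<in> P \<Longrightarrow> \<exists>s c. s \<notin> P \<and> s * b = t * c"
proof -
  note Pp = Spec1_prime[OF P] and Pi = prime_spectrumD(1)[OF Spec1_prime[OF P]]
  have sub: "subring_set (UNIV :: 'b set)" by (simp add: subring_set_def)
  obtain f where f: "f \<in> P" "f \<noteq> 0" using Spec1_nonzero[OF P] by metis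
  obtain S where S: "finite S" "S \<subseteq> P" "P \<subseteq> lin_span UNIV S"
    using noetherian_set_finitely_generated[OF noeth sub subset_UNIV] by metis
  obtain ps where ps: "set ps = S" using finite_list[OF S(1)] by metis
  define n where "n = length ps"
  have Sn: "S = (!) ps ` {..<n}" unfolding ps[symmetric] n_def by (auto simp: set_conv_nth)
  have gen: "\<exists>\<beta>. b = (\<Sum>j<n. \<beta> j * ps ! j)" if "b \<in> P" for b
  proof -
    have "b \<in> lin_span UNIV ((!) ps ` {..<n})" using that S(3) Sn by auto
    from lin_span_finite_image[OF this _ sub] show ?thesis by auto
  qed
  have psP: "ps ! i \<in> P" if "i < n" for i using that S(2) Sn by auto
  obtain g where g: "\<And>s c. s \<notin> P \<Longrightarrow> s * g \<noteq> f * c"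
    "\<And>p. p \<in> S \<Longrightarrow> \<exists>s c. s \<notin> P \<and> s * (g * p) = f * c"
    using Spec1_socle[OF P f S(1,2)] by metis
  obtain s0 c0 where s0: "\<And>p. p \<in> S \<Longrightarrow> s0 p \<notin> P \<and> s0 p * (g * p) = f * c0 p"
    using g(2) by metis
  \<comment> \<open>A common denominator outside P for the finitely many generators.\<close>
  define s where "s = prod s0 S"
  have sP: "s \<notin> P" unfolding s_def by (rule prime_spectrum_prod[OF Pp]) (use s0 in auto)
  have "\<exists>c. s * (g * p) = f * c" if p: "p \<in> S" for p
  proof -
    have "s = s0 p * prod s0 (S - {p})" unfolding s_def using S(1) p by (rule prod.remove)
    then have "s * (g * p) = (s0 p * (g * p)) * prod s0 (S - {p})" by (simp add: algebra_simps)
    also have "\<dots> = f * (c0 p * prod s0 (S - {p}))" using s0[OF p] by simp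
    finally show ?thesis by blast
  qed
  then have "\<exists>c. s * (g * ps ! i) = f * c" if "i < n" for i using that Sn by auto
  then obtain c where c: "\<And>i. i < n \<Longrightarrow> s * (g * ps ! i) = f * c i" by metis
  have sg: "s * g \<noteq> 0" using g(1)[OF sP, of 0] by simp
  show thesis
  proof (cases "\<forall>i<n. c i \<in> P")
    case True
    then have "\<forall>i<n. \<exists>\<beta>. c i = (\<Sum>j<n. \<beta> j * ps ! j)" using gen by auto
    then obtain a where a: "\<And>i. i < n \<Longrightarrow> c i = (\<Sum>j<n. a i j * ps ! j)" by metis
    obtain k where k: "k < n" "ps ! k \<noteq> 0"
    proof (rule ccontr)
      assume "\<not> thesis"
      then have "\<forall>k<n. ps ! k = 0" using that by auto
      moreover obtain \<beta> where "f = (\<Sum>j<n. \<beta> j * ps ! j)" using gen[OF f(1)] by auto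
      ultimately show False using f(2) by simp
    qed
    define x where "x = to_fract (s * g) / to_fract f"
    have "x * to_fract (ps ! i) = (\<Sum>j<n. to_fract (a i j) * to_fract (ps ! j))" if "i < n" for i
    proof -
      have "x * to_fract (ps ! i) = to_fract (s * (g * ps ! i)) / to_fract f" by (simp add: x_def)
      also have "\<dots> = to_fract (c i)" using f(2) by (simp add: c[OF that])
      also have "\<dots> = (\<Sum>j<n. to_fract (a i j) * to_fract (ps ! j))"
        by (simp add: a[OF that] to_fract_hom.hom_sum)
      finally show ?thesis .
    qed
    from integral_over_normal_domain[OF normal this k] obtain b where "x = to_fract b" by auto
    then have "to_fract (s * g) = to_fract (f * b)" using f(2) by (simp add: x_def field_simps)
    then have "s * g = f * b" by (simp only: to_fract_eq_iff)
    then show thesis using g(1)[OF sP] by simp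
  next
    case False
    then obtain i where i: "i < n" "c i \<notin> P" by auto
    have c0: "c i \<noteq> 0" using i(2) ideal_setD(1)[OF Pi] by auto
    have key: "c i * b = ps ! i * d" if "s * (g * b) = f * d" for b d
    proof -
      have "(s * g) * (c i * b) = c i * (s * (g * b))" by (simp add: algebra_simps)
      also have "\<dots> = (s * (g * ps ! i)) * d" using that c[OF i(1)] by (simp add: algebra_simps)
      also have "\<dots> = (s * g) * (ps ! i * d)" by (simp add: algebra_simps)
      finally show ?thesis using sg by simp
    qed
    have "\<exists>d. s * (g * b) = f * d" if b: "b \<in> P" for b
    proof -
      obtain \<beta> where "b = (\<Sum>j<n. \<beta> j * ps ! j)" using gen[OF b] by auto
      then have "s * (g * b) = (\<Sum>j<n. \<beta> j * (s * (g * ps ! j)))"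
        by (simp add: sum_distrib_left algebra_simps)
      also have "\<dots> = f * (\<Sum>j<n. \<beta> j * c j)" using c by (simp add: sum_distrib_left algebra_simps)
      finally show ?thesis by blast
    qed
    then have *: "\<exists>s c. s \<notin> P \<and> s * b = ps ! i * c" if "b \<in> P" for b
      using key i(2) that by metis
    have "ps ! i \<noteq> 0" using *[OF f(1)] f(2) ideal_setD(1)[OF Pi] by auto
    then show thesis using that psP[OF i(1)] * by metis
  qed
qed

section \<open>Homogeneous components\<close>

lemma inv_additive_group: "inv\<^bsub>additive_group\<^esub> x = - (x::'g::ab_group_add)"
proof -
  interpret comm_group "additive_group :: 'g monoid" by (rule comm_group_additive_group)
  show ?thesis by (rule inv_equality) (simp_all add: additive_group_def)
qed

lemma subgroup_additive_group_iff:
  "subgroup H (additive_group :: 'g::ab_group_add monoid) \<longleftrightarrow>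
    0 \<in> H \<and> (\<forall>x\<in>H. \<forall>y\<in>H. x + y \<in> H) \<and> (\<forall>x\<in>H. - x \<in> H)"
  unfolding subgroup_def inv_additive_group by (auto simp: additive_group_def)

lemma subgroup_additive_groupD:
  assumes "subgroup H (additive_group :: 'g::ab_group_add monoid)"
  shows "0 \<in> H" "x \<in> H \<Longrightarrow> y \<in> H \<Longrightarrow> x + y \<in> H" "x \<in> H \<Longrightarrow> - x \<in> H"
    "x \<in> H \<Longrightarrow> y \<in> H \<Longrightarrow> x - y \<in> H"
proof -
  have H: "0 \<in> H" "\<forall>x\<in>H. \<forall>y\<in>H. x + y \<in> H" "\<forall>x\<in>H. - x \<in> H"
    using assms by (simp_all add: subgroup_additive_group_iff)
  then show "0 \<in> H" "x \<in> H \<Longrightarrow> y \<in> H \<Longrightarrow> x + y \<in> H" "x \<in> H \<Longrightarrow> - x \<in> H" by simp_all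
  show "x - y \<in> H" if "x \<in> H" "y \<in> H"
  proof -
    have "x + - y \<in> H" using H that by metis
    then show ?thesis by simp
  qed
qed

text \<open>Existence by finite families and uniqueness by independence of 0 is the form in which a
  coarser grading is obtained from a finer one.\<close>

lemma ring_gradingI:
  fixes \<B> :: "'g::ab_group_add \<Rightarrow> 'b::comm_ring_1 set"
  assumes sub: "\<And>i. subgroup (\<B> i) additive_group"
    and mult: "\<And>i j x y. x \<in> \<B> i \<Longrightarrow> y \<in> \<B> j \<Longrightarrow> x * y \<in> \<B> (i + j)"
    and ex: "\<And>x. \<exists>I f. finite I \<and> (\<forall>i\<in>I. f i \<in> \<B> i) \<and> x = (\<Sum>i\<in>I. f i)"
    and unique: "\<And>I f i. finite I \<Longrightarrow> (\<And>i. i \<in> I \<Longrightarrow> f i \<in> \<B> i) \<Longrightarrow> (\<Sum>i\<in>I. f i) = 0 \<Longrightarrow> i \<in> I \<Longrightarrow> f i = 0"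
  shows "ring_grading \<B>"
  unfolding ring_grading_def
proof (intro conjI allI ballI)
  note subD = subgroup_additive_groupD[OF sub]
  fix x
  show "\<exists>!f :: 'g \<Rightarrow>\<^sub>0 'b. (\<forall>i. Poly_Mapping.lookup f i \<in> \<B> i) \<and>
       x = (\<Sum>i\<in>Poly_Mapping.keys f. Poly_Mapping.lookup f i)"
  proof (rule ex_ex1I)
    obtain I f where If: "finite I" "\<forall>i\<in>I. f i \<in> \<B> i" "x = (\<Sum>i\<in>I. f i)" using ex[of x] by auto
    define g where "g i = (if i \<in> I then f i else 0)" for i
    have "finite {i. g i \<noteq> 0}" using If(1) by (rule rev_finite_subset) (auto simp: g_def)
    then have lk: "Poly_Mapping.lookup (Abs_poly_mapping g) = g" by (simp add: Abs_poly_mapping_inverse)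
    have "(\<Sum>i\<in>Poly_Mapping.keys (Abs_poly_mapping g). g i) = (\<Sum>i\<in>I. f i)"
      using If(1) by (intro sum.mono_neutral_cong_left) (auto simp: in_keys_iff lk g_def split: if_splits)
    moreover have "g i \<in> \<B> i" for i using If(2) subD(1) by (simp add: g_def)
    ultimately have "(\<forall>i. Poly_Mapping.lookup (Abs_poly_mapping g) i \<in> \<B> i) \<and>
       x = (\<Sum>i\<in>Poly_Mapping.keys (Abs_poly_mapping g). Poly_Mapping.lookup (Abs_poly_mapping g) i)"
      using If(3) by (simp add: lk)
    then show "\<exists>f :: 'g \<Rightarrow>\<^sub>0 'b. (\<forall>i. Poly_Mapping.lookup f i \<in> \<B> i) \<and>
       x = (\<Sum>i\<in>Poly_Mapping.keys f. Poly_Mapping.lookup f i)" by (rule exI)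
  next
    fix f g :: "'g \<Rightarrow>\<^sub>0 'b"
    assume f: "(\<forall>i. Poly_Mapping.lookup f i \<in> \<B> i) \<and> x = (\<Sum>i\<in>Poly_Mapping.keys f. Poly_Mapping.lookup f i)"
      and g: "(\<forall>i. Poly_Mapping.lookup g i \<in> \<B> i) \<and> x = (\<Sum>i\<in>Poly_Mapping.keys g. Poly_Mapping.lookup g i)"
    let ?I = "Poly_Mapping.keys f \<union> Poly_Mapping.keys g"
    have "x = (\<Sum>i\<in>?I. Poly_Mapping.lookup f i)"
      using conjunct2[OF f] by (subst sum.mono_neutral_right[of ?I "Poly_Mapping.keys f"]) (auto simp: in_keys_iff)
    moreover have "x = (\<Sum>i\<in>?I. Poly_Mapping.lookup g i)"
      using conjunct2[OF g] by (subst sum.mono_neutral_right[of ?I "Poly_Mapping.keys g"]) (auto simp: in_keys_iff)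
    ultimately have "(\<Sum>i\<in>?I. Poly_Mapping.lookup f i - Poly_Mapping.lookup g i) = 0"
      by (simp add: sum_subtractf)
    from unique[OF _ _ this] have "Poly_Mapping.lookup f i - Poly_Mapping.lookup g i = 0" if "i \<in> ?I" for i
      using f g that subD(4) by auto
    moreover have "Poly_Mapping.lookup f i - Poly_Mapping.lookup g i = 0" if "i \<notin> ?I" for i
      using that by (simp add: in_keys_iff)
    ultimately have "Poly_Mapping.lookup f i = Poly_Mapping.lookup g i" for i by (metis eq_iff_diff_eq_0)
    then show "f = g" by (rule poly_mapping_eqI)
  qed
qed (use sub mult in auto)

locale graded_ring =
  fixes \<B> :: "'g::ab_group_add \<Rightarrow> 'b::comm_ring_1 set"
  assumes grading: "ring_grading \<B>" and one_mem: "1 \<in> \<B> 0"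
begin

lemma subgroup_component: "subgroup (\<B> i) additive_group"
  using grading[unfolded ring_grading_def, THEN conjunct1] by (rule spec)

lemmas mem = subgroup_additive_groupD[OF subgroup_component]

lemma mult_mem: "x \<in> \<B> i \<Longrightarrow> y \<in> \<B> j \<Longrightarrow> x * y \<in> \<B> (i + j)"
  using grading[unfolded ring_grading_def, THEN conjunct2, THEN conjunct2] by simp

definition decomposition :: "'b \<Rightarrow> 'g \<Rightarrow>\<^sub>0 'b"
  where "decomposition x = (THE f. (\<forall>i. Poly_Mapping.lookup f i \<in> \<B> i) \<and>
    x = (\<Sum>i\<in>Poly_Mapping.keys f. Poly_Mapping.lookup f i))"

definition component :: "'b \<Rightarrow> 'g \<Rightarrow> 'b"
  where "component x = Poly_Mapping.lookup (decomposition x)"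

definition support :: "'b \<Rightarrow> 'g set"
  where "support x = {i. component x i \<noteq> 0}"

lemma decomposition_ex1: "\<exists>!f. (\<forall>i. Poly_Mapping.lookup f i \<in> \<B> i) \<and>
    x = (\<Sum>i\<in>Poly_Mapping.keys f. Poly_Mapping.lookup f i)"
  using grading[unfolded ring_grading_def, THEN conjunct2, THEN conjunct1] by (rule spec)

lemma component_mem [simp]: "component x i \<in> \<B> i"
  and sum_component: "x = (\<Sum>i\<in>support x. component x i)"
proof -
  have s: "support x = Poly_Mapping.keys (decomposition x)"
    by (auto simp: support_def component_def in_keys_iff)
  have d: "(\<forall>i. Poly_Mapping.lookup (decomposition x) i \<in> \<B> i) \<and>
    x = (\<Sum>i\<in>Poly_Mapping.keys (decomposition x). Poly_Mapping.lookup (decomposition x) i)"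
    unfolding decomposition_def by (rule theI'[OF decomposition_ex1])
  show "component x i \<in> \<B> i" using conjunct1[OF d] by (simp add: component_def)
  show "x = (\<Sum>i\<in>support x. component x i)" unfolding s component_def by (rule conjunct2[OF d])
qed

lemma finite_support [simp]: "finite (support x)"
  unfolding support_def component_def by simp

lemma support_iff: "i \<in> support x \<longleftrightarrow> component x i \<noteq> 0"
  by (simp add: support_def)

lemma component_eq:
  assumes I: "finite I" "\<And>i. i \<in> I \<Longrightarrow> f i \<in> \<B> i" and x: "x = (\<Sum>i\<in>I. f i)"
  shows "component x i = (if i \<in> I then f i else 0)"
proof -
  define g where "g i = (if i \<in> I then f i else 0)" for i
  have "finite {i. g i \<noteq> 0}" using I(1) by (rule rev_finite_subset) (auto simp: g_def)
  then have lk: "Poly_Mapping.lookup (Abs_poly_mapping g) = g" by (simp add: Abs_poly_mapping_inverse)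
  have "(\<Sum>i\<in>Poly_Mapping.keys (Abs_poly_mapping g). g i) = (\<Sum>i\<in>I. f i)"
    using I(1) by (intro sum.mono_neutral_cong_left) (auto simp: in_keys_iff lk g_def split: if_splits)
  moreover have "g i \<in> \<B> i" for i using I(2) mem(1) by (simp add: g_def)
  ultimately have "(\<forall>i. Poly_Mapping.lookup (Abs_poly_mapping g) i \<in> \<B> i) \<and>
     x = (\<Sum>i\<in>Poly_Mapping.keys (Abs_poly_mapping g). Poly_Mapping.lookup (Abs_poly_mapping g) i)"
    unfolding lk using x by simp
  then have "decomposition x = Abs_poly_mapping g"
    unfolding decomposition_def by (rule the1_equality[OF decomposition_ex1])
  then show ?thesis by (simp add: component_def lk g_def)
qed

lemma component_homogeneous: "x \<in> \<B> i \<Longrightarrow> component x j = (if j = i then x else 0)"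
  using component_eq[of "{i}" "\<lambda>_. x" x j] by simp

lemma component_0 [simp]: "component 0 i = 0"
  using component_eq[of "{}" "\<lambda>_. 0" 0 i] by simp

lemma sum_component_superset:
  assumes "finite I" "support x \<subseteq> I" shows "x = (\<Sum>i\<in>I. component x i)"
proof -
  have "(\<Sum>i\<in>support x. component x i) = (\<Sum>i\<in>I. component x i)"
    using assms by (intro sum.mono_neutral_left) (auto simp: support_iff)
  then show ?thesis using sum_component[of x] by (rule trans[rotated])
qed

lemma component_add [simp]: "component (x + y) i = component x i + component y i"
proof -
  have "x + y = (\<Sum>i\<in>support x \<union> support y. component x i + component y i)"
    unfolding sum.distrib by (intro arg_cong2[of _ _ _ _ "(+)"] sum_component_superset) auto
  from component_eq[OF _ _ this] show ?thesis by (auto simp: mem support_iff)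
qed

lemma component_minus [simp]: "component (- x) i = - component x i"
  using component_add[of x "- x" i] by (simp add: eq_neg_iff_add_eq_0 add.commute)

lemma component_diff [simp]: "component (x - y) i = component x i - component y i"
  using component_add[of x "- y" i] by simp

lemma component_sum [simp]: "component (sum f A) i = (\<Sum>a\<in>A. component (f a) i)"
  by (induction A rule: infinite_finite_induct) auto

lemma component_eqI: "(\<And>i. component x i = component y i) \<Longrightarrow> x = y"
  using sum_component[of "x - y"] by (simp add: support_def)

lemma mem_iff: "x \<in> \<B> i \<longleftrightarrow> support x \<subseteq> {i}"
proof
  assume "support x \<subseteq> {i}"
  then have "component x i = x" using sum_component_superset[of "{i}" x] by simp
  then show "x \<in> \<B> i" using component_mem[of x i] by simp
qed (auto simp: support_iff component_homogeneous split: if_splits)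

lemma mult_sum_component: "x * y = (\<Sum>i\<in>support y. x * component y i)"
  using arg_cong[OF sum_component[of y], of "\<lambda>z. x * z"] by (simp only: sum_distrib_left)

lemma sum_component_mult: "x * y = (\<Sum>i\<in>support x. component x i * y)"
  using arg_cong[OF sum_component[of x], of "\<lambda>z. z * y"] by (simp only: sum_distrib_right)

lemma component_mult_homogeneous:
  assumes "x \<in> \<B> i" shows "component (x * y) j = x * component y (j - i)"
proof -
  let ?I = "(\<lambda>j. i + j) ` support y"
  have "x * y = (\<Sum>j\<in>support y. x * component y j)" by (rule mult_sum_component)
  also have "\<dots> = (\<Sum>j\<in>?I. x * component y (j - i))" by (subst sum.reindex) auto
  finally have "x * y = (\<Sum>j\<in>?I. x * component y (j - i))" .
  moreover have "x * component y (j - i) \<in> \<B> j" for j using mult_mem[OF assms component_mem[of y "j - i"]] by simp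
  ultimately have "component (x * y) j = (if j \<in> ?I then x * component y (j - i) else 0)"
    by (intro component_eq) auto
  also have "\<dots> = x * component y (j - i)"
  proof (cases "j - i \<in> support y")
    case True
    then have "i + (j - i) \<in> ?I" by (rule imageI)
    then show ?thesis by simp
  next
    case False
    then show ?thesis by (simp add: support_iff)
  qed
  finally show ?thesis .
qed

lemma component_mult: "component (x * y) k = (\<Sum>i\<in>support x. component x i * component y (k - i))"
proof -
  have "x * y = (\<Sum>i\<in>support x. component x i * y)" by (rule sum_component_mult)
  then have "component (x * y) k = component (\<Sum>i\<in>support x. component x i * y) k" by (rule arg_cong)
  then show ?thesis by (simp only: component_sum component_mult_homogeneous[OF component_mem])
qed

lemma support_mult: "k \<in> support (x * y) \<Longrightarrow> \<exists>i\<in>support x. \<exists>j\<in>support y. k = i + j"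
proof -
  assume "k \<in> support (x * y)"
  then have "(\<Sum>i\<in>support x. component x i * component y (k - i)) \<noteq> 0"
    by (simp add: support_iff component_mult)
  then obtain i where i: "i \<in> support x" "component x i * component y (k - i) \<noteq> 0"
    by (rule sum.not_neutral_contains_not_neutral)
  then have "k - i \<in> support y" by (auto simp: support_iff)
  then show ?thesis using i(1) by (intro bexI[of _ i] bexI[of _ "k - i"]) simp_all
qed

lemma support_degree: assumes "i \<in> support x" shows "\<B> i \<noteq> {0}"
proof
  assume "\<B> i = {0}"
  with component_mem[of x i] have "component x i \<in> {0}" by (simp only:)
  with assms show False by (simp add: support_iff)
qed

lemma support_homogeneous: "x \<in> \<B> i \<Longrightarrow> support x \<subseteq> {i}"
  by (simp add: mem_iff)

lemma homogeneous_in_support: "x \<in> \<B> i \<Longrightarrow> x \<noteq> 0 \<Longrightarrow> i \<in> support x"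
  by (simp add: support_iff component_homogeneous)

lemma degree_nonzero: "\<B> i \<noteq> {0} \<Longrightarrow> \<exists>x\<in>\<B> i. x \<noteq> 0"
  using mem(1)[of i] by auto

lemma support_nonempty: "x \<noteq> 0 \<Longrightarrow> support x \<noteq> {}"
  using sum_component_superset[of "{}" x] by auto

lemma graded_part_iff: "x \<in> graded_part \<B> H \<longleftrightarrow> support x \<subseteq> H"
proof
  assume "x \<in> graded_part \<B> H"
  then obtain f :: "'g \<Rightarrow>\<^sub>0 'b" where f: "x = (\<Sum>i\<in>Poly_Mapping.keys f. Poly_Mapping.lookup f i)"
    "Poly_Mapping.keys f \<subseteq> H" "\<forall>i. Poly_Mapping.lookup f i \<in> \<B> i" unfolding graded_part_def by auto
  have "component x i = (if i \<in> Poly_Mapping.keys f then Poly_Mapping.lookup f i else 0)" for i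
    by (rule component_eq[OF _ _ f(1)]) (use f(3) in auto)
  then show "support x \<subseteq> H" using f(2) by (auto simp: support_iff split: if_splits)
next
  assume "support x \<subseteq> H"
  moreover have "support x = Poly_Mapping.keys (decomposition x)"
    by (auto simp: support_def component_def in_keys_iff)
  moreover have "x = (\<Sum>i\<in>support x. component x i)" by (rule sum_component)
  moreover have "\<forall>i. component x i \<in> \<B> i" by simp
  ultimately show "x \<in> graded_part \<B> H" unfolding graded_part_def component_def
    by (intro CollectI exI[of _ "decomposition x"]) simp
qed

lemma graded_part_add: "x \<in> graded_part \<B> H \<Longrightarrow> y \<in> graded_part \<B> H \<Longrightarrow> x + y \<in> graded_part \<B> H"
  and graded_part_minus: "x \<in> graded_part \<B> H \<Longrightarrow> - x \<in> graded_part \<B> H"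
  and graded_part_0: "0 \<in> graded_part \<B> H"
  unfolding graded_part_iff subset_iff support_iff component_add component_minus component_0
  by (metis add.left_neutral, simp_all)

lemma graded_part_mult:
  assumes "x \<in> graded_part \<B> H" "y \<in> graded_part \<B> K" "\<And>i j. i \<in> H \<Longrightarrow> j \<in> K \<Longrightarrow> i + j \<in> L"
  shows "x * y \<in> graded_part \<B> L"
  unfolding graded_part_iff
proof
  fix k assume "k \<in> support (x * y)"
  then obtain i j where "i \<in> support x" "j \<in> support y" "k = i + j" using support_mult by metis
  with assms show "k \<in> L" by (auto simp: graded_part_iff)
qed

lemma graded_part_sum: "(\<And>a. a \<in> A \<Longrightarrow> f a \<in> graded_part \<B> H) \<Longrightarrow> sum f A \<in> graded_part \<B> H"
  by (induction A rule: infinite_finite_induct) (auto intro: graded_part_add graded_part_0)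

lemma homogeneous_graded_part: "x \<in> \<B> i \<Longrightarrow> i \<in> H \<Longrightarrow> x \<in> graded_part \<B> H"
  using support_homogeneous by (auto simp: graded_part_iff)

text \<open>A degree in \<open>H a\<close> is met by no other summand. This gives uniqueness of
  decompositions both for gradings by values of a functional and for gradings by cosets.\<close>

lemma graded_part_independent:
  assumes I: "finite I" "\<And>a. a \<in> I \<Longrightarrow> f a \<in> graded_part \<B> (H a)" "(\<Sum>a\<in>I. f a) = 0" "a \<in> I"
    and disj: "\<And>a b. a \<in> I \<Longrightarrow> b \<in> I \<Longrightarrow> a \<noteq> b \<Longrightarrow> H a \<inter> H b = {}"
  shows "f a = 0"
proof (rule component_eqI)
  fix i
  show "component (f a) i = component 0 i"
  proof (cases "i \<in> H a")
    case True
    have "component (f b) i = 0" if "b \<in> I - {a}" for b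
      using that I(2)[of b] disj[of a b] I(4) True by (auto simp: graded_part_iff support_def)
    then have "(\<Sum>b\<in>I. component (f b) i) = component (f a) i"
      using I(1,4) by (subst sum.remove[of I a]) auto
    then show ?thesis using arg_cong[OF I(3), of "\<lambda>x. component x i"] by simp
  next
    case False
    then show ?thesis using I(2)[OF I(4)] by (auto simp: graded_part_iff support_def)
  qed
qed

section \<open>The Euler derivation of a functional, and the integer grading it defines\<close>

definition euler :: "('g \<Rightarrow> int) \<Rightarrow> 'b \<Rightarrow> 'b"
  where "euler \<phi> x = (\<Sum>i\<in>support x. of_int (\<phi> i) * component x i)"

lemma of_int_mult_mem: "x \<in> \<B> i \<Longrightarrow> of_int n * x \<in> \<B> i"
proof (induction n rule: int_induct[where k = 0])
  case (step1 m)
  then show ?case by (simp add: distrib_right mem)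
next
  case (step2 m)
  then show ?case by (simp add: left_diff_distrib mem)
qed (auto simp: mem)

lemma component_euler [simp]: "component (euler \<phi> x) i = of_int (\<phi> i) * component x i"
  using component_eq[OF _ _ euler_def, of x \<phi> i] by (auto simp: of_int_mult_mem support_iff)

text \<open>Additivity is asked only at degrees that occur, since a functional on the grading group
  is unspecified elsewhere in the index type.\<close>

definition additive_on_degrees :: "('g \<Rightarrow> int) \<Rightarrow> bool"
  where "additive_on_degrees \<phi> \<longleftrightarrow> (\<forall>i j. \<B> i \<noteq> {0} \<longrightarrow> \<B> j \<noteq> {0} \<longrightarrow> \<phi> (i + j) = \<phi> i + \<phi> j)"

lemma euler_add: "euler \<phi> (x + y) = euler \<phi> x + euler \<phi> y"
  by (rule component_eqI) (simp add: algebra_simps)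

lemma euler_minus: "euler \<phi> (- x) = - euler \<phi> x"
  by (rule component_eqI) simp

lemma euler_homogeneous: "x \<in> \<B> i \<Longrightarrow> euler \<phi> x = of_int (\<phi> i) * x"
  by (rule component_eqI) (simp add: component_homogeneous component_homogeneous[OF of_int_mult_mem])

lemma euler_mult:
  assumes "additive_on_degrees \<phi>"
  shows "euler \<phi> (x * y) = euler \<phi> x * y + x * euler \<phi> y"
proof (rule component_eqI)
  fix k
  have 1: "euler \<phi> x * y = (\<Sum>i\<in>support x. (of_int (\<phi> i) * component x i) * y)"
    unfolding euler_def sum_distrib_right ..
  have 2: "x * euler \<phi> y = (\<Sum>i\<in>support x. component x i * euler \<phi> y)"
    by (rule sum_component_mult)
  have "of_int (\<phi> k) * (component x i * component y (k - i)) =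
      (of_int (\<phi> i) * component x i) * component y (k - i) + component x i * (of_int (\<phi> (k - i)) * component y (k - i))"
    if "i \<in> support x" for i
  proof (cases "k - i \<in> support y")
    case True
    then have "\<phi> (i + (k - i)) = \<phi> i + \<phi> (k - i)"
      using assms that support_degree unfolding additive_on_degrees_def by metis
    then show ?thesis by (simp add: algebra_simps)
  qed (simp add: support_iff)
  then show "component (euler \<phi> (x * y)) k = component (euler \<phi> x * y + x * euler \<phi> y) k"
    unfolding component_euler component_mult[of x y] component_add 1 2 component_sum
    by (simp add: component_mult_homogeneous[OF of_int_mult_mem[OF component_mem]]
        component_mult_homogeneous[OF component_mem] sum_distrib_left flip: sum.distrib)
qed

lemma additive_on_degrees_0: "additive_on_degrees \<phi> \<Longrightarrow> (1::'b) \<noteq> 0 \<Longrightarrow> \<phi> 0 = 0"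
  using one_mem unfolding additive_on_degrees_def by (metis add.right_neutral add_cancel_right_right singletonD)

lemma coarsening:
  assumes \<phi>: "additive_on_degrees \<phi>"
  shows "graded_ring (\<lambda>n. graded_part \<B> {i. \<phi> i = n})"
proof
  show "ring_grading (\<lambda>n. graded_part \<B> {i. \<phi> i = n})"
  proof (rule ring_gradingI)
    show "subgroup (graded_part \<B> {i. \<phi> i = n}) additive_group" for n
      by (auto simp: subgroup_additive_group_iff graded_part_0 graded_part_add graded_part_minus)
    show "x * y \<in> graded_part \<B> {i. \<phi> i = m + n}"
      if "x \<in> graded_part \<B> {i. \<phi> i = m}" "y \<in> graded_part \<B> {i. \<phi> i = n}" for x y m n
      unfolding graded_part_iff
    proof
      fix k assume "k \<in> support (x * y)"
      then obtain i j where ij: "i \<in> support x" "j \<in> support y" "k = i + j" using support_mult by metis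
      then have "\<phi> k = \<phi> i + \<phi> j" using \<phi> support_degree unfolding additive_on_degrees_def by metis
      then show "k \<in> {i. \<phi> i = m + n}" using that ij by (auto simp: graded_part_iff)
    qed
    show "\<exists>I f. finite I \<and> (\<forall>n\<in>I. f n \<in> graded_part \<B> {i. \<phi> i = n}) \<and> x = (\<Sum>n\<in>I. f n)" for x
    proof (intro exI conjI ballI)
      show "finite (\<phi> ` support x)" by simp
      show "(\<Sum>i | i \<in> support x \<and> \<phi> i = n. component x i) \<in> graded_part \<B> {i. \<phi> i = n}" for n
        by (intro graded_part_sum homogeneous_graded_part[OF component_mem]) auto
      show "x = (\<Sum>n\<in>\<phi> ` support x. \<Sum>i | i \<in> support x \<and> \<phi> i = n. component x i)"
        by (subst sum.image_gen[symmetric]) (auto intro: sum_component)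
    qed
    show "f i = 0" if "finite I" "\<And>n. n \<in> I \<Longrightarrow> f n \<in> graded_part \<B> {i. \<phi> i = n}"
      "(\<Sum>n\<in>I. f n) = 0" "i \<in> I" for I f i
      using graded_part_independent[of I f "\<lambda>n. {i. \<phi> i = n}" i] that by auto
  qed
  show "1 \<in> graded_part \<B> {i. \<phi> i = 0}"
  proof (cases "(1::'b) = 0")
    case True
    then show ?thesis using graded_part_0 by metis
  next
    case False
    then show ?thesis using homogeneous_graded_part[OF one_mem] additive_on_degrees_0[OF \<phi>] by simp
  qed
qed

end

section \<open>Homogeneous locally nilpotent derivations\<close>

locale graded_domain = graded_ring \<B>
  for \<B> :: "'g::ab_group_add \<Rightarrow> 'b::idom set"
begin

lemma homogeneous_mult_degree:
  assumes "\<B> i \<noteq> {0}" "\<B> j \<noteq> {0}" shows "\<B> (i + j) \<noteq> {0}"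
proof -
  obtain x y where xy: "x \<in> \<B> i" "x \<noteq> 0" "y \<in> \<B> j" "y \<noteq> 0"
    using degree_nonzero[OF assms(1)] degree_nonzero[OF assms(2)] by (elim bexE) (rule that)
  have "x * y \<in> \<B> (i + j)" using xy(1,3) by (rule mult_mem)
  moreover have "x * y \<notin> {0}" using xy(2,4) by simp
  ultimately show ?thesis by metis
qed

text \<open>The derivation is \<open>x \<mapsto> s * euler \<phi> x / t\<close>.\<close>

lemma homogeneous_LND_exists:
  assumes H: "subgroup H additive_group"
    and \<phi>: "additive_on_degrees \<phi>" and nonneg: "\<And>i. i \<in> H \<Longrightarrow> \<B> i \<noteq> {0} \<Longrightarrow> \<phi> i \<ge> 0"
    and t: "t \<in> \<B> e" "t \<noteq> 0" "e \<in> H" "\<phi> e > 0"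
    and s: "s \<in> \<B> \<sigma>" "s \<noteq> 0" "\<sigma> \<in> H" "\<phi> \<sigma> = 0"
    and dvd: "\<And>i b. i \<in> H \<Longrightarrow> b \<in> \<B> i \<Longrightarrow> \<phi> i > 0 \<Longrightarrow> \<exists>c. s * b = t * c"
    and char0: "\<And>n::int. n \<noteq> 0 \<Longrightarrow> (of_int n :: 'b) \<noteq> 0"
  obtains D where "D \<in> HLND \<B> H"
    "\<And>x. x \<in> graded_part \<B> H \<Longrightarrow> D x = 0 \<longleftrightarrow> (\<forall>i\<in>support x. \<phi> i = 0)"
    "\<And>x. x \<notin> graded_part \<B> H \<Longrightarrow> D x = 0"
proof -
  note HD = subgroup_additive_groupD[OF H]
  let ?A = "graded_part \<B> H"
  have "\<exists>y. t * y = s * euler \<phi> x" if x: "x \<in> ?A" for x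
  proof -
    have "\<exists>c. t * c = s * (of_int (\<phi> i) * component x i)" if i: "i \<in> support x" for i
    proof -
      have iH: "i \<in> H" using x i by (auto simp: graded_part_iff)
      show ?thesis
      proof (cases "\<phi> i > 0")
        case True
        from dvd[OF iH component_mem[of x i] True] obtain c where "s * component x i = t * c" by metis
        then have "t * (of_int (\<phi> i) * c) = s * (of_int (\<phi> i) * component x i)"
          by (simp add: mult.left_commute)
        then show ?thesis by metis
      next
        case False
        then have "\<phi> i = 0" using nonneg[OF iH support_degree[OF i]] by simp
        then show ?thesis by (intro exI[of _ 0]) simp
      qed
    qed
    then obtain c where "\<And>i. i \<in> support x \<Longrightarrow> t * c i = s * (of_int (\<phi> i) * component x i)" by metis
    then have "t * (\<Sum>i\<in>support x. c i) = s * euler \<phi> x"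
      by (simp add: euler_def sum_distrib_left)
    then show ?thesis by metis
  qed
  then obtain D0 where D0: "\<And>x. x \<in> ?A \<Longrightarrow> t * D0 x = s * euler \<phi> x" by metis
  define D where "D x = (if x \<in> ?A then D0 x else 0)" for x
  have D: "t * D x = s * euler \<phi> x" if "x \<in> ?A" for x using D0 that by (simp add: D_def)
  have D_out: "D x = 0" if "x \<notin> ?A" for x using that by (simp add: D_def)
  \<comment> \<open>Comparing components of degree j + e in t * D x = s * euler \<phi> x; it shows
    that D shifts degrees by \<sigma> - e.\<close>
  have cD: "t * component (D x) j = s * (of_int (\<phi> (j + e - \<sigma>)) * component x (j + e - \<sigma>))"
    if "x \<in> ?A" for x j
    using arg_cong[OF D[OF that], of "\<lambda>z. component z (j + e)"]
    by (simp add: component_mult_homogeneous[OF t(1)] component_mult_homogeneous[OF s(1)])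
  have supD: "j + e - \<sigma> \<in> support x" if "x \<in> ?A" "j \<in> support (D x)" for x j
    using cD[OF that(1), of j] that(2) t(2) by (auto simp: support_iff)
  have D_closed: "D x \<in> ?A" if x: "x \<in> ?A" for x
    unfolding graded_part_iff
  proof
    fix j assume "j \<in> support (D x)"
    then have "j + e - \<sigma> \<in> H" using supD[OF x] x by (auto simp: graded_part_iff)
    then have "(j + e - \<sigma>) + \<sigma> - e \<in> H" using HD t(3) s(3) by metis
    then show "j \<in> H" by simp
  qed
  have tc: "a = b" if "t * a = t * b" for a b using that t(2) by simp
  have plus: "x + y \<in> ?A" if "x \<in> ?A" "y \<in> ?A" for x y using that by (rule graded_part_add)
  have times: "x * y \<in> ?A" if "x \<in> ?A" "y \<in> ?A" for x y
    using that(1,2) HD(2) by (rule graded_part_mult)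
  have D_add: "D (x + y) = D x + D y" if "x \<in> ?A" "y \<in> ?A" for x y
    by (rule tc) (simp add: D that plus distrib_left euler_add)
  have D_mult: "D (x * y) = D x * y + x * D y" if "x \<in> ?A" "y \<in> ?A" for x y
  proof (rule tc)
    have "t * (D x * y + x * D y) = (t * D x) * y + x * (t * D y)" by (simp add: algebra_simps)
    also have "\<dots> = s * euler \<phi> (x * y)" by (simp add: D that euler_mult[OF \<phi>] algebra_simps)
    finally show "t * D (x * y) = t * (D x * y + x * D y)" by (simp add: D that times)
  qed
  \<comment> \<open>Each application lowers \<phi> by \<phi> e - \<phi> \<sigma> = \<phi> e > 0. As
    \<phi> is nonnegative at the degrees in H that occur, this yields local nilpotence.\<close>
  have deg_D: "\<phi> j < \<phi> (j + e - \<sigma>)" if "x \<in> ?A" "j \<in> support (D x)" for x j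
  proof -
    have 1: "\<B> (j + e - \<sigma>) \<noteq> {0}" "\<B> j \<noteq> {0}" using supD[OF that] that(2) support_degree by auto
    have 2: "\<B> \<sigma> \<noteq> {0}" "\<B> e \<noteq> {0}" using s t by auto
    note ad = \<phi>[unfolded additive_on_degrees_def, rule_format]
    have "\<phi> (j + e) = \<phi> (j + e - \<sigma>) + \<phi> \<sigma>" using ad[OF 1(1) 2(1)] by (simp only: diff_add_cancel)
    then show ?thesis using ad[OF 1(2) 2(2)] s(4) t(4) by linarith
  qed
  have nil: "(D ^^ n) x = 0" if "x \<in> ?A" "\<And>i. i \<in> support x \<Longrightarrow> \<phi> i < int n" for x n
    using that
  proof (induction n arbitrary: x)
    case 0
    have "support x = {}"
    proof (rule ccontr)
      assume "support x \<noteq> {}"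
      then obtain i where i: "i \<in> support x" by auto
      then have "i \<in> H" using 0(1) by (auto simp: graded_part_iff)
      with nonneg[OF this support_degree[OF i]] 0(2)[OF i] show False by simp
    qed
    then show ?case using support_nonempty by auto
  next
    case (Suc n)
    have "(D ^^ n) (D x) = 0"
    proof (rule Suc.IH[OF D_closed[OF Suc.prems(1)]])
      fix j assume "j \<in> support (D x)"
      from deg_D[OF Suc.prems(1) this] Suc.prems(2)[OF supD[OF Suc.prems(1) this]]
      show "\<phi> j < int n" by simp
    qed
    then show ?case by (simp add: funpow_swap1)
  qed
  have "\<exists>n>0. (D ^^ n) x = 0" if x: "x \<in> ?A" for x
  proof -
    define N where "N = (\<Sum>i\<in>support x. nat (\<phi> i))"
    have "\<phi> i < int (Suc N)" if "i \<in> support x" for i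
    proof -
      have "nat (\<phi> i) \<le> N" unfolding N_def using that by (intro member_le_sum) simp_all
      then show ?thesis by linarith
    qed
    from nil[OF x this] show ?thesis by (intro exI[of _ "Suc N"]) simp
  qed
  then have LND: "D \<in> LND ?A"
    unfolding LND_def derivations_def using D_closed D_out D_add D_mult by simp
  have "D ` \<B> i \<subseteq> \<B> (i + (\<sigma> - e))" if "i \<in> H" for i
  proof (rule image_subsetI)
    fix x assume x: "x \<in> \<B> i"
    have xA: "x \<in> ?A" using x that by (rule homogeneous_graded_part)
    have "support (D x) \<subseteq> {i + (\<sigma> - e)}"
    proof
      fix j assume "j \<in> support (D x)"
      then have "j + e - \<sigma> = i" using supD[OF xA] support_homogeneous[OF x] by auto
      then show "j \<in> {i + (\<sigma> - e)}" by (auto simp: algebra_simps)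
    qed
    then show "D x \<in> \<B> (i + (\<sigma> - e))" by (simp add: mem_iff)
  qed
  moreover have "\<sigma> - e \<in> H" using HD(4)[OF s(3) t(3)] .
  ultimately have "D \<in> HLND \<B> H" unfolding HLND_def using LND by blast
  moreover have "D x = 0 \<longleftrightarrow> (\<forall>i\<in>support x. \<phi> i = 0)" if x: "x \<in> ?A" for x
  proof -
    have "D x = 0 \<longleftrightarrow> euler \<phi> x = 0"
      using arg_cong[OF D[OF x], of "\<lambda>z. z = 0"] s(2) t(2) by simp
    also have "\<dots> \<longleftrightarrow> (\<forall>i. of_int (\<phi> i) * component x i = 0)"
    proof
      show "euler \<phi> x = 0 \<Longrightarrow> \<forall>i. of_int (\<phi> i) * component x i = 0"
        using component_euler[of \<phi> x] by simp
      show "\<forall>i. of_int (\<phi> i) * component x i = 0 \<Longrightarrow> euler \<phi> x = 0"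
        unfolding euler_def by (intro sum.neutral) simp
    qed
    also have "\<dots> \<longleftrightarrow> (\<forall>i\<in>support x. \<phi> i = 0)"
    proof -
      have "of_int (\<phi> i) * component x i = 0 \<longleftrightarrow> (i \<in> support x \<longrightarrow> \<phi> i = 0)" for i
        using char0[of "\<phi> i"] by (cases "\<phi> i = 0") (simp_all add: support_iff)
      then show ?thesis by (simp add: Ball_def)
    qed
    finally show ?thesis .
  qed
  ultimately show thesis using that D_out by metis
qed


section \<open>Height one primes containing all components of nonzero degree\<close>

text \<open>The components of t0 of nonzero degree lie in P by assumption, hence also the one of
  degree 0, and locally each is t0 times some a i. If all a i were in P, summing would give t0 as a
  multiple of itself by an element of P, so a denominator outside P would lie in P. Hence some a i
  is a unit, and that component generates P locally.\<close>

lemma homogeneous_uniformizer: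
  assumes P: "P \<in> prime_spectrum" and BP: "\<And>i. i \<noteq> 0 \<Longrightarrow> \<B> i \<subseteq> P"
    and t0: "t0 \<in> P" "t0 \<noteq> 0" "\<And>b. b \<in> P \<Longrightarrow> \<exists>s c. s \<notin> P \<and> s * b = t0 * c"
  obtains d t where "t \<in> \<B> d" "t \<in> P" "t \<noteq> 0" "\<And>b. b \<in> P \<Longrightarrow> \<exists>s c. s \<notin> P \<and> s * b = t * c"
proof -
  note Pi = prime_spectrumD(1)[OF P]
  have cPn: "component x i \<in> P" if "i \<noteq> 0" for x i
    using BP[OF that] component_mem[of x i] by (rule subsetD)
  have cP: "component t0 i \<in> P" for i
  proof (cases "i = 0")
    case True
    have "(\<Sum>j\<in>support t0 - {0}. component t0 j) \<in> P"
      by (intro ideal_set_sum[OF Pi] cPn) simp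
    then have "t0 + (- 1) * (\<Sum>j\<in>support t0 - {0}. component t0 j) \<in> P"
      using t0(1) by (intro ideal_setD(2)[OF Pi] ideal_setD(3)[OF Pi])
    moreover have "t0 = component t0 0 + (\<Sum>j\<in>support t0 - {0}. component t0 j)"
    proof (cases "0 \<in> support t0")
      case True
      then show ?thesis using sum.remove[OF finite_support True, of "component t0"] sum_component[of t0]
        by (simp only:)
    next
      case False
      then show ?thesis using sum_component[of t0] by (simp add: support_iff)
    qed
    ultimately show ?thesis using True by (metis add_diff_cancel_right' mult_minus1 uminus_add_conv_diff add.commute)
  next
    case False
    then show ?thesis by (rule cPn)
  qed
  then have "\<forall>i. \<exists>s a. s \<notin> P \<and> s * component t0 i = t0 * a" using t0(3) by metis
  then obtain s a where sa: "\<And>i. s i \<notin> P" "\<And>i. s i * component t0 i = t0 * a i" by metis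
  have "\<exists>i\<in>support t0. a i \<notin> P"
  proof (rule ccontr)
    assume "\<not> ?thesis"
    then have aP: "\<And>i. i \<in> support t0 \<Longrightarrow> a i \<in> P" by auto
    define S where "S = prod s (support t0)"
    define w where "w i = prod s (support t0 - {i})" for i
    have "S * component t0 i = t0 * (a i * w i)" if "i \<in> support t0" for i
    proof -
      have "S = s i * w i" unfolding S_def w_def using that by (intro prod.remove) auto
      then have "S * component t0 i = (s i * component t0 i) * w i" by (simp add: algebra_simps)
      then show ?thesis using sa(2)[of i] by (simp add: algebra_simps)
    qed
    then have "S * t0 = t0 * (\<Sum>i\<in>support t0. a i * w i)"
      by (simp add: mult_sum_component[of S t0] sum_distrib_left)
    then have "S = (\<Sum>i\<in>support t0. a i * w i)" using t0(2) by (simp add: mult.commute)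
    moreover have "(\<Sum>i\<in>support t0. a i * w i) \<in> P"
      by (intro ideal_set_sum[OF Pi] ideal_setD(4)[OF Pi] aP)
    moreover have "S \<notin> P" unfolding S_def using sa(1) by (intro prime_spectrum_prod[OF P])
    ultimately show False by simp
  qed
  then obtain i where i: "i \<in> support t0" "a i \<notin> P" by auto
  have "\<exists>s c. s \<notin> P \<and> s * b = component t0 i * c" if b: "b \<in> P" for b
  proof -
    obtain s' c where s': "s' \<notin> P" "s' * b = t0 * c" using t0(3)[OF b] by metis
    have "(a i * s') * b = (t0 * a i) * c" using s'(2) by (simp add: algebra_simps)
    also have "\<dots> = component t0 i * (s i * c)" using sa(2)[of i] by (simp add: algebra_simps)
    finally have "(a i * s') * b = component t0 i * (s i * c)" .
    moreover have "a i * s' \<notin> P" using i(2) s'(1) prime_spectrumD(3)[OF P] by simp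
    ultimately show ?thesis by metis
  qed
  then show thesis using that[OF component_mem[of t0 i] cP] i(1) by (simp add: support_iff)
qed

end

text \<open>Localising at the elements of degree \<open>0\<close> outside \<open>P\<close>, the uniformizer \<open>t\<close> of
  \<open>P\<close> can be taken homogeneous and every homogeneous element becomes a unit of degree \<open>0\<close>
  times a power of \<open>t\<close>.\<close>

lemma (in graded_domain) graded_by_uniformizer:
  assumes P: "P \<in> Spec1" and BP: "\<And>i. i \<noteq> 0 \<Longrightarrow> \<B> i \<subseteq> P"
    and t0: "t0 \<in> P" "t0 \<noteq> 0" "\<And>b. b \<in> P \<Longrightarrow> \<exists>s c. s \<notin> P \<and> s * b = t0 * c"
  obtains d t where "t \<in> \<B> d" "t \<noteq> 0"
    "\<And>n b. b \<in> \<B> n \<Longrightarrow> b \<noteq> 0 \<Longrightarrow> \<exists>m s c. s \<in> \<B> 0 \<and> s \<noteq> 0 \<and> c \<in> \<B> 0 \<and> c \<noteq> 0 \<and>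
       s * b = t ^ m * c \<and> n = ((+) d ^^ m) 0"
proof -
  note Pp = Spec1_prime[OF P] and Pi = prime_spectrumD(1)[OF Spec1_prime[OF P]]
  obtain d t where t: "t \<in> \<B> d" "t \<in> P" "t \<noteq> 0" "\<And>b. b \<in> P \<Longrightarrow> \<exists>s c. s \<notin> P \<and> s * b = t * c"
    using homogeneous_uniformizer[OF Pp BP t0] by metis
  \<comment> \<open>\<open>((+) d ^^ m) 0\<close> is the m-fold multiple of d in the group of
    indices, which is still arbitrary here.\<close>
  have tm: "t ^ m \<in> \<B> (((+) d ^^ m) 0)" for m
    by (induction m) (auto simp: one_mem t(1) mult_mem)
  have "\<exists>m s c. s \<in> \<B> 0 \<and> s \<noteq> 0 \<and> c \<in> \<B> 0 \<and> c \<noteq> 0 \<and> s * b = t ^ m * c \<and> n = ((+) d ^^ m) 0"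
    if b: "b \<in> \<B> n" "b \<noteq> 0" for b n
  proof -
    define Q where "Q m \<longleftrightarrow> (\<exists>s c. s \<notin> P \<and> s * b = t ^ m * c)" for m
    have "Q 0" unfolding Q_def using prime_spectrumD(2)[OF Pp] by (intro exI[of _ 1] exI[of _ b]) simp
    \<comment> \<open>The order of b along t is finite: if b lies in P, some t ^ N is a local
      multiple of b, and then t ^ Suc N cannot divide b, since t would become a unit.\<close>
    moreover have "\<exists>N. \<not> Q N"
    proof (cases "b \<in> P")
      case False
      have "\<not> Q 1"
      proof
        assume "Q 1"
        then obtain s c where sc: "s \<notin> P" "s * b = t * c" by (auto simp: Q_def)
        have "s * b \<in> P" unfolding sc(2) using t(2) by (rule ideal_setD(4)[OF Pi])
        then show False using sc(1) False prime_spectrumD(3)[OF Pp] by simp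
      qed
      then show ?thesis ..
    next
      case True
      obtain s N c where 1: "s \<notin> P" "s * t ^ N = b * c"
        using Spec1_power_multiple[OF P True b(2) t(2)] by metis
      have "\<not> Q (Suc N)"
      proof
        assume "Q (Suc N)"
        then obtain s' c' where 2: "s' \<notin> P" "s' * b = t ^ Suc N * c'" by (auto simp: Q_def)
        have "(s * s') * t ^ N = c * (s' * b)" using 1(2) by (simp add: algebra_simps)
        also have "\<dots> = (t * (c * c')) * t ^ N" unfolding 2(2) by (simp add: algebra_simps)
        finally have "s * s' = t * (c * c')" using t(3) by simp
        moreover have "t * (c * c') \<in> P" using t(2) by (rule ideal_setD(4)[OF Pi])
        ultimately have "s * s' \<in> P" by (simp only:)
        then show False using 1(1) 2(1) prime_spectrumD(3)[OF Pp, of s s'] by metis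
      qed
      then show ?thesis ..
    qed
    ultimately obtain N where "Q 0" "\<not> Q N" by auto
    then have "\<exists>m. Q m \<and> \<not> Q (Suc m)" by (induction N) auto
    then obtain m where m: "Q m" "\<not> Q (Suc m)" by auto
    then obtain s c where sc: "s \<notin> P" "s * b = t ^ m * c" by (auto simp: Q_def)
    define k where "k = ((+) d ^^ m) 0"
    \<comment> \<open>The other components of s lie in P anyway, so s itself would lie in P.\<close>
    have s0: "component s 0 \<notin> P"
    proof
      assume "component s 0 \<in> P"
      then have "component s i \<in> P" for i
        using subsetD[OF BP component_mem, of i s] by (cases "i = 0") simp_all
      then have "(\<Sum>i\<in>support s. component s i) \<in> P" by (intro ideal_set_sum[OF Pi])
      then show False using sc(1) sum_component[of s] by simp
    qed
    have "b * s = t ^ m * c" using sc(2) by (simp only: mult.commute)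
    then have "component (b * s) n = component (t ^ m * c) n" by (rule arg_cong)
    then have "b * component s 0 = t ^ m * component c (n - k)"
      unfolding component_mult_homogeneous[OF tm] component_mult_homogeneous[OF b(1)] k_def by simp
    then have eq: "component s 0 * b = t ^ m * component c (n - k)" by (simp only: mult.commute)
    have nz: "component s 0 \<noteq> 0" using s0 ideal_setD(1)[OF Pi] by auto
    have cnz: "component c (n - k) \<noteq> 0" using eq nz b(2) by auto
    \<comment> \<open>By the maximality of m this component is not divisible by t. Being outside P
      it must have degree 0, which identifies the degree of b as the m-fold multiple of d.\<close>
    have "component c (n - k) \<notin> P"
    proof
      assume "component c (n - k) \<in> P"
      from t(4)[OF this] obtain s' c' where 3: "s' \<notin> P" "s' * component c (n - k) = t * c'" by metis
      have "(s' * component s 0) * b = t ^ m * (s' * component c (n - k))"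
        using eq by (simp add: algebra_simps)
      also have "\<dots> = t ^ Suc m * c'" unfolding 3(2) by (simp add: algebra_simps)
      finally have "Q (Suc m)" unfolding Q_def using 3(1) s0 prime_spectrumD(3)[OF Pp] by metis
      then show False using m(2) by simp
    qed
    then have "n - k = 0" using subsetD[OF BP component_mem, of "n - k" c] by metis
    then have "n = k" by simp
    have "component s 0 \<in> \<B> 0 \<and> component s 0 \<noteq> 0 \<and> component c 0 \<in> \<B> 0 \<and> component c 0 \<noteq> 0 \<and>
      component s 0 * b = t ^ m * component c 0 \<and> n = ((+) d ^^ m) 0"
      using nz cnz eq \<open>n - k = 0\<close> \<open>n = k\<close> by (simp add: k_def)
    then show ?thesis
      by (intro exI[of _ m] exI[of _ "component s 0"] exI[of _ "component c 0"])
  qed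
  then show thesis by (rule that[OF t(1,3)])
qed

section \<open>Quotients of subgroups of the grading group\<close>

definition int_scale :: "int \<Rightarrow> 'g::ab_group_add \<Rightarrow> 'g"
  where "int_scale k x = x [^]\<^bsub>additive_group\<^esub> k"

lemma additive_group_simps [simp]:
  "carrier additive_group = UNIV" "x \<otimes>\<^bsub>additive_group\<^esub> y = x + y" "\<one>\<^bsub>additive_group\<^esub> = 0"
  by (simp_all add: additive_group_def)

lemma group_additive_group: "group (additive_group :: 'g::ab_group_add monoid)"
  using comm_group_additive_group by (rule comm_group.axioms(2))

interpretation int_scale: Modules.module "int_scale :: int \<Rightarrow> 'g::ab_group_add \<Rightarrow> 'g"
proof -
  interpret comm_group "additive_group :: 'g monoid" by (rule comm_group_additive_group)
  show "Modules.module (int_scale :: int \<Rightarrow> 'g \<Rightarrow> 'g)"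
  proof
    fix a b :: int and x y :: 'g
    show "int_scale a (x + y) = int_scale a x + int_scale a y"
      using int_pow_distrib[of x y a] by (simp add: int_scale_def)
    show "int_scale (a + b) x = int_scale a x + int_scale b x"
      using int_pow_mult[of x a b] by (simp add: int_scale_def)
    show "int_scale a (int_scale b x) = int_scale (a * b) x"
      using int_pow_pow[of x b a] by (simp add: int_scale_def mult.commute)
    show "int_scale 1 x = x" using int_pow_1[of x] by (simp add: int_scale_def)
  qed
qed

lemma int_scale_int: "int_scale (int n) x = ((+) x ^^ n) 0"
  by (induction n) (simp_all add: int_scale.scale_left_distrib)

lemma int_scale_of_int: "int_scale k (x::int) = k * x"
proof (induction k rule: int_induct[where k = 0])
  case (step1 i)
  then show ?case by (simp add: int_scale.scale_left_distrib distrib_right)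
next
  case (step2 i)
  then show ?case by (simp add: int_scale.scale_left_diff_distrib left_diff_distrib)
qed simp

lemma int_scale_mem:
  assumes "subgroup H (additive_group :: 'g::ab_group_add monoid)" "x \<in> H"
  shows "int_scale k x \<in> H"
proof (induction k rule: int_induct[where k = 0])
  case (step1 i)
  then show ?case using assms by (simp add: int_scale.scale_left_distrib subgroup_additive_groupD)
next
  case (step2 i)
  then show ?case using assms by (simp add: int_scale.scale_left_diff_distrib subgroup_additive_groupD)
qed (use assms in \<open>simp add: subgroup_additive_groupD\<close>)

lemma nat_pow_additive_group: "x [^]\<^bsub>additive_group\<^esub> (n::nat) = int_scale (int n) (x::'g::ab_group_add)"
  unfolding int_scale_def by (simp add: int_pow_int)

lemma subgroup_generate_additive: "subgroup (generate additive_group S) (additive_group :: 'g::ab_group_add monoid)"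
  by (rule group.generate_is_subgroup[OF group_additive_group]) simp

lemma generate_additive_least:
  assumes "S \<subseteq> H" "subgroup H (additive_group :: 'g::ab_group_add monoid)"
  shows "generate additive_group S \<subseteq> H"
  by (rule group.generate_subgroup_incl[OF group_additive_group assms])

locale subgroup_pair =
  fixes A H :: "'g::ab_group_add set"
  assumes A: "subgroup A additive_group" and H: "subgroup H additive_group" and HA: "H \<subseteq> A"
begin

abbreviation "GA \<equiv> additive_group\<lparr>carrier := A\<rparr>"

lemmas AD = subgroup_additive_groupD[OF A] and HD = subgroup_additive_groupD[OF H]

lemma comm_group_GA: "comm_group GA"
proof (rule comm_groupI)
  fix x assume "x \<in> carrier GA"
  then show "\<exists>y\<in>carrier GA. y \<otimes>\<^bsub>GA\<^esub> x = \<one>\<^bsub>GA\<^esub>" using AD(3) by (intro bexI[of _ "- x"]) auto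
qed (use AD in \<open>auto simp: ac_simps\<close>)

lemma inv_GA: "x \<in> A \<Longrightarrow> inv\<^bsub>GA\<^esub> x = - x"
proof -
  interpret comm_group GA by (rule comm_group_GA)
  show "x \<in> A \<Longrightarrow> inv\<^bsub>GA\<^esub> x = - x" by (rule inv_equality) (simp_all add: AD)
qed

lemma normal_H: "H \<lhd> GA"
proof -
  interpret comm_group GA by (rule comm_group_GA)
  have "subgroup H GA" using HD HA inv_GA by (intro subgroupI) auto
  then show ?thesis by (rule subgroup_imp_normal)
qed

lemma r_coset_GA: "H #>\<^bsub>GA\<^esub> x = (\<lambda>h. h + x) ` H"
  by (auto simp: r_coset_def)

lemma r_coset_eq_iff: "x \<in> A \<Longrightarrow> H #>\<^bsub>GA\<^esub> x = H \<longleftrightarrow> x \<in> H"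
proof
  assume "H #>\<^bsub>GA\<^esub> x = H"
  moreover have "0 + x \<in> H #>\<^bsub>GA\<^esub> x" unfolding r_coset_GA using HD(1) by (rule imageI)
  ultimately show "x \<in> H" by simp
next
  assume x: "x \<in> H"
  show "H #>\<^bsub>GA\<^esub> x = H" unfolding r_coset_GA
  proof
    show "(\<lambda>h. h + x) ` H \<subseteq> H" using HD(2) x by auto
    show "H \<subseteq> (\<lambda>h. h + x) ` H"
    proof
      fix y assume "y \<in> H"
      then show "y \<in> (\<lambda>h. h + x) ` H" using HD(4) x by (intro image_eqI[of _ _ "y - x"]) auto
    qed
  qed
qed

lemma carrier_quotient: "carrier (quotient_group A H) = (\<lambda>x. H #>\<^bsub>GA\<^esub> x) ` A"
  by (auto simp: quotient_group_def FactGroup_def RCOSETS_def)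

lemma one_quotient: "\<one>\<^bsub>quotient_group A H\<^esub> = H"
  by (simp add: quotient_group_def FactGroup_def)

lemma mult_quotient: "x \<in> A \<Longrightarrow> y \<in> A \<Longrightarrow>
  (H #>\<^bsub>GA\<^esub> x) \<otimes>\<^bsub>quotient_group A H\<^esub> (H #>\<^bsub>GA\<^esub> y) = H #>\<^bsub>GA\<^esub> (x + y)"
  using normal.rcos_sum[OF normal_H, of x y] by (simp add: quotient_group_def FactGroup_def)

lemma comm_group_quotient: "comm_group (quotient_group A H)"
  unfolding quotient_group_def
  by (rule comm_group.abelian_FactGroup[OF comm_group_GA normal_imp_subgroup[OF normal_H]])

lemma nat_pow_quotient:
  assumes x: "x \<in> A"
  shows "(H #>\<^bsub>GA\<^esub> x) [^]\<^bsub>quotient_group A H\<^esub> (n::nat) = H #>\<^bsub>GA\<^esub> int_scale (int n) x"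
proof (induction n)
  case 0
  have "H = H #>\<^bsub>GA\<^esub> 0" using r_coset_eq_iff[OF AD(1)] HD(1) by simp
  then show ?case by (simp add: nat_pow_def one_quotient)
next
  case (Suc n)
  have "(H #>\<^bsub>GA\<^esub> x) [^]\<^bsub>quotient_group A H\<^esub> Suc n =
    (H #>\<^bsub>GA\<^esub> x) [^]\<^bsub>quotient_group A H\<^esub> n \<otimes>\<^bsub>quotient_group A H\<^esub> (H #>\<^bsub>GA\<^esub> x)"
    by (simp add: nat_pow_def)
  also have "\<dots> = H #>\<^bsub>GA\<^esub> (int_scale (int n) x + x)"
    unfolding Suc by (rule mult_quotient[OF int_scale_mem[OF A x] x])
  finally show ?case by (simp add: int_scale.scale_left_distrib add.commute)
qed

lemma torsion_quotient_iff:
  "torsion_group (quotient_group A H) \<longleftrightarrow> (\<forall>x\<in>A. \<exists>n::nat. n \<ge> 1 \<and> int_scale (int n) x \<in> H)"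
proof -
  have "(H #>\<^bsub>GA\<^esub> x) [^]\<^bsub>quotient_group A H\<^esub> (n::nat) = H \<longleftrightarrow> int_scale (int n) x \<in> H"
    if "x \<in> A" for x n
    unfolding nat_pow_quotient[OF that] by (rule r_coset_eq_iff[OF int_scale_mem[OF A that]])
  then have "(\<forall>x\<in>A. \<exists>n::nat. n \<ge> 1 \<and> (H #>\<^bsub>GA\<^esub> x) [^]\<^bsub>quotient_group A H\<^esub> n = H) \<longleftrightarrow>
      (\<forall>x\<in>A. \<exists>n::nat. n \<ge> 1 \<and> int_scale (int n) x \<in> H)"
    by (intro ball_cong refl) (simp only:)
  then show ?thesis unfolding torsion_group_def carrier_quotient one_quotient by (simp only: ball_simps)
qed

end

lemma torc_iff: "x \<in> torc H A \<longleftrightarrow> x \<in> A \<and> (\<exists>m::nat. m \<ge> 1 \<and> int_scale (int m) x \<in> H)"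
  by (simp add: torc_def nat_pow_additive_group)

lemma (in subgroup_pair) subgroup_torc: "subgroup (torc H A) additive_group"
  unfolding subgroup_additive_group_iff
proof (intro conjI ballI)
  show "0 \<in> torc H A" using AD(1) HD(1) by (auto simp: torc_iff)
  fix x assume "x \<in> torc H A"
  then obtain m :: nat where m: "x \<in> A" "m \<ge> 1" "int_scale (int m) x \<in> H" by (auto simp: torc_iff)
  then have "int_scale (int m) (- x) \<in> H" by (simp add: HD(3))
  then show "- x \<in> torc H A" using m AD(3) by (auto simp: torc_iff)
  fix y assume "y \<in> torc H A"
  then obtain n :: nat where n: "y \<in> A" "n \<ge> 1" "int_scale (int n) y \<in> H" by (auto simp: torc_iff)
  have "int_scale (int (m * n)) (x + y) = int_scale (int n) (int_scale (int m) x) + int_scale (int m) (int_scale (int n) y)"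
    by (simp add: int_scale.scale_right_distrib mult.commute)
  also have "\<dots> \<in> H" by (rule HD(2)[OF int_scale_mem[OF H m(3)] int_scale_mem[OF H n(3)]])
  finally have "int_scale (int (m * n)) (x + y) \<in> H" .
  moreover have "m * n \<ge> 1" using m n by simp
  ultimately show "x + y \<in> torc H A" using AD(2) m(1) n(1) unfolding torc_iff by metis
qed

lemma (in subgroup_pair) torc_superset: "H \<subseteq> torc H A"
  using HA by (auto simp: torc_iff intro!: exI[of _ 1])

section \<open>Subgroups with infinite cyclic quotient as kernels of integer functionals\<close>

lemma additive_int_scale:
  assumes A: "subgroup A (additive_group :: 'g::ab_group_add monoid)"
    and \<phi>: "\<And>x y. x \<in> A \<Longrightarrow> y \<in> A \<Longrightarrow> \<phi> (x + y) = \<phi> x + (\<phi> y :: int)" and x: "x \<in> A"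
  shows "\<phi> (int_scale k x) = k * \<phi> x"
proof -
  note AD = subgroup_additive_groupD[OF A]
  have \<phi>0: "\<phi> 0 = 0" using \<phi>[of 0 0] AD by simp
  show ?thesis
  proof (induction k rule: int_induct[where k = 0])
    case base
    then show ?case using \<phi>0 by simp
  next
    case (step1 i)
    then show ?case using \<phi>[OF int_scale_mem[OF A x] x] by (simp add: int_scale.scale_left_distrib distrib_right)
  next
    case (step2 i)
    have "\<phi> (int_scale (i - 1) x + x) = \<phi> (int_scale (i - 1) x) + \<phi> x" by (rule \<phi>[OF int_scale_mem[OF A x] x])
    then show ?case using step2 by (simp add: int_scale.scale_left_diff_distrib left_diff_distrib)
  qed
qed

lemma additive_diff:
  assumes A: "subgroup A (additive_group :: 'g::ab_group_add monoid)"
    and \<phi>: "\<And>x y. x \<in> A \<Longrightarrow> y \<in> A \<Longrightarrow> \<phi> (x + y) = \<phi> x + (\<phi> y :: int)" and "x \<in> A" "y \<in> A"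
  shows "\<phi> (x - y) = \<phi> x - \<phi> y"
  using \<phi>[of "x - y" y] subgroup_additive_groupD(4)[OF A] assms(3,4) by simp

text \<open>Trades the isomorphism of A/H' with the integers for a map on elements, specified on A
  only. H' determines this map up to sign; the sign \<epsilon> chosen later settles which one is
  used.\<close>

lemma cocyclic_overgroups_functional:
  assumes A: "subgroup A (additive_group :: 'g::ab_group_add monoid)" and H': "H' \<in> cocyclic_overgroups H A"
  obtains \<phi> :: "'g::ab_group_add \<Rightarrow> int" where "\<And>x y. x \<in> A \<Longrightarrow> y \<in> A \<Longrightarrow> \<phi> (x + y) = \<phi> x + \<phi> y"
    "\<And>x. x \<in> A \<Longrightarrow> \<phi> x = 0 \<longleftrightarrow> x \<in> H'" "\<exists>x\<in>A. \<phi> x = 1"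
proof -
  have sub: "subgroup H' (additive_group\<lparr>carrier := A\<rparr>)" and HA: "H' \<subset> A"
    and iso: "quotient_group A H' \<cong> integer_group"
    using H' by (auto simp: cocyclic_overgroups_def)
  have "subgroup H' additive_group"
    by (rule group.incl_subgroup[OF group_additive_group A sub])
  then interpret subgroup_pair A H' using A HA by (intro subgroup_pair.intro) auto
  obtain \<psi> where \<psi>: "\<psi> \<in> hom (quotient_group A H') integer_group"
    "bij_betw \<psi> (carrier (quotient_group A H')) (carrier integer_group)"
    using iso by (auto simp: is_iso_def iso_def)
  interpret Q: comm_group "quotient_group A H'" by (rule comm_group_quotient)
  have \<psi>1: "\<psi> H' = 0"
    using hom_one[OF \<psi>(1) Q.is_group group_integer_group] by (simp add: one_quotient integer_group_def)
  have H'c: "H' \<in> carrier (quotient_group A H')" using Q.one_closed by (simp add: one_quotient)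
  define \<phi> where "\<phi> x = \<psi> (H' #>\<^bsub>GA\<^esub> x)" for x
  have c: "H' #>\<^bsub>GA\<^esub> x \<in> carrier (quotient_group A H')" if "x \<in> A" for x
    unfolding carrier_quotient using that by (rule imageI)
  have "\<phi> (x + y) = \<phi> x + \<phi> y" if "x \<in> A" "y \<in> A" for x y
    unfolding \<phi>_def mult_quotient[OF that, symmetric]
    using hom_mult[OF \<psi>(1) c[OF that(1)] c[OF that(2)]] by (simp add: integer_group_def)
  moreover have "\<phi> x = 0 \<longleftrightarrow> x \<in> H'" if "x \<in> A" for x
  proof -
    have "\<phi> x = 0 \<longleftrightarrow> H' #>\<^bsub>GA\<^esub> x = H'"
      unfolding \<phi>_def \<psi>1[symmetric]
      by (rule inj_on_eq_iff[OF bij_betw_imp_inj_on[OF \<psi>(2)] c[OF that] H'c])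
    then show ?thesis using r_coset_eq_iff[OF that] by simp
  qed
  moreover have "\<exists>x\<in>A. \<phi> x = 1"
  proof -
    have "1 \<in> \<psi> ` carrier (quotient_group A H')" using \<psi>(2) by (simp add: bij_betw_def integer_group_def)
    then obtain c where c: "c \<in> carrier (quotient_group A H')" "\<psi> c = 1" by auto
    from c(1) obtain x where "x \<in> A" "c = H' #>\<^bsub>GA\<^esub> x" unfolding carrier_quotient by (rule imageE)
    with c(2) show ?thesis unfolding \<phi>_def by (intro bexI[of _ x]) (simp_all only:)
  qed
  ultimately show thesis by (rule that)
qed

lemma functional_cocyclic_overgroups:
  assumes A: "subgroup A (additive_group :: 'g::ab_group_add monoid)"
    and \<phi>: "\<And>x y. x \<in> A \<Longrightarrow> y \<in> A \<Longrightarrow> \<phi> (x + y) = \<phi> x + (\<phi> y :: int)" "\<exists>x\<in>A. \<phi> x = 1"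
    and Hker: "\<And>x. x \<in> H \<Longrightarrow> x \<in> A \<and> \<phi> x = 0"
  shows "{x \<in> A. \<phi> x = 0} \<in> cocyclic_overgroups H A"
proof -
  note AD = subgroup_additive_groupD[OF A]
  let ?K = "{x \<in> A. \<phi> x = 0}"
  have \<phi>_minus: "\<phi> (- x) = - \<phi> x" if "x \<in> A" for x
    using additive_int_scale[OF A \<phi>(1) that, of "-1"] by simp
  have \<phi>0: "\<phi> 0 = 0" using \<phi>(1)[of 0 0] AD by simp
  have "subgroup ?K additive_group"
    using AD \<phi>(1) \<phi>_minus \<phi>0 by (auto simp: subgroup_additive_group_iff)
  then interpret subgroup_pair A ?K using A by (intro subgroup_pair.intro) auto
  interpret GA: comm_group GA by (rule comm_group_GA)
  interpret hom: group_hom GA integer_group \<phi>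
    by (intro group_hom.intro group_hom_axioms.intro GA.is_group group_integer_group homI)
      (use \<phi>(1) in \<open>simp_all add: integer_group_def\<close>)
  have surj: "\<phi> ` carrier GA = carrier integer_group"
  proof -
    obtain x where x: "x \<in> A" "\<phi> x = 1" using \<phi>(2) by auto
    have "k \<in> \<phi> ` A" for k
    proof (rule image_eqI)
      show "k = \<phi> (int_scale k x)" using additive_int_scale[OF A \<phi>(1) x(1), of k] x(2) by simp
    qed (rule int_scale_mem[OF A x(1)])
    then show ?thesis by (auto simp: integer_group_def)
  qed
  have ker: "kernel GA integer_group \<phi> = ?K" by (auto simp: kernel_def integer_group_def)
  have "quotient_group A ?K \<cong> integer_group"
    using hom.FactGroup_iso[OF surj] unfolding ker quotient_group_def .
  moreover have "subgroup ?K GA" using normal_imp_subgroup[OF normal_H] .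
  moreover have "?K \<subset> A"
  proof
    show "?K \<subseteq> A" by (rule Collect_restrict)
    obtain x where x: "x \<in> A" "\<phi> x = 1" using \<phi>(2) by (rule bexE)
    show "?K \<noteq> A"
    proof
      assume "?K = A"
      with x(1) have "x \<in> ?K" by (simp only:)
      with x(2) show False by simp
    qed
  qed
  moreover have "H \<subseteq> ?K"
  proof
    fix x assume "x \<in> H"
    from Hker[OF this] show "x \<in> ?K" by simp
  qed
  ultimately show ?thesis by (simp add: cocyclic_overgroups_def)
qed

section \<open>The structure of the grading at a height one prime\<close>

text \<open>The scalars contain the rationals. Here characteristic 0 enters: the Euler derivation
  multiplies a component by its degree, and that factor has to be cancelled.\<close>

lemma affine_algebra_int_invertible:
  fixes \<iota> :: "'k::field_char_0 \<Rightarrow> 'b::comm_ring_1"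
  assumes aff: "affine_algebra \<iota>" and n: "n \<noteq> 0"
  shows "\<exists>q::'b. q * of_int n = 1"
proof -
  note \<iota> = affine_algebra_hom[OF aff]
  have \<iota>_int: "\<iota> (of_int k) = of_int k" for k
  proof (induction k rule: int_induct[where k = 0])
    case (step2 k)
    have "\<iota> (of_int (k - 1)) = \<iota> (of_int k + (- 1))" by simp
    then show ?case using step2 by (simp only: \<iota>(1,3,5)) simp
  qed (simp_all add: \<iota>)
  have "\<iota> (1 / of_int n) * of_int n = \<iota> ((1 / of_int n) * of_int n)" by (simp only: \<iota>(2) \<iota>_int)
  also have "\<dots> = 1" using n by (simp add: \<iota>(3))
  finally show ?thesis ..
qed

lemma (in graded_ring) subgroup_grading_group: "subgroup (grading_group \<B>) additive_group"
  unfolding grading_group_def by (rule subgroup_generate_additive)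

lemma (in graded_ring) degree_in_grading_group: "\<B> i \<noteq> {0} \<Longrightarrow> i \<in> grading_group \<B>"
  unfolding grading_group_def by (rule generate.incl) simp

context graded_domain
begin

lemma one_degree: "\<B> 0 \<noteq> {0}"
  using one_mem by auto

text \<open>In a domain the degrees that occur form a monoid, so the group they generate consists of
  their differences.\<close>

lemma grading_group_diff:
  assumes "x \<in> grading_group \<B>"
  obtains i j where "\<B> i \<noteq> {0}" "\<B> j \<noteq> {0}" "x = i - j"
proof -
  define M where "M = {i. \<B> i \<noteq> {0}}"
  have M: "0 \<in> M" "\<And>i j. i \<in> M \<Longrightarrow> j \<in> M \<Longrightarrow> i + j \<in> M"
    using one_degree homogeneous_mult_degree by (simp_all add: M_def)
  define K where "K = {i - j |i j. i \<in> M \<and> j \<in> M}"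
  have "subgroup K additive_group"
    unfolding subgroup_additive_group_iff
  proof (intro conjI ballI)
    have "0 - 0 \<in> K" unfolding K_def using M(1) by blast
    then show "0 \<in> K" by simp
    fix x assume "x \<in> K"
    then obtain i j where x: "x = i - j" "i \<in> M" "j \<in> M" by (auto simp: K_def)
    have "j - i \<in> K" unfolding K_def using x by blast
    then show "- x \<in> K" using x(1) by simp
    fix y assume "y \<in> K"
    then obtain k l where y: "y = k - l" "k \<in> M" "l \<in> M" by (auto simp: K_def)
    have "(i + k) - (j + l) \<in> K" unfolding K_def using M(2) x y by blast
    moreover have "x + y = (i + k) - (j + l)" unfolding x(1) y(1) by simp
    ultimately show "x + y \<in> K" by (simp only:)
  qed
  moreover have "M \<subseteq> K"
  proof
    fix i assume "i \<in> M"
    then have "i - 0 \<in> K" unfolding K_def using M(1) by blast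
    then show "i \<in> K" by simp
  qed
  ultimately have "grading_group \<B> \<subseteq> K"
    unfolding grading_group_def M_def[symmetric] by (intro generate_additive_least)
  with assms have "x \<in> K" by auto
  then show thesis using that by (auto simp: K_def M_def)
qed

text \<open>In the integer grading by \<phi> the uniformizer turns every value at an occurring
  degree into a nonnegative multiple of its own degree d. \<open>gen\<close> says that these values
  have no common factor, so d is 1 or -1, and \<epsilon> is d. The point of the second half is that
  one s works for all b.\<close>

lemma prime_grading_structure:
  fixes \<iota> :: "'k::field_char_0 \<Rightarrow> 'b" and \<phi> :: "'g \<Rightarrow> int"
  assumes aff: "affine_algebra \<iota>" and \<iota>0: "range \<iota> \<subseteq> \<B> 0" and normal: "normal_domain TYPE('b)"
    and P: "P \<in> Spec1" and \<phi>: "additive_on_degrees \<phi>"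
    and BP: "\<And>i. \<phi> i \<noteq> 0 \<Longrightarrow> \<B> i \<subseteq> P"
    and gen: "\<And>d. (\<And>i. \<B> i \<noteq> {0} \<Longrightarrow> d dvd \<phi> i) \<Longrightarrow> d dvd 1"
  obtains \<epsilon> e \<sigma> t s where "\<epsilon> * \<epsilon> = 1" "t \<in> \<B> e" "t \<noteq> 0" "\<epsilon> * \<phi> e = 1"
    "s \<in> \<B> \<sigma>" "s \<noteq> 0" "\<phi> \<sigma> = 0" "\<And>i. \<B> i \<noteq> {0} \<Longrightarrow> \<epsilon> * \<phi> i \<ge> 0"
    "\<And>i b. b \<in> \<B> i \<Longrightarrow> \<phi> i \<noteq> 0 \<Longrightarrow> \<exists>c. s * b = t * c"
proof -
  note Pi = prime_spectrumD(1)[OF Spec1_prime[OF P]]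
  note ad = \<phi>[unfolded additive_on_degrees_def, rule_format]
  define C where "C n = graded_part \<B> {i. \<phi> i = n}" for n
  have C_ring: "graded_ring C" unfolding C_def by (rule coarsening[OF \<phi>])
  interpret C: graded_domain C by (rule graded_domain.intro[OF C_ring])
  have CI: "x \<in> C (\<phi> i)" if "x \<in> \<B> i" for x i
    unfolding C_def using that by (rule homogeneous_graded_part) simp
  have CP: "C n \<subseteq> P" if "n \<noteq> 0" for n
  proof
    fix x assume x: "x \<in> C n"
    have "component x i \<in> P" if "i \<in> support x" for i
    proof -
      have "\<phi> i \<noteq> 0" using that x \<open>n \<noteq> 0\<close> by (auto simp: C_def graded_part_iff)
      from BP[OF this] component_mem[of x i] show ?thesis by (rule subsetD)
    qed
    then have "(\<Sum>i\<in>support x. component x i) \<in> P" by (rule ideal_set_sum[OF Pi])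
    then show "x \<in> P" using sum_component[of x] by simp
  qed
  obtain t1 where t1: "t1 \<in> P" "t1 \<noteq> 0" "\<And>b. b \<in> P \<Longrightarrow> \<exists>s c. s \<notin> P \<and> s * b = t1 * c"
    using Spec1_uniformizer[OF normal affine_noetherian[OF aff] P] by metis
  obtain d t0 where t0: "t0 \<in> C d" "t0 \<noteq> 0"
    and C_eq: "\<And>n b. b \<in> C n \<Longrightarrow> b \<noteq> 0 \<Longrightarrow> \<exists>m s c. s \<in> C 0 \<and> s \<noteq> 0 \<and> c \<in> C 0 \<and> c \<noteq> 0 \<and>
       s * b = t0 ^ m * c \<and> n = ((+) d ^^ m) 0"
    by (rule C.graded_by_uniformizer[OF P CP t1]) (assumption | rule that)+
  have C_eq': "\<exists>m s c. s \<in> C 0 \<and> s \<noteq> 0 \<and> c \<in> C 0 \<and> c \<noteq> 0 \<and> s * b = t0 ^ m * c \<and> n = int m * d"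
    if "b \<in> C n" "b \<noteq> 0" for n b
    using C_eq[OF that] unfolding int_scale_int[symmetric] int_scale_of_int .
  have degs: "\<exists>m. \<phi> i = int m * d" if i: "\<B> i \<noteq> {0}" for i
  proof -
    obtain x where "x \<in> \<B> i" "x \<noteq> 0" using degree_nonzero[OF i] by auto
    from C_eq'[OF CI[OF this(1)] this(2)] show ?thesis by auto
  qed
  have "d dvd 1"
  proof (rule gen)
    fix i assume "\<B> i \<noteq> {0}"
    from degs[OF this] show "d dvd \<phi> i" by auto
  qed
  then have d: "d * d = 1" by (metis zdvd1_eq abs_mult_self_eq mult_1)
  \<comment> \<open>A component of t0 in the finer grading. It has the same value d of \<phi>, so it
    agrees with t0 up to nonzero factors from \<open>C 0\<close>.\<close>
  obtain e where e: "e \<in> support t0" using support_nonempty[OF t0(2)] by auto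
  define t where "t = component t0 e"
  have t: "t \<in> \<B> e" "t \<noteq> 0" using e by (simp_all add: t_def support_iff)
  have \<phi>e: "\<phi> e = d" using e t0(1) by (auto simp: C_def graded_part_iff)
  obtain m1 s1 c1 where 1: "s1 \<in> C 0" "s1 \<noteq> 0" "c1 \<in> C 0" "c1 \<noteq> 0" "s1 * t = t0 ^ m1 * c1" "d = int m1 * d"
    using C_eq'[OF CI[OF t(1)] t(2)] unfolding \<phi>e by auto
  have "m1 = 1" using 1(6) d by auto
  then have 1: "s1 \<in> C 0" "s1 \<noteq> 0" "c1 \<in> C 0" "c1 \<noteq> 0" "s1 * t = t0 * c1" using 1 by simp_all
  \<comment> \<open>For a single b: split one factor off the power of t0, replace it by t at the
    cost of the factors \<open>s1\<close> and \<open>c1\<close>, and then keep any one nonzero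
    component of the denominator \<open>u\<close>. Since b and t are homogeneous, comparing
    components preserves the relation.\<close>
  have den: "\<exists>\<sigma> u c. u \<in> \<B> \<sigma> \<and> u \<noteq> 0 \<and> \<phi> \<sigma> = 0 \<and> u * b = t * c" if b: "b \<in> \<B> i" "\<phi> i \<noteq> 0" for b i
  proof (cases "b = 0")
    case True
    have "\<phi> 0 = 0" by (rule additive_on_degrees_0[OF \<phi>]) simp
    then show ?thesis using True by (intro exI[of _ 0] exI[of _ 1]) (simp add: one_mem)
  next
    case False
    obtain m s2 c2 where 2: "s2 \<in> C 0" "s2 \<noteq> 0" "c2 \<in> C 0" "s2 * b = t0 ^ m * c2" "\<phi> i = int m * d"
      using C_eq'[OF CI[OF b(1)] False] by auto
    obtain k where k: "m = Suc k" using 2(5) b(2) by (cases m) auto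
    define u where "u = c1 * s2"
    define w where "w = s1 * (t0 ^ k * c2)"
    have "u * b = c1 * (s2 * b)" by (simp add: u_def mult.assoc)
    also have "\<dots> = c1 * (t0 ^ m * c2)" by (simp only: 2(4))
    also have "\<dots> = (t0 * c1) * (t0 ^ k * c2)" by (simp add: k algebra_simps)
    also have "\<dots> = t * w" unfolding 1(5)[symmetric] w_def by (simp add: algebra_simps)
    finally have uw: "u * b = t * w" .
    have "u \<noteq> 0" using 1(4) 2(2) by (simp add: u_def)
    then obtain \<sigma> where \<sigma>: "\<sigma> \<in> support u" using support_nonempty by auto
    have "u \<in> C 0" unfolding u_def using C.mult_mem[OF 1(3) 2(1)] by simp
    then have \<phi>\<sigma>: "\<phi> \<sigma> = 0" using \<sigma> by (auto simp: C_def graded_part_iff)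
    have "b * u = t * w" using uw by (simp only: mult.commute)
    then have "component (b * u) (i + \<sigma>) = component (t * w) (i + \<sigma>)" by (rule arg_cong)
    then have "b * component u \<sigma> = t * component w (i + \<sigma> - e)"
      unfolding component_mult_homogeneous[OF b(1)] component_mult_homogeneous[OF t(1)] by simp
    then have "component u \<sigma> * b = t * component w (i + \<sigma> - e)" by (simp only: mult.commute)
    moreover have "component u \<sigma> \<noteq> 0" using \<sigma> by (simp add: support_iff)
    ultimately show ?thesis using \<phi>\<sigma> component_mem[of u \<sigma>] by metis
  qed
  obtain S where S: "finite S" "\<And>A. subring_set A \<Longrightarrow> range \<iota> \<subseteq> A \<Longrightarrow> S \<subseteq> A \<Longrightarrow> A = UNIV"
    by (rule affine_algebra_generators[OF aff]) (rule that)
  \<comment> \<open>The components of the generators at which \<phi> is nonzero. The product of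
    their denominators will serve all of B.\<close>
  define T where "T = (\<Union>x\<in>S. (\<lambda>i. (i, component x i)) ` {i \<in> support x. \<phi> i \<noteq> 0})"
  have "finite T" unfolding T_def using S(1) by simp
  moreover have "\<And>i b. (i, b) \<in> T \<Longrightarrow> b \<in> \<B> i \<and> \<phi> i \<noteq> 0" by (auto simp: T_def)
  ultimately have "\<exists>\<sigma> s. s \<in> \<B> \<sigma> \<and> s \<noteq> 0 \<and> \<phi> \<sigma> = 0 \<and> (\<forall>(i, b)\<in>T. \<exists>c. s * b = t * c)"
  proof (induction T)
    case empty
    have "\<phi> 0 = 0" by (rule additive_on_degrees_0[OF \<phi>]) simp
    then show ?case by (intro exI[of _ 0] exI[of _ 1]) (simp add: one_mem)
  next
    case (insert p T)
    obtain i b where p: "p = (i, b)" by (cases p)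
    obtain \<sigma> s where s: "s \<in> \<B> \<sigma>" "s \<noteq> 0" "\<phi> \<sigma> = 0" "\<forall>(i, b)\<in>T. \<exists>c. s * b = t * c"
      using insert by auto
    obtain \<tau> u c where u: "u \<in> \<B> \<tau>" "u \<noteq> 0" "\<phi> \<tau> = 0" "u * b = t * c"
      using den[of b i] insert.prems[of i b] p by auto
    have "\<B> \<sigma> \<noteq> {0}" "\<B> \<tau> \<noteq> {0}" using s u by auto
    from ad[OF this] have "\<phi> (\<sigma> + \<tau>) = 0" using s(3) u(3) by simp
    moreover have "s * u \<in> \<B> (\<sigma> + \<tau>)" using s(1) u(1) by (rule mult_mem)
    moreover have "s * u \<noteq> 0" using s(2) u(2) by simp
    moreover have "\<exists>c. (s * u) * b' = t * c" if ib: "(i', b') \<in> insert p T" for i' b'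
    proof (cases "(i', b') = p")
      case True
      then have "(s * u) * b' = t * (s * c)" using u(4) p by (simp add: mult.assoc mult.left_commute)
      then show ?thesis ..
    next
      case False
      then obtain c' where "s * b' = t * c'" using bspec[OF s(4), of "(i', b')"] ib by auto
      then have "u * (s * b') = u * (t * c')" by (rule arg_cong)
      then have "(s * u) * b' = t * (u * c')" by (simp only: mult_ac)
      then show ?thesis ..
    qed
    ultimately show ?case by (intro exI[of _ "\<sigma> + \<tau>"] exI[of _ "s * u"]) auto
  qed
  then obtain \<sigma> s where s: "s \<in> \<B> \<sigma>" "s \<noteq> 0" "\<phi> \<sigma> = 0" "\<forall>(i, b)\<in>T. \<exists>c. s * b = t * c"
    by (elim exE conjE) (rule that)
  \<comment> \<open>Divisibility is tested on the Euler image and not on x: by the Leibniz rule this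
    gives a subring, and it contains the scalars, whose Euler image is 0.\<close>
  define A where "A = {x. \<exists>c. s * euler \<phi> x = t * c}"
  have euler_0: "euler \<phi> x = 0" if "x \<in> \<B> 0" for x
    using euler_homogeneous[OF that, of \<phi>] additive_on_degrees_0[OF \<phi>] by simp
  have "A = UNIV"
  proof (rule S(2))
    show "range \<iota> \<subseteq> A" using \<iota>0 euler_0 by (auto simp: A_def intro: exI[of _ 0])
    show "S \<subseteq> A"
    proof
      fix x assume x: "x \<in> S"
      have "\<exists>c. s * (of_int (\<phi> i) * component x i) = t * c" if i: "i \<in> support x" for i
      proof (cases "\<phi> i = 0")
        case True
        then show ?thesis by (intro exI[of _ 0]) simp
      next
        case False
        then have "(i, component x i) \<in> T" using x i by (auto simp: T_def)
        from bspec[OF s(4) this] obtain c where "s * component x i = t * c" by auto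
        then have "of_int (\<phi> i) * (s * component x i) = of_int (\<phi> i) * (t * c)" by (rule arg_cong)
        then have "s * (of_int (\<phi> i) * component x i) = t * (of_int (\<phi> i) * c)" by (simp only: mult_ac)
        then show ?thesis ..
      qed
      then obtain c where c: "\<And>i. i \<in> support x \<Longrightarrow> s * (of_int (\<phi> i) * component x i) = t * c i" by metis
      have "s * euler \<phi> x = t * (\<Sum>i\<in>support x. c i)"
        unfolding euler_def sum_distrib_left by (rule sum.cong[OF refl c])
      then show "x \<in> A" by (auto simp: A_def)
    qed
    show "subring_set A"
      unfolding subring_set_def
    proof (intro conjI ballI)
      show "1 \<in> A" using euler_0[OF one_mem] by (auto simp: A_def intro: exI[of _ 0])
      fix x assume "x \<in> A"
      then obtain c where x: "s * euler \<phi> x = t * c" by (auto simp: A_def)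
      have "s * euler \<phi> (- x) = t * (- c)" using x by (simp add: euler_minus)
      then show "- x \<in> A" unfolding A_def by blast
      fix y assume "y \<in> A"
      then obtain c' where y: "s * euler \<phi> y = t * c'" by (auto simp: A_def)
      have "s * euler \<phi> (x + y) = t * (c + c')" using x y by (simp add: euler_add distrib_left)
      then show "x + y \<in> A" unfolding A_def by blast
      have "s * euler \<phi> (x * y) = (s * euler \<phi> x) * y + x * (s * euler \<phi> y)"
        by (simp add: euler_mult[OF \<phi>] algebra_simps)
      also have "\<dots> = t * (c * y + x * c')" unfolding x y by (simp add: algebra_simps)
      finally show "x * y \<in> A" unfolding A_def by blast
    qed
  qed
  have "\<exists>c. s * b = t * c" if b: "b \<in> \<B> i" "\<phi> i \<noteq> 0" for i b
  proof -
    have "b \<in> A" using \<open>A = UNIV\<close> by simp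
    then obtain c where c: "s * (of_int (\<phi> i) * b) = t * c"
      using euler_homogeneous[OF b(1), of \<phi>] by (auto simp: A_def)
    \<comment> \<open>The integer \<phi> i is invertible in B, so it can be removed from the Euler
      image of b.\<close>
    obtain q where q: "q * of_int (\<phi> i) = (1::'b)" using affine_algebra_int_invertible[OF aff b(2)] by auto
    have "s * b = (q * of_int (\<phi> i)) * (s * b)" by (simp only: q mult_1)
    also have "\<dots> = q * (s * (of_int (\<phi> i) * b))" by (simp only: mult_ac)
    also have "\<dots> = t * (q * c)" unfolding c by (simp only: mult_ac)
    finally show ?thesis ..
  qed
  moreover have "d * \<phi> i \<ge> 0" if i: "\<B> i \<noteq> {0}" for i
  proof -
    obtain m where "\<phi> i = int m * d" using degs[OF i] by auto
    then have "d * \<phi> i = int m * (d * d)" by simp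
    then show ?thesis using d by simp
  qed
  moreover have "d * \<phi> e = 1" using \<phi>e d by simp
  ultimately show thesis using that[OF d t _ s(1-3)] by simp
qed

text \<open>If \<phi> is nonzero at i, then i is not in H', hence not in the degree group off P, so
  the component of degree i lies in P. Passing from \<psi> to \<epsilon> * \<psi> keeps the kernel
  and gives t the value 1.\<close>

lemma cocyclic_structure:
  fixes \<iota> :: "'k::field_char_0 \<Rightarrow> 'b"
  assumes aff: "affine_algebra \<iota>" and \<iota>0: "range \<iota> \<subseteq> \<B> 0" and normal: "normal_domain TYPE('b)"
    and P: "P \<in> Spec1" and H': "H' \<in> cocyclic_overgroups (degree_group_off \<B> P) (grading_group \<B>)"
  obtains \<phi> :: "'g \<Rightarrow> int" and e \<sigma> t s where
    "\<And>x y. x \<in> grading_group \<B> \<Longrightarrow> y \<in> grading_group \<B> \<Longrightarrow> \<phi> (x + y) = \<phi> x + \<phi> y"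
    "\<And>x. x \<in> grading_group \<B> \<Longrightarrow> \<phi> x = 0 \<longleftrightarrow> x \<in> H'"
    "\<And>i. \<B> i \<noteq> {0} \<Longrightarrow> \<phi> i \<ge> 0" "t \<in> \<B> e" "t \<noteq> 0" "\<phi> e = 1" "s \<in> \<B> \<sigma>" "s \<noteq> 0" "\<phi> \<sigma> = 0"
    "\<And>i b. b \<in> \<B> i \<Longrightarrow> \<phi> i > 0 \<Longrightarrow> \<exists>c. s * b = t * c"
proof -
  let ?A = "grading_group \<B>"
  note A = subgroup_grading_group
  obtain \<psi> :: "'g \<Rightarrow> int" where \<psi>: "\<And>x y. x \<in> ?A \<Longrightarrow> y \<in> ?A \<Longrightarrow> \<psi> (x + y) = \<psi> x + \<psi> y"
    "\<And>x. x \<in> ?A \<Longrightarrow> \<psi> x = 0 \<longleftrightarrow> x \<in> H'" "\<exists>x\<in>?A. \<psi> x = 1"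
    by (rule cocyclic_overgroups_functional[OF A H']) (rule that)
  have add: "additive_on_degrees \<psi>"
    unfolding additive_on_degrees_def using \<psi>(1) degree_in_grading_group by simp
  have BP: "\<B> i \<subseteq> P" if "\<psi> i \<noteq> 0" for i
  proof (rule ccontr)
    assume neg: "\<not> \<B> i \<subseteq> P"
    then have "i \<in> degree_group_off \<B> P" unfolding degree_group_off_def by (intro generate.incl) simp
    then have "i \<in> H'" using H' by (auto simp: cocyclic_overgroups_def)
    moreover have "\<B> i \<noteq> {0}" using neg prime_spectrumD(4)[OF Spec1_prime[OF P]] by auto
    ultimately show False using \<psi>(2)[OF degree_in_grading_group] that by simp
  qed
  have gen: "d dvd 1" if d: "\<And>i. \<B> i \<noteq> {0} \<Longrightarrow> d dvd \<psi> i" for d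
  proof -
    obtain x where x: "x \<in> ?A" "\<psi> x = 1" using \<psi>(3) by (rule bexE)
    obtain i j where ij: "\<B> i \<noteq> {0}" "\<B> j \<noteq> {0}" "x = i - j" by (rule grading_group_diff[OF x(1)])
    have "\<psi> x = \<psi> i - \<psi> j"
      unfolding ij(3)
      by (rule additive_diff[OF A \<psi>(1)]) (assumption | rule degree_in_grading_group ij)+
    then show ?thesis using dvd_diff[OF d[OF ij(1)] d[OF ij(2)]] x(2) by simp
  qed
  obtain \<epsilon> e \<sigma> t s where *: "\<epsilon> * \<epsilon> = (1::int)" "t \<in> \<B> e" "t \<noteq> 0" "\<epsilon> * \<psi> e = 1"
    "s \<in> \<B> \<sigma>" "s \<noteq> 0" "\<psi> \<sigma> = 0" "\<And>i. \<B> i \<noteq> {0} \<Longrightarrow> \<epsilon> * \<psi> i \<ge> 0"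
    "\<And>i b. b \<in> \<B> i \<Longrightarrow> \<psi> i \<noteq> 0 \<Longrightarrow> \<exists>c. s * b = t * c"
    by (rule prime_grading_structure[OF aff \<iota>0 normal P add BP gen]) (assumption | rule that)+
  show thesis
  proof (rule that[of "\<lambda>i. \<epsilon> * \<psi> i" t e s \<sigma>])
    have "\<epsilon> \<noteq> 0" using *(1) by auto
    then show "\<epsilon> * \<psi> x = 0 \<longleftrightarrow> x \<in> H'" if "x \<in> ?A" for x using \<psi>(2)[OF that] by simp
    show "\<exists>c. s * b = t * c" if "b \<in> \<B> i" "\<epsilon> * \<psi> i > 0" for i b
      using that by (intro *(9)) auto
  qed (use * \<psi>(1) in \<open>simp_all add: distrib_left\<close>)
qed

lemma of_int_nonzero:
  fixes \<iota> :: "'k::field_char_0 \<Rightarrow> 'b"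
  assumes "affine_algebra \<iota>" "n \<noteq> 0"
  shows "(of_int n :: 'b) \<noteq> 0"
proof
  assume 0: "(of_int n :: 'b) = 0"
  obtain q :: 'b where "q * of_int n = 1" using affine_algebra_int_invertible[OF assms] by auto
  then show False unfolding 0 by simp
qed

lemma support_in_grading_group: "i \<in> support x \<Longrightarrow> i \<in> grading_group \<B>"
  by (intro degree_in_grading_group support_degree)

lemma graded_part_superset: "grading_group \<B> \<subseteq> H \<Longrightarrow> graded_part \<B> H = UNIV"
  by (auto simp: graded_part_iff dest!: support_in_grading_group)

lemma LND_kernel_cocyclic:
  fixes \<iota> :: "'k::field_char_0 \<Rightarrow> 'b"
  assumes aff: "affine_algebra \<iota>" and \<iota>0: "range \<iota> \<subseteq> \<B> 0" and normal: "normal_domain TYPE('b)"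
    and P: "P \<in> Spec1" and H': "H' \<in> cocyclic_overgroups (degree_group_off \<B> P) (grading_group \<B>)"
  shows "\<exists>D\<in>LND UNIV. derivation_ker D = graded_part \<B> H'"
proof -
  let ?A = "grading_group \<B>"
  obtain \<phi> :: "'g \<Rightarrow> int" and e \<sigma> t s where
    \<phi>: "\<And>x y. x \<in> ?A \<Longrightarrow> y \<in> ?A \<Longrightarrow> \<phi> (x + y) = \<phi> x + \<phi> y" "\<And>x. x \<in> ?A \<Longrightarrow> \<phi> x = 0 \<longleftrightarrow> x \<in> H'"
    and nonneg: "\<And>i. \<B> i \<noteq> {0} \<Longrightarrow> \<phi> i \<ge> 0" and t: "t \<in> \<B> e" "t \<noteq> 0" "\<phi> e = 1"
    and s: "s \<in> \<B> \<sigma>" "s \<noteq> 0" "\<phi> \<sigma> = 0"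
    and dv: "\<And>i b. b \<in> \<B> i \<Longrightarrow> \<phi> i > 0 \<Longrightarrow> \<exists>c. s * b = t * c"
    by (rule cocyclic_structure[OF aff \<iota>0 normal P H']) (rule that)
  have add: "additive_on_degrees \<phi>"
    unfolding additive_on_degrees_def using \<phi>(1) degree_in_grading_group by simp
  have U: "subgroup UNIV (additive_group :: 'g monoid)" by (simp add: subgroup_additive_group_iff)
  have UU: "graded_part \<B> UNIV = UNIV" by (rule graded_part_superset) simp
  have te: "0 < \<phi> e" using t(3) by simp
  obtain D where D: "D \<in> HLND \<B> UNIV" "\<And>x. x \<in> graded_part \<B> UNIV \<Longrightarrow> D x = 0 \<longleftrightarrow> (\<forall>i\<in>support x. \<phi> i = 0)"
    by (rule homogeneous_LND_exists[OF U add nonneg t(1,2) UNIV_I te s(1,2) UNIV_I s(3) dv of_int_nonzero[OF aff]])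
      (assumption | rule that)+
  have "derivation_ker D = graded_part \<B> H'"
  proof (rule Set.set_eqI)
    fix x
    have "x \<in> derivation_ker D \<longleftrightarrow> (\<forall>i\<in>support x. \<phi> i = 0)" using D(2)[of x] by (simp add: derivation_ker_def UU)
    also have "\<dots> \<longleftrightarrow> (\<forall>i\<in>support x. i \<in> H')"
      by (rule ball_cong[OF refl]) (rule \<phi>(2)[OF support_in_grading_group])
    finally show "x \<in> derivation_ker D \<longleftrightarrow> x \<in> graded_part \<B> H'" by (simp add: graded_part_iff subset_iff Ball_def)
  qed
  moreover have "D \<in> LND UNIV" using D(1) by (simp add: HLND_def UU)
  ultimately show ?thesis by auto
qed

text \<open>The right exponent is the least positive value q of \<phi> on the elements of H in the
  grading group: a homogeneous x whose degree lies in H and has a positive value has value at least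
  q, so s ^ q * x is a multiple of t ^ q. What remains is to correct t ^ q and s ^ q by factors of
  value 0 until their degrees lie in H.\<close>

lemma HLND_nontrivial:
  fixes \<iota> :: "'k::field_char_0 \<Rightarrow> 'b"
  assumes aff: "affine_algebra \<iota>" and \<iota>0: "range \<iota> \<subseteq> \<B> 0" and normal: "normal_domain TYPE('b)"
    and P: "P \<in> Spec1" and H': "H' \<in> cocyclic_overgroups (degree_group_off \<B> P) (grading_group \<B>)"
    and H: "H \<in> cotorsion_subgroups \<B>"
  shows "HLND \<B> H \<noteq> {\<lambda>_. 0}"
proof -
  let ?A = "grading_group \<B>"
  note A = subgroup_grading_group and AD = subgroup_additive_groupD[OF subgroup_grading_group]
  have HG: "subgroup H additive_group" using H by (simp add: cotorsion_subgroups_def)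
  note HD = subgroup_additive_groupD[OF HG]
  have HA: "subgroup (H \<inter> ?A) additive_group"
    using HD AD by (simp add: subgroup_additive_group_iff)
  interpret HA: subgroup_pair ?A "H \<inter> ?A"
    by (rule subgroup_pair.intro[OF A HA]) simp
  have tors: "\<exists>n::nat. n \<ge> 1 \<and> int_scale (int n) x \<in> H" if "x \<in> ?A" for x
  proof -
    have "torsion_group (quotient_group ?A (H \<inter> ?A))" using H by (simp add: cotorsion_subgroups_def)
    then show ?thesis unfolding HA.torsion_quotient_iff using that by auto
  qed
  obtain \<phi> :: "'g \<Rightarrow> int" and e \<sigma> t s where
    \<phi>: "\<And>x y. x \<in> ?A \<Longrightarrow> y \<in> ?A \<Longrightarrow> \<phi> (x + y) = \<phi> x + \<phi> y" "\<And>x. x \<in> ?A \<Longrightarrow> \<phi> x = 0 \<longleftrightarrow> x \<in> H'"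
    and nonneg: "\<And>i. \<B> i \<noteq> {0} \<Longrightarrow> \<phi> i \<ge> 0" and t: "t \<in> \<B> e" "t \<noteq> 0" "\<phi> e = 1"
    and s: "s \<in> \<B> \<sigma>" "s \<noteq> 0" "\<phi> \<sigma> = 0"
    and dv: "\<And>i b. b \<in> \<B> i \<Longrightarrow> \<phi> i > 0 \<Longrightarrow> \<exists>c. s * b = t * c"
    by (rule cocyclic_structure[OF aff \<iota>0 normal P H']) (rule that)
  have add: "additive_on_degrees \<phi>"
    unfolding additive_on_degrees_def using \<phi>(1) degree_in_grading_group by simp
  note \<phi>_scale = additive_int_scale[OF A \<phi>(1)]
  have \<phi>_diff: "\<phi> (x - y) = \<phi> x - \<phi> y" if "x \<in> ?A" "y \<in> ?A" for x y
    by (rule additive_diff[OF A \<phi>(1)]) (assumption | rule that)+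
  have degA: "i \<in> ?A" if "x \<in> \<B> i" "x \<noteq> 0" for i x
    by (rule degree_in_grading_group) (use that in auto)
  have eA: "e \<in> ?A" and \<sigma>A: "\<sigma> \<in> ?A" using degA t s by auto
  have div1: "\<exists>c\<in>\<B> (i + (\<sigma> - e)). s * b = t * c" if b: "b \<in> \<B> i" "\<phi> i > 0" for b i
  proof -
    obtain c where "s * b = t * c" using dv[OF b] by auto
    then have "component (s * b) (\<sigma> + i) = component (t * c) (\<sigma> + i)" by (rule arg_cong)
    then have "s * b = t * component c (\<sigma> + i - e)"
      unfolding component_mult_homogeneous[OF s(1)] component_mult_homogeneous[OF t(1)]
      by (simp add: component_homogeneous[OF b(1)])
    moreover have "component c (\<sigma> + i - e) \<in> \<B> (i + (\<sigma> - e))"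
      using component_mem[of c "\<sigma> + i - e"] by (simp add: algebra_simps)
    ultimately show ?thesis by (rule bexI)
  qed
  \<comment> \<open>Each division by t lowers \<phi> by 1 and leaves a homogeneous quotient, so a
    value of at least n permits n divisions.\<close>
  have divn: "\<exists>c\<in>\<B> (i + int_scale (int n) (\<sigma> - e)). s ^ n * b = t ^ n * c"
    if "b \<in> \<B> i" "b \<noteq> 0" "\<phi> i \<ge> int n" for n b i
    using that
  proof (induction n arbitrary: b i)
    case (Suc n)
    obtain c where c: "c \<in> \<B> (i + (\<sigma> - e))" "s * b = t * c" using div1[OF Suc.prems(1)] Suc.prems(3) by auto
    have "c \<noteq> 0" using c(2) s(2) Suc.prems(2) by auto
    have "\<phi> (i + (\<sigma> - e)) = \<phi> i - 1"
      using \<phi>(1)[OF degA[OF Suc.prems(1,2)] AD(4)[OF \<sigma>A eA]] \<phi>_diff[OF \<sigma>A eA] s(3) t(3) by simp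
    then have "int n \<le> \<phi> (i + (\<sigma> - e))" using Suc.prems(3) by simp
    from Suc.IH[OF c(1) \<open>c \<noteq> 0\<close> this] obtain c' where
      c': "c' \<in> \<B> (i + (\<sigma> - e) + int_scale (int n) (\<sigma> - e))" "s ^ n * c = t ^ n * c'" by auto
    have "s ^ Suc n * b = s ^ n * (s * b)" by (simp add: algebra_simps)
    also have "\<dots> = t * (s ^ n * c)" unfolding c(2) by (simp add: algebra_simps)
    also have "\<dots> = t ^ Suc n * c'" unfolding c'(2) by (simp add: algebra_simps)
    finally have "s ^ Suc n * b = t ^ Suc n * c'" .
    moreover have "c' \<in> \<B> (i + int_scale (int (Suc n)) (\<sigma> - e))"
      using c'(1) by (simp add: int_scale.scale_left_distrib add.assoc)
    ultimately show ?case by (rule bexI)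
  qed auto
  \<comment> \<open>If i - j has value 0, then i and j have the same value n. Replacing n factors t
    by s shifts both by the same \<delta> down to value 0, and their difference is
    unchanged.\<close>
  have ker: "\<exists>i j. \<B> i \<noteq> {0} \<and> \<B> j \<noteq> {0} \<and> \<phi> i = 0 \<and> \<phi> j = 0 \<and> x = i - j" if x: "x \<in> ?A" "\<phi> x = 0" for x
  proof -
    obtain i j where ij: "\<B> i \<noteq> {0}" "\<B> j \<noteq> {0}" "x = i - j" by (rule grading_group_diff[OF x(1)])
    have ijA: "i \<in> ?A" "j \<in> ?A" using ij(1,2) by (simp_all add: degree_in_grading_group)
    have eq: "\<phi> i = \<phi> j" using \<phi>_diff[OF ijA] x(2) ij(3) by simp
    define n where "n = nat (\<phi> i)"
    have n: "\<phi> i = int n" "\<phi> j = int n" using nonneg[OF ij(1)] eq by (simp_all add: n_def)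
    define \<delta> where "\<delta> = int_scale (int n) (\<sigma> - e)"
    have \<delta>A: "\<delta> \<in> ?A" unfolding \<delta>_def by (rule int_scale_mem[OF A AD(4)[OF \<sigma>A eA]])
    have \<phi>\<delta>: "\<phi> \<delta> = - int n"
      using \<phi>_scale[OF _ _ AD(4)[OF \<sigma>A eA], of "int n"] \<phi>_diff[OF \<sigma>A eA] s(3) t(3)
      by (simp add: \<delta>_def)
    have shift: "\<B> (k + \<delta>) \<noteq> {0} \<and> \<phi> (k + \<delta>) = 0" if k: "\<B> k \<noteq> {0}" "\<phi> k = int n" for k
    proof -
      obtain b where b: "b \<in> \<B> k" "b \<noteq> 0" using degree_nonzero[OF k(1)] by auto
      obtain c where c: "c \<in> \<B> (k + \<delta>)" "s ^ n * b = t ^ n * c" using divn[OF b, of n] k(2) unfolding \<delta>_def by auto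
      have "c \<noteq> 0" using c(2) s(2) b(2) by auto
      then have "\<B> (k + \<delta>) \<noteq> {0}" using c(1) by auto
      moreover have "\<phi> (k + \<delta>) = 0" using \<phi>(1)[OF degree_in_grading_group[OF k(1)] \<delta>A] \<phi>\<delta> k(2) by simp
      ultimately show ?thesis ..
    qed
    have "x = (i + \<delta>) - (j + \<delta>)" using ij(3) by simp
    with shift[OF ij(1) n(1)] shift[OF ij(2) n(2)] show ?thesis by metis
  qed
  \<comment> \<open>The positive values of \<phi> on H form a nonempty set: a multiple of e lies in
    H, as H is cotorsion.\<close>
  define Q where "Q q \<longleftrightarrow> q > 0 \<and> (\<exists>u\<in>H \<inter> ?A. \<phi> u = int q)" for q
  have "\<exists>q. Q q"
  proof -
    obtain m :: nat where m: "m \<ge> 1" "int_scale (int m) e \<in> H" using tors[OF eA] by auto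
    have "\<phi> (int_scale (int m) e) = int m" using \<phi>_scale[OF _ _ eA, of "int m"] t(3) by simp
    then have "Q m" unfolding Q_def using m int_scale_mem[OF A eA] by auto
    then show ?thesis ..
  qed
  then obtain q where Qq: "Q q" and least: "\<And>k. Q k \<Longrightarrow> q \<le> k"
    using LeastI_ex[of Q] Least_le[of Q] by auto
  obtain u where u: "u \<in> H" "u \<in> ?A" "\<phi> u = int q" and q0: "q > 0" using Qq by (auto simp: Q_def)
  define qe where "qe = int_scale (int q) e"
  have qeA: "qe \<in> ?A" unfolding qe_def by (rule int_scale_mem[OF A eA])
  have \<phi>qe: "\<phi> qe = int q" unfolding qe_def using \<phi>_scale[OF _ _ eA, of "int q"] t(3) by simp
  have "\<phi> (u - qe) = 0" using \<phi>_diff[OF u(2) qeA] u(3) \<phi>qe by simp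
  from ker[OF AD(4)[OF u(2) qeA] this] obtain i j where
    ij: "\<B> i \<noteq> {0}" "\<B> j \<noteq> {0}" "\<phi> i = 0" "\<phi> j = 0" "u - qe = i - j" by auto
  have ijA: "i \<in> ?A" "j \<in> ?A" using ij(1,2) by (simp_all add: degree_in_grading_group)
  obtain a where a: "a \<in> \<B> i" "a \<noteq> 0" using degree_nonzero[OF ij(1)] by auto
  obtain b where b: "b \<in> \<B> j" "b \<noteq> 0" using degree_nonzero[OF ij(2)] by auto
  \<comment> \<open>To move q e to u in H one would multiply by a and divide by b. As the N-fold
    multiple of j lies in H, multiplying by b ^ N' with N' = N - 1 replaces the division modulo
    H.\<close>
  obtain N :: nat where N: "N \<ge> 1" "int_scale (int N) j \<in> H" using tors[OF ijA(2)] by auto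
  then obtain N' where N': "N = Suc N'" by (cases N) auto
  have pow: "x ^ n \<in> \<B> (int_scale (int n) k)" if "x \<in> \<B> k" for x k n
    unfolding int_scale_int using that by (induction n) (auto simp: one_mem mult_mem)
  define c where "c = a * b ^ N'"
  define \<gamma> where "\<gamma> = i + int_scale (int N') j"
  have c: "c \<in> \<B> \<gamma>" "c \<noteq> 0"
    using a b mult_mem[OF a(1) pow[OF b(1)]] by (simp_all add: c_def \<gamma>_def)
  have \<gamma>A: "\<gamma> \<in> ?A" by (rule degA[OF c])
  have \<phi>\<gamma>: "\<phi> \<gamma> = 0"
    using \<phi>(1)[OF ijA(1) int_scale_mem[OF A ijA(2), of "int N'"]] \<phi>_scale[OF _ _ ijA(2), of "int N'"] ij(3,4)
    by (simp add: \<gamma>_def)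
  define t' where "t' = t ^ q * c"
  define e' where "e' = qe + \<gamma>"
  have t': "t' \<in> \<B> e'" "t' \<noteq> 0"
    using mult_mem[OF pow[OF t(1)] c(1)] t(2) c(2) by (simp_all add: t'_def e'_def qe_def)
  have \<phi>e': "\<phi> e' = int q" unfolding e'_def using \<phi>(1)[OF qeA \<gamma>A] \<phi>qe \<phi>\<gamma> by simp
  have "e' = u + int_scale (int N) j"
    using ij(5) by (simp add: e'_def \<gamma>_def N' int_scale.scale_left_distrib algebra_simps)
  then have e'H: "e' \<in> H" using HD(2)[OF u(1) N(2)] by simp
  \<comment> \<open>The factor c is put into w as well, because the divisor t' contains it. A power
    of w then has its degree in H, and one factor w of it already gives divisibility by t'.\<close>
  define w where "w = s ^ q * c"
  define \<omega> where "\<omega> = int_scale (int q) \<sigma> + \<gamma>"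
  have w: "w \<in> \<B> \<omega>" "w \<noteq> 0"
    using mult_mem[OF pow[OF s(1)] c(1)] s(2) c(2) by (simp_all add: w_def \<omega>_def)
  have \<omega>A: "\<omega> \<in> ?A" by (rule degA[OF w])
  have \<phi>\<omega>: "\<phi> \<omega> = 0"
    using \<phi>(1)[OF int_scale_mem[OF A \<sigma>A, of "int q"] \<gamma>A] \<phi>_scale[OF _ _ \<sigma>A, of "int q"] s(3) \<phi>\<gamma>
    by (simp add: \<omega>_def)
  obtain M :: nat where M: "M \<ge> 1" "int_scale (int M) \<omega> \<in> H" using tors[OF \<omega>A] by auto
  then obtain M' where M': "M = Suc M'" by (cases M) auto
  have s': "w ^ M \<in> \<B> (int_scale (int M) \<omega>)" "w ^ M \<noteq> 0" using pow[OF w(1)] w(2) by simp_all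
  have \<phi>s': "\<phi> (int_scale (int M) \<omega>) = 0" using \<phi>_scale[OF _ _ \<omega>A, of "int M"] \<phi>\<omega> by simp
  have dv': "\<exists>d. w ^ M * x = t' * d" if k: "k \<in> H" "x \<in> \<B> k" "\<phi> k > 0" for k x
  proof (cases "x = 0")
    case True
    then show ?thesis by (intro exI[of _ 0]) simp
  next
    case False
    have "Q (nat (\<phi> k))" unfolding Q_def using k(1,3) degA[OF k(2) False] by (intro conjI bexI[of _ k]) auto
    then have "int q \<le> \<phi> k" using least k(3) by fastforce
    from divn[OF k(2) False this] obtain d where d: "s ^ q * x = t ^ q * d" by auto
    have "w ^ M * x = w ^ M' * c * (s ^ q * x)" by (simp add: M' w_def algebra_simps)
    also have "\<dots> = t' * (w ^ M' * d)" unfolding d t'_def by (simp add: algebra_simps)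
    finally show ?thesis ..
  qed
  have nonneg': "\<phi> i \<ge> 0" if "i \<in> H" "\<B> i \<noteq> {0}" for i using nonneg[OF that(2)] .
  have te: "0 < \<phi> e'" using \<phi>e' q0 by simp
  obtain D where D: "D \<in> HLND \<B> H" "\<And>x. x \<in> graded_part \<B> H \<Longrightarrow> D x = 0 \<longleftrightarrow> (\<forall>i\<in>support x. \<phi> i = 0)"
    by (rule homogeneous_LND_exists[OF HG add nonneg' t' e'H te s' M(2) \<phi>s' dv' of_int_nonzero[OF aff]])
      (assumption | rule that)+
  have "D t' \<noteq> 0"
    using D(2)[OF homogeneous_graded_part[OF t'(1) e'H]] homogeneous_in_support[OF t'] te by auto
  then have "D \<noteq> (\<lambda>_. 0)" by auto
  with D(1) show ?thesis by auto
qed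

end

section \<open>Finitely generated grading groups\<close>

text \<open>One finite set T of components of generators serves every prime. For P = {0} this makes
  the grading group finitely generated; as P varies, only the subset of T outside P matters, which
  leaves finitely many groups.\<close>

lemma (in graded_domain) degree_group_off_generators:
  fixes \<iota> :: "'k::field \<Rightarrow> 'b"
  assumes aff: "affine_algebra \<iota>" and \<iota>0: "range \<iota> \<subseteq> \<B> 0"
  obtains T :: "('g \<times> 'b) set" where "finite T"
    "\<And>P. P \<in> prime_spectrum \<Longrightarrow> degree_group_off \<B> P = generate additive_group (fst ` {p \<in> T. snd p \<notin> P})"
proof -
  obtain S where S: "finite S" "\<And>A. subring_set A \<Longrightarrow> range \<iota> \<subseteq> A \<Longrightarrow> S \<subseteq> A \<Longrightarrow> A = UNIV"
    by (rule affine_algebra_generators[OF aff]) (rule that)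
  define T where "T = (\<Union>x\<in>S. (\<lambda>i. (i, component x i)) ` support x)"
  have "finite T" unfolding T_def using S(1) by simp
  moreover have "degree_group_off \<B> P = generate additive_group (fst ` {p \<in> T. snd p \<notin> P})"
    if P: "P \<in> prime_spectrum" for P
  proof
    let ?L = "generate additive_group (fst ` {p \<in> T. snd p \<notin> P})"
    note Pi = prime_spectrumD(1)[OF P]
    have L: "subgroup ?L additive_group" by (rule subgroup_generate_additive)
    note LD = subgroup_additive_groupD[OF L]
    show "?L \<subseteq> degree_group_off \<B> P"
    proof (rule generate_additive_least)
      show "subgroup (degree_group_off \<B> P) additive_group"
        unfolding degree_group_off_def by (rule subgroup_generate_additive)
      show "fst ` {p \<in> T. snd p \<notin> P} \<subseteq> degree_group_off \<B> P"
      proof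
        fix i assume "i \<in> fst ` {p \<in> T. snd p \<notin> P}"
        then obtain x where "component x i \<notin> P" by (auto simp: T_def)
        then have "\<not> \<B> i \<subseteq> P" using subsetD[of "\<B> i" P, OF _ component_mem] by metis
        then show "i \<in> degree_group_off \<B> P" unfolding degree_group_off_def by (intro generate.incl) simp
      qed
    qed
    define A where "A = {x. \<forall>i. i \<notin> ?L \<longrightarrow> component x i \<in> P}"
    have "A = UNIV"
    proof (rule S(2))
      have deg0: "x \<in> A" if "x \<in> \<B> 0" for x
        using LD(1) ideal_setD(1)[OF Pi] by (auto simp: A_def component_homogeneous[OF that])
      then show "range \<iota> \<subseteq> A" using \<iota>0 by auto
      show "S \<subseteq> A"
      proof
        fix x assume x: "x \<in> S"
        have "i \<in> ?L" if "component x i \<notin> P" for i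
        proof (rule generate.incl)
          have "i \<in> support x" using that ideal_setD(1)[OF Pi] by (auto simp: support_iff)
          then have "(i, component x i) \<in> T" using x by (auto simp: T_def)
          then show "i \<in> fst ` {p \<in> T. snd p \<notin> P}" using that by force
        qed
        then show "x \<in> A" unfolding A_def by auto
      qed
      show "subring_set A"
        unfolding subring_set_def
      proof (intro conjI ballI)
        show "1 \<in> A" by (rule deg0[OF one_mem])
        fix x assume x: "x \<in> A"
        show "- x \<in> A" using x ideal_setD(3)[OF Pi, of _ "-1"] by (simp add: A_def)
        fix y assume y: "y \<in> A"
        show "x + y \<in> A" using x y ideal_setD(2)[OF Pi] by (simp add: A_def)
        have "component (x * y) k \<in> P" if k: "k \<notin> ?L" for k
          unfolding component_mult
        proof (rule ideal_set_sum[OF Pi])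
          fix i
          show "component x i * component y (k - i) \<in> P"
          proof (cases "i \<in> ?L")
            case True
            have "k - i \<notin> ?L"
            proof
              assume "k - i \<in> ?L"
              from LD(2)[OF this True] k show False by simp
            qed
            then show ?thesis using y ideal_setD(3)[OF Pi] by (simp add: A_def)
          next
            case False
            then show ?thesis using x ideal_setD(4)[OF Pi] by (simp add: A_def)
          qed
        qed
        then show "x * y \<in> A" by (simp add: A_def)
      qed
    qed
    show "degree_group_off \<B> P \<subseteq> ?L"
      unfolding degree_group_off_def
    proof (rule generate_additive_least[OF _ L], rule subsetI)
      fix i assume "i \<in> {i. \<not> \<B> i \<subseteq> P}"
      then obtain b where b: "b \<in> \<B> i" "b \<notin> P" by auto
      have "b \<in> A" using \<open>A = UNIV\<close> by simp
      then show "i \<in> ?L" using b component_homogeneous[OF b(1), of i] by (auto simp: A_def)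
    qed
  qed
  ultimately show thesis by (rule that)
qed

lemma (in graded_ring) degree_group_off_zero: "degree_group_off \<B> {0} = grading_group \<B>"
proof -
  have "\<B> i \<subseteq> {0} \<longleftrightarrow> \<B> i = {0}" for i using mem(1)[of i] by auto
  then show ?thesis by (simp add: degree_group_off_def grading_group_def)
qed

lemma (in graded_ring) subgroup_degree_group_off: "subgroup (degree_group_off \<B> P) additive_group"
  unfolding degree_group_off_def by (rule subgroup_generate_additive)

lemma (in graded_ring) degree_group_off_subset:
  assumes "0 \<in> P" shows "degree_group_off \<B> P \<subseteq> grading_group \<B>"
  unfolding degree_group_off_def
proof (rule generate_additive_least[OF _ subgroup_grading_group], rule subsetI)
  fix i assume "i \<in> {i. \<not> \<B> i \<subseteq> P}"
  then show "i \<in> grading_group \<B>" using assms by (intro degree_in_grading_group) auto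
qed

lemma (in graded_domain) grading_group_finitely_generated:
  fixes \<iota> :: "'k::field \<Rightarrow> 'b"
  assumes "affine_algebra \<iota>" "range \<iota> \<subseteq> \<B> 0"
  obtains E where "finite E" "grading_group \<B> = generate additive_group E"
proof -
  obtain T :: "('g \<times> 'b) set" where T: "finite T"
    "\<And>P. P \<in> prime_spectrum \<Longrightarrow> degree_group_off \<B> P = generate additive_group (fst ` {p \<in> T. snd p \<notin> P})"
    by (rule degree_group_off_generators[OF assms]) (rule that)
  show thesis
    by (rule that[OF _ T(2)[OF zero_in_prime_spectrum, unfolded degree_group_off_zero]]) (use T(1) in simp)
qed

lemma (in graded_domain) finite_degree_groups_off:
  fixes \<iota> :: "'k::field \<Rightarrow> 'b"
  assumes "affine_algebra \<iota>" "range \<iota> \<subseteq> \<B> 0"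
  shows "finite (degree_group_off \<B> ` Spec1)"
proof -
  obtain T :: "('g \<times> 'b) set" where T: "finite T"
    "\<And>P. P \<in> prime_spectrum \<Longrightarrow> degree_group_off \<B> P = generate additive_group (fst ` {p \<in> T. snd p \<notin> P})"
    by (rule degree_group_off_generators[OF assms]) (rule that)
  have "degree_group_off \<B> ` Spec1 \<subseteq> (\<lambda>T. generate additive_group (fst ` T)) ` Pow T"
  proof
    fix M assume "M \<in> degree_group_off \<B> ` Spec1"
    then obtain P where P: "P \<in> Spec1" "M = degree_group_off \<B> P" by auto
    then have "M = generate additive_group (fst ` {p \<in> T. snd p \<notin> P})" using T(2)[OF Spec1_prime] by simp
    then show "M \<in> (\<lambda>T. generate additive_group (fst ` T)) ` Pow T" by (rule image_eqI) auto
  qed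
  then show ?thesis using T(1) by (meson finite_Pow_iff finite_imageI finite_subset)
qed

section \<open>Finitely generated groups modulo a subgroup with torsion-free quotient\<close>

definition int_comb :: "nat set \<Rightarrow> (nat \<Rightarrow> int) \<Rightarrow> (nat \<Rightarrow> 'g::ab_group_add) \<Rightarrow> 'g"
  where "int_comb I n e = (\<Sum>i\<in>I. int_scale (n i) (e i))"

definition generates_mod :: "'g::ab_group_add set \<Rightarrow> 'g set \<Rightarrow> nat set \<Rightarrow> (nat \<Rightarrow> 'g) \<Rightarrow> bool"
  where "generates_mod W A I e \<longleftrightarrow> finite I \<and> (\<forall>i\<in>I. e i \<in> A) \<and> (\<forall>x\<in>A. \<exists>n. x - int_comb I n e \<in> W)"

lemma int_comb_add: "int_comb I (\<lambda>i. m i + n i) e = int_comb I m e + int_comb I n e"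
  by (simp add: int_comb_def int_scale.scale_left_distrib sum.distrib)

lemma int_comb_diff: "int_comb I (\<lambda>i. m i - n i) e = int_comb I m e - int_comb I n e"
  by (simp add: int_comb_def int_scale.scale_left_diff_distrib sum_subtractf)

lemma int_comb_single: "finite I \<Longrightarrow> i \<in> I \<Longrightarrow> int_comb I (\<lambda>j. if j = i then k else 0) e = int_scale k (e i)"
proof -
  assume "finite I" "i \<in> I"
  then have "(\<Sum>j\<in>I. int_scale (if j = i then k else 0) (e j)) = (\<Sum>j\<in>I. if j = i then int_scale k (e i) else 0)"
    by (intro sum.cong) auto
  with \<open>finite I\<close> \<open>i \<in> I\<close> show ?thesis by (simp add: int_comb_def)
qed

lemma int_comb_mem:
  assumes A: "subgroup A (additive_group :: 'g::ab_group_add monoid)" and "\<And>i. i \<in> I \<Longrightarrow> e i \<in> A"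
  shows "int_comb I n e \<in> A"
  unfolding int_comb_def using assms(2)
  by (induction I rule: infinite_finite_induct)
    (auto simp: subgroup_additive_groupD[OF A] int_scale_mem[OF A])

text \<open>One step of the Euclidean algorithm on the coefficients, compensated by a change of one
  generator.\<close>

lemma int_comb_transvection:
  assumes "finite I" "i \<in> I" "j \<in> I" "i \<noteq> j"
  shows "int_comb I (n(i := n i - k * n j)) (e(j := e j + int_scale k (e i))) = int_comb I n e"
proof -
  let ?R = "I - {i} - {j}"
  have split: "int_comb I n' e' = int_scale (n' i) (e' i) + (int_scale (n' j) (e' j) + int_comb ?R n' e')" for n' e'
    unfolding int_comb_def using assms
    by (simp add: sum.remove[of I i] sum.remove[of "I - {i}" j])
  have "int_comb ?R (n(i := n i - k * n j)) (e(j := e j + int_scale k (e i))) = int_comb ?R n e"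
    unfolding int_comb_def by (rule sum.cong) auto
  then show ?thesis unfolding split[of n] split[of "n(i := n i - k * n j)"] using assms(4)
    by (simp add: int_scale.scale_left_diff_distrib int_scale.scale_right_distrib mult.commute)
qed

lemma generates_mod_exists:
  assumes A: "A = generate additive_group E" "finite E"
    and W: "subgroup W (additive_group :: 'g::ab_group_add monoid)"
  shows "\<exists>I e. generates_mod W A I e"
proof -
  obtain es where es: "set es = E" using finite_list[OF A(2)] by auto
  define I where "I = {..<length es}"
  define e where "e i = es ! i" for i
  have eA: "e i \<in> A" if "i \<in> I" for i
  proof -
    have "e i \<in> E" using that es by (auto simp: I_def e_def)
    then show ?thesis unfolding A(1) by (rule generate.incl)
  qed
  let ?K = "range (\<lambda>n. int_comb I n e)"
  have "A \<subseteq> ?K"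
    unfolding A(1)
  proof (rule generate_additive_least)
    show "E \<subseteq> ?K"
    proof
      fix x assume "x \<in> E"
      then obtain i where i: "i \<in> I" "x = e i" unfolding es[symmetric] I_def e_def by (metis in_set_conv_nth lessThan_iff)
      have "int_comb I (\<lambda>j. if j = i then 1 else 0) e = x" using int_comb_single[of I i 1 e] i by (simp add: I_def)
      then show "x \<in> ?K" by (metis rangeI)
    qed
    have K0: "0 \<in> ?K" by (rule range_eqI[of _ _ "\<lambda>_. 0"]) (simp add: int_comb_def)
    have Kd: "x - y \<in> ?K" if "x \<in> ?K" "y \<in> ?K" for x y
      using that by (auto simp flip: int_comb_diff)
    have Km: "- y \<in> ?K" if "y \<in> ?K" for y using Kd[OF K0 that] by simp
    have Kp: "x + y \<in> ?K" if "x \<in> ?K" "y \<in> ?K" for x y using Kd[OF that(1) Km[OF that(2)]] by simp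
    show "subgroup ?K additive_group" unfolding subgroup_additive_group_iff using K0 Km Kp by metis
  qed
  then have "\<exists>n. x - int_comb I n e \<in> W" if xA: "x \<in> A" for x
  proof -
    obtain n where "x = int_comb I n e" using subsetD[OF \<open>A \<subseteq> ?K\<close> xA] by auto
    then have "x - int_comb I n e = 0" by simp
    then show ?thesis using subgroup_additive_groupD(1)[OF W] by metis
  qed
  then have "generates_mod W A I e" unfolding generates_mod_def using eA by (simp add: I_def)
  then show ?thesis by auto
qed

definition basis_mod :: "'g::ab_group_add set \<Rightarrow> 'g set \<Rightarrow> nat set \<Rightarrow> (nat \<Rightarrow> 'g) \<Rightarrow> bool"
  where "basis_mod W A I e \<longleftrightarrow> generates_mod W A I e \<and>
    (\<forall>n. int_comb I n e \<in> W \<longrightarrow> (\<forall>i\<in>I. n i = 0))"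

text \<open>Among the generating families of minimal size, a nontrivial relation of minimal total size
  has a single nonzero coefficient, since otherwise a transvection would decrease it; as the
  quotient is torsion-free, the corresponding generator is superfluous.\<close>

lemma basis_mod_exists:
  assumes A: "A = generate additive_group E" "finite E"
    and W: "subgroup W (additive_group :: 'g::ab_group_add monoid)"
    and tf: "\<And>x k. x \<in> A \<Longrightarrow> k \<noteq> 0 \<Longrightarrow> int_scale k x \<in> W \<Longrightarrow> x \<in> W"
  shows "\<exists>I e. basis_mod W A I e"
proof -
  note WD = subgroup_additive_groupD[OF W]
  have AG: "subgroup A additive_group" unfolding A(1) by (rule subgroup_generate_additive)
  note AD = subgroup_additive_groupD[OF AG]
  obtain p0 where p0: "(\<lambda>(I, e). generates_mod W A I e) p0" using generates_mod_exists[OF A W] by auto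
  obtain p where p: "(\<lambda>(I, e). generates_mod W A I e) p \<and>
    (\<forall>q. (\<lambda>(I, e). generates_mod W A I e) q \<longrightarrow> card (fst p) \<le> card (fst q))"
    using ex_has_least_nat[of "\<lambda>(I, e). generates_mod W A I e", OF p0, of "\<lambda>p. card (fst p)"] by (rule exE)
  define I where "I = fst p"
  have genp: "generates_mod W A I (snd p)" using conjunct1[OF p] by (simp add: I_def split: prod.splits)
  have min: "card I \<le> card J" if "generates_mod W A J e" for J e
    using conjunct2[OF p, THEN spec, of "(J, e)"] that by (simp add: I_def)
  have finI: "finite I" using genp by (simp add: generates_mod_def)
  \<comment> \<open>Generating families and nontrivial relations modulo W vary together over the
    fixed index set I of minimal size.\<close>
  define R where "R = (\<lambda>(e, n). generates_mod W A I e \<and> int_comb I n e \<in> W \<and> (\<exists>i\<in>I. n i \<noteq> 0))"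
  define size where "size = (\<lambda>(e::nat \<Rightarrow> 'g, n). \<Sum>i\<in>I. nat \<bar>n i\<bar>)"
  have "\<not> R q" for q
  proof
    assume "R q"
    from ex_has_least_nat[of R, OF this, of size]
    obtain q' where q': "R q'" "\<And>q. R q \<Longrightarrow> size q' \<le> size q" by auto
    obtain e n where en: "q' = (e, n)" by (cases q')
    have gen: "generates_mod W A I e" and rel: "int_comb I n e \<in> W" and nz: "\<exists>i\<in>I. n i \<noteq> 0"
      using q'(1) by (simp_all add: R_def en)
    have eA: "\<And>i. i \<in> I \<Longrightarrow> e i \<in> A" and sp: "\<And>x. x \<in> A \<Longrightarrow> \<exists>n. x - int_comb I n e \<in> W"
      using gen by (simp_all add: generates_mod_def)
    have no2: False if ij: "i \<in> I" "j \<in> I" "i \<noteq> j" "n j \<noteq> 0" "\<bar>n j\<bar> \<le> \<bar>n i\<bar>" for i j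
    proof -
      \<comment> \<open>The sign for which \<open>\<bar>n i - k * n j\<bar>\<close> becomes
        \<open>\<bar>n i\<bar> - \<bar>n j\<bar>\<close>.\<close>
      define k where "k = sgn (n i) * sgn (n j)"
      define n' where "n' = n(i := n i - k * n j)"
      define e' where "e' = e(j := e j + int_scale k (e i))"
      have tv: "int_comb I (m(i := m i - k * m j)) e' = int_comb I m e" for m
        unfolding e'_def by (rule int_comb_transvection[OF finI ij(1-3)])
      have "generates_mod W A I e'"
        unfolding generates_mod_def
      proof (intro conjI ballI)
        show "e' l \<in> A" if "l \<in> I" for l
          using that eA ij by (auto simp: e'_def int_scale_mem[OF AG] AD(2))
        fix x assume "x \<in> A"
        then obtain m where "x - int_comb I m e \<in> W" using sp by auto
        then show "\<exists>n. x - int_comb I n e' \<in> W" unfolding tv[of m, symmetric] by auto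
      qed (rule finI)
      moreover have "int_comb I n' e' \<in> W" using rel tv[of n] by (simp add: n'_def)
      moreover have "n' j \<noteq> 0" using ij by (simp add: n'_def)
      ultimately have "R (e', n')" using ij(2) by (auto simp: R_def)
      then have le: "size (e, n) \<le> size (e', n')" using q'(2) by (simp add: en)
      have abs: "\<bar>n i - k * n j\<bar> = \<bar>n i\<bar> - \<bar>n j\<bar>"
        using ij(4,5) unfolding k_def by (cases "n i" "0::int" rule: linorder_cases; cases "n j" "0::int" rule: linorder_cases) auto
      have "(\<Sum>l\<in>I. nat \<bar>n' l\<bar>) < (\<Sum>l\<in>I. nat \<bar>n l\<bar>)"
      proof (rule sum_strict_mono_ex1[OF finI])
        show "\<forall>l\<in>I. nat \<bar>n' l\<bar> \<le> nat \<bar>n l\<bar>" using abs by (auto simp: n'_def)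
        have "nat \<bar>n' i\<bar> < nat \<bar>n i\<bar>" using abs ij(4,5) by (simp add: n'_def)
        then show "\<exists>l\<in>I. nat \<bar>n' l\<bar> < nat \<bar>n l\<bar>" using ij(1) by auto
      qed
      then show False using le by (simp add: size_def)
    qed
    obtain i where i: "i \<in> I" "n i \<noteq> 0" using nz by auto
    have zero: "n j = 0" if "j \<in> I" "j \<noteq> i" for j
    proof (rule ccontr)
      assume "n j \<noteq> 0"
      then show False using no2[of i j] no2[of j i] that i by (cases "\<bar>n j\<bar> \<le> \<bar>n i\<bar>") auto
    qed
    have comb_i: "int_comb I m e = int_scale (m i) (e i) + int_comb (I - {i}) m e" for m
      unfolding int_comb_def by (rule sum.remove[OF finI i(1)])
    have "int_comb (I - {i}) n e = 0" unfolding int_comb_def by (rule sum.neutral) (simp add: zero)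
    then have "int_scale (n i) (e i) \<in> W" using rel comb_i[of n] by simp
    then have eW: "e i \<in> W" using tf[OF eA[OF i(1)] i(2)] by simp
    have "generates_mod W A (I - {i}) e"
      unfolding generates_mod_def
    proof (intro conjI ballI)
      fix x assume "x \<in> A"
      then obtain m where m: "x - int_comb I m e \<in> W" using sp by auto
      have "x - int_comb (I - {i}) m e = (x - int_comb I m e) + int_scale (m i) (e i)"
        by (simp add: comb_i)
      also have "\<dots> \<in> W" using m int_scale_mem[OF W eW] by (rule WD(2))
      finally show "\<exists>m. x - int_comb (I - {i}) m e \<in> W" by auto
    qed (use finI eA in auto)
    from min[OF this] have "card I \<le> card (I - {i})" .
    then show False using finI i(1) by (metis card_Diff1_less not_le)
  qed
  then have "\<not> R (snd p, n)" for n .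
  then have "basis_mod W A I (snd p)" unfolding basis_mod_def using genp by (auto simp: R_def)
  then show ?thesis by auto
qed

text \<open>Independence makes coordinates unique, and uniqueness makes them additive. These
  functionals later cut out the cocyclic overgroups and compute the rank.\<close>

lemma basis_mod_coordinates:
  assumes A: "subgroup A (additive_group :: 'g::ab_group_add monoid)" and W: "subgroup W additive_group" "W \<subseteq> A"
    and b: "basis_mod W A I e"
  obtains c :: "'g::ab_group_add \<Rightarrow> nat \<Rightarrow> int" where
    "\<And>x. x \<in> A \<Longrightarrow> x - int_comb I (c x) e \<in> W"
    "\<And>x y i. x \<in> A \<Longrightarrow> y \<in> A \<Longrightarrow> i \<in> I \<Longrightarrow> c (x + y) i = c x i + c y i"
    "\<And>x. x \<in> A \<Longrightarrow> (\<forall>i\<in>I. c x i = 0) \<longleftrightarrow> x \<in> W"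
    "\<And>i j. i \<in> I \<Longrightarrow> j \<in> I \<Longrightarrow> c (e i) j = (if j = i then 1 else 0)"
proof -
  note WD = subgroup_additive_groupD[OF W(1)] and AD = subgroup_additive_groupD[OF A]
  have finI: "finite I" and eA: "\<And>i. i \<in> I \<Longrightarrow> e i \<in> A"
    and sp: "\<And>x. x \<in> A \<Longrightarrow> \<exists>n. x - int_comb I n e \<in> W"
    and ind: "\<And>n i. int_comb I n e \<in> W \<Longrightarrow> i \<in> I \<Longrightarrow> n i = 0"
    using b by (simp_all add: basis_mod_def generates_mod_def)
  obtain c where c: "\<And>x. x \<in> A \<Longrightarrow> x - int_comb I (c x) e \<in> W" using sp by metis
  have uniq: "c x i = n i" if x: "x \<in> A" "x - int_comb I n e \<in> W" "i \<in> I" for x n i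
  proof -
    have "int_comb I (\<lambda>i. c x i - n i) e = (x - int_comb I n e) - (x - int_comb I (c x) e)"
      by (simp add: int_comb_diff)
    also have "\<dots> \<in> W" using x(2) c[OF x(1)] by (rule WD(4))
    finally have "int_comb I (\<lambda>i. c x i - n i) e \<in> W" .
    from ind[OF this x(3)] show ?thesis by simp
  qed
  have 1: "c (x + y) i = c x i + c y i" if xy: "x \<in> A" "y \<in> A" "i \<in> I" for x y i
  proof (rule uniq[OF AD(2)[OF xy(1,2)] _ xy(3)])
    have "(x + y) - int_comb I (\<lambda>i. c x i + c y i) e = (x - int_comb I (c x) e) + (y - int_comb I (c y) e)"
      by (simp add: int_comb_add)
    also have "\<dots> \<in> W" using c[OF xy(1)] c[OF xy(2)] by (rule WD(2))
    finally show "(x + y) - int_comb I (\<lambda>i. c x i + c y i) e \<in> W" .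
  qed
  have 2: "(\<forall>i\<in>I. c x i = 0) \<longleftrightarrow> x \<in> W" if x: "x \<in> A" for x
  proof
    assume "\<forall>i\<in>I. c x i = 0"
    then have "int_comb I (c x) e = 0" unfolding int_comb_def by (intro sum.neutral) simp
    then show "x \<in> W" using c[OF x] by simp
  next
    assume "x \<in> W"
    then have "x - int_comb I (\<lambda>_. 0) e \<in> W" by (simp add: int_comb_def)
    then show "\<forall>i\<in>I. c x i = 0" using uniq[OF x, of "\<lambda>_. 0"] by simp
  qed
  have 3: "c (e i) j = (if j = i then 1 else 0)" if ij: "i \<in> I" "j \<in> I" for i j
    by (rule uniq[OF eA[OF ij(1)] _ ij(2)]) (simp add: int_comb_single[OF finI ij(1)] WD(1))
  show thesis by (rule that[OF c 1 2 3])
qed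

lemma (in subgroup_pair) torc_torsion_free:
  assumes "x \<in> A" "k \<noteq> 0" "int_scale k x \<in> torc H A"
  shows "x \<in> torc H A"
proof -
  obtain m :: nat where m: "m \<ge> 1" "int_scale (int m) (int_scale k x) \<in> H" using assms(3) by (auto simp: torc_iff)
  have "int_scale (int (m * nat \<bar>k\<bar>)) x = int_scale (sgn k) (int_scale (int m) (int_scale k x))"
  proof -
    have "int (m * nat \<bar>k\<bar>) = sgn k * (int m * k)" by (auto simp: abs_if sgn_if)
    then show ?thesis by (simp only: int_scale.scale_scale)
  qed
  also have "\<dots> \<in> H" by (rule int_scale_mem[OF H m(2)])
  finally have "int_scale (int (m * nat \<bar>k\<bar>)) x \<in> H" .
  moreover have "m * nat \<bar>k\<bar> \<ge> 1" using m(1) assms(2) by simp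
  ultimately show ?thesis using assms(1) unfolding torc_iff by metis
qed

lemma (in subgroup_pair) torsion_quotient_torc: "torsion_group (quotient_group A H) \<longleftrightarrow> torc H A = A"
proof
  assume "torc H A = A"
  then have "x \<in> torc H A" if "x \<in> A" for x using that by simp
  then show "torsion_group (quotient_group A H)" unfolding torsion_quotient_iff torc_iff by simp
qed (auto simp: torsion_quotient_iff torc_iff)

text \<open>The kernels of the coordinates on A modulo the torsion closure are cocyclic overgroups,
  and they already intersect in the closure. Conversely every functional that vanishes on H vanishes
  on the closure, as the integers have no torsion.\<close>

lemma (in subgroup_pair) Inter_cocyclic_overgroups:
  assumes E: "A = generate additive_group E" "finite E" and nt: "\<not> torsion_group (quotient_group A H)"
  shows "cocyclic_overgroups H A \<noteq> {}" "\<Inter> (cocyclic_overgroups H A) = torc H A"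
proof -
  let ?T = "torc H A"
  have TA: "?T \<subseteq> A" by (auto simp: torc_iff)
  obtain I e where b: "basis_mod ?T A I e"
  proof -
    have "\<exists>I e. basis_mod ?T A I e" by (rule basis_mod_exists[OF E subgroup_torc torc_torsion_free])
    then show thesis using that by (elim exE)
  qed
  obtain c :: "'g \<Rightarrow> nat \<Rightarrow> int" where c:
    "\<And>x y i. x \<in> A \<Longrightarrow> y \<in> A \<Longrightarrow> i \<in> I \<Longrightarrow> c (x + y) i = c x i + c y i"
    "\<And>x. x \<in> A \<Longrightarrow> (\<forall>i\<in>I. c x i = 0) \<longleftrightarrow> x \<in> ?T"
    "\<And>i j. i \<in> I \<Longrightarrow> j \<in> I \<Longrightarrow> c (e i) j = (if j = i then 1 else 0)"
    by (rule basis_mod_coordinates[OF A subgroup_torc TA b]) (rule that)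
  have coc: "{x \<in> A. c x i = 0} \<in> cocyclic_overgroups H A" if i: "i \<in> I" for i
  proof (rule functional_cocyclic_overgroups[OF A, where \<phi> = "\<lambda>x. c x i"])
    show "c (x + y) i = c x i + c y i" if "x \<in> A" "y \<in> A" for x y using that i by (rule c(1))
    have "e i \<in> A" using b i by (simp add: basis_mod_def generates_mod_def)
    then show "\<exists>x\<in>A. c x i = 1" using c(3)[OF i i] by auto
    show "x \<in> A \<and> c x i = 0" if "x \<in> H" for x
      using c(2)[of x] that HA torc_superset i by auto
  qed
  obtain x0 where x0: "x0 \<in> A" "x0 \<notin> ?T" using nt TA unfolding torsion_quotient_torc by auto
  then obtain i0 where "i0 \<in> I" using c(2) by auto
  then show ne: "cocyclic_overgroups H A \<noteq> {}" using coc by auto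
  show "\<Inter> (cocyclic_overgroups H A) = ?T"
  proof
    show "\<Inter> (cocyclic_overgroups H A) \<subseteq> ?T"
    proof
      fix x assume x: "x \<in> \<Inter> (cocyclic_overgroups H A)"
      have "x \<in> A" using x coc[OF \<open>i0 \<in> I\<close>] by auto
      moreover have "\<forall>i\<in>I. c x i = 0"
      proof
        fix i assume "i \<in> I"
        from InterD[OF x coc[OF this]] show "c x i = 0" by simp
      qed
      ultimately show "x \<in> ?T" using c(2) by auto
    qed
    show "?T \<subseteq> \<Inter> (cocyclic_overgroups H A)"
    proof (intro subsetI InterI)
      fix x H' assume x: "x \<in> ?T" and H': "H' \<in> cocyclic_overgroups H A"
      obtain \<phi> :: "'g \<Rightarrow> int" where \<phi>: "\<And>x y. x \<in> A \<Longrightarrow> y \<in> A \<Longrightarrow> \<phi> (x + y) = \<phi> x + \<phi> y"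
        "\<And>x. x \<in> A \<Longrightarrow> \<phi> x = 0 \<longleftrightarrow> x \<in> H'"
        by (rule cocyclic_overgroups_functional[OF A H']) (rule that)
      obtain m :: nat where m: "x \<in> A" "m \<ge> 1" "int_scale (int m) x \<in> H" using x by (auto simp: torc_iff)
      have "int_scale (int m) x \<in> H'" using m(3) H' by (auto simp: cocyclic_overgroups_def)
      then have "int m * \<phi> x = 0"
        using \<phi>(2)[OF int_scale_mem[OF A m(1)], of "int m"] additive_int_scale[OF A \<phi>(1) m(1), of "int m"] by metis
      then show "x \<in> H'" using \<phi>(2)[OF m(1)] m(2) by simp
    qed
  qed
qed

section \<open>The rank of a quotient\<close>

text \<open>The rank is the dimension of a tensor product made of cosets. Two facts determine it:
  the tensors 1 \<otimes> a span, and additive maps on A extend to linear functionals.\<close>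

locale rat_tensor_space = comm_group A for A (structure)
begin

definition FA :: "((rat \<times> 'a) \<Rightarrow>\<^sub>0 int) monoid"
  where "FA = free_Abelian_group (UNIV \<times> carrier A)"

definition NA :: "((rat \<times> 'a) \<Rightarrow>\<^sub>0 int) set"
  where "NA = generate FA (tensor_relations A)"

definition tens :: "rat \<Rightarrow> 'a \<Rightarrow> ((rat \<times> 'a) \<Rightarrow>\<^sub>0 int) set"
  where "tens q a = NA #>\<^bsub>FA\<^esub> frag_of (q, a)"

definition scale_frag :: "rat \<Rightarrow> ((rat \<times> 'a) \<Rightarrow>\<^sub>0 int) \<Rightarrow> ((rat \<times> 'a) \<Rightarrow>\<^sub>0 int)"
  where "scale_frag q = frag_extend (\<lambda>(p, a). frag_of (q * p, a))"

abbreviation "V \<equiv> rat_tensor A"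

sublocale FA: comm_group FA
  unfolding FA_def by (rule abelian_free_Abelian_group)

lemma FA_simps: "x \<otimes>\<^bsub>FA\<^esub> y = x + y" "\<one>\<^bsub>FA\<^esub> = 0"
  "x \<in> carrier FA \<longleftrightarrow> Poly_Mapping.keys x \<subseteq> UNIV \<times> carrier A"
  by (simp_all add: FA_def)

lemma inv_FA: "x \<in> carrier FA \<Longrightarrow> inv\<^bsub>FA\<^esub> x = - x"
  by (simp add: FA_def)

lemma FA_closed: "x \<in> carrier FA \<Longrightarrow> y \<in> carrier FA \<Longrightarrow> x + y \<in> carrier FA"
    "x \<in> carrier FA \<Longrightarrow> y \<in> carrier FA \<Longrightarrow> x - y \<in> carrier FA"
    "a \<in> carrier A \<Longrightarrow> frag_of (q, a) \<in> carrier FA"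
proof -
  show "x \<in> carrier FA \<Longrightarrow> y \<in> carrier FA \<Longrightarrow> x + y \<in> carrier FA"
    using FA.m_closed[of x y] by (simp add: FA_simps(1))
  show "x \<in> carrier FA \<Longrightarrow> y \<in> carrier FA \<Longrightarrow> x - y \<in> carrier FA"
    using keys_diff[of x y] by (auto simp: FA_simps)
qed (simp add: FA_simps)

lemma relations_closed: "tensor_relations A \<subseteq> carrier FA"
  unfolding tensor_relations_def by (auto intro!: FA_closed)

lemma subgroup_NA: "subgroup NA FA"
  unfolding NA_def by (rule FA.generate_is_subgroup[OF relations_closed])

lemma normal_NA: "NA \<lhd> FA"
  by (rule FA.subgroup_imp_normal[OF subgroup_NA])

lemma coset_eqI:
  assumes "x - y \<in> NA" "x \<in> carrier FA" "y \<in> carrier FA"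
  shows "NA #>\<^bsub>FA\<^esub> x = NA #>\<^bsub>FA\<^esub> y"
proof -
  have "x \<in> NA #>\<^bsub>FA\<^esub> y"
    unfolding r_coset_def using assms by (auto simp: FA_simps intro!: bexI[of _ "x - y"])
  then show ?thesis using FA.repr_independence[OF _ assms(3) subgroup_NA] by metis
qed

lemma scale_frag_simps:
  "scale_frag q (x + y) = scale_frag q x + scale_frag q y"
  "scale_frag q (x - y) = scale_frag q x - scale_frag q y"
  "scale_frag q (- x) = - scale_frag q x" "scale_frag q 0 = 0"
  "scale_frag q (frag_of (p, a)) = frag_of (q * p, a)"
  by (simp_all add: scale_frag_def frag_extend_add frag_extend_diff frag_extend_minus)

lemma scale_frag_relations: "x \<in> tensor_relations A \<Longrightarrow> scale_frag q x \<in> tensor_relations A"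
proof -
  assume "x \<in> tensor_relations A"
  then consider p r a where "x = frag_of (p + r, a) - frag_of (p, a) - frag_of (r, a)" "a \<in> carrier A"
    | p a b where "x = frag_of (p, a \<otimes> b) - frag_of (p, a) - frag_of (p, b)" "a \<in> carrier A" "b \<in> carrier A"
    unfolding tensor_relations_def by auto
  then show ?thesis
  proof cases
    case 1
    then have "scale_frag q x = frag_of (q * p + q * r, a) - frag_of (q * p, a) - frag_of (q * r, a)"
      by (simp add: scale_frag_simps distrib_left)
    with 1(2) show ?thesis unfolding tensor_relations_def by auto
  next
    case 2
    then have "scale_frag q x = frag_of (q * p, a \<otimes> b) - frag_of (q * p, a) - frag_of (q * p, b)"
      by (simp add: scale_frag_simps)
    with 2(2,3) show ?thesis unfolding tensor_relations_def by auto
  qed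
qed

lemma NA_induct [consumes 1, case_names zero relation minus add]:
  assumes "x \<in> NA" "Q 0" "\<And>x. x \<in> tensor_relations A \<Longrightarrow> Q x"
    "\<And>x. x \<in> tensor_relations A \<Longrightarrow> Q x \<Longrightarrow> Q (- x)" "\<And>x y. x \<in> NA \<Longrightarrow> y \<in> NA \<Longrightarrow> Q x \<Longrightarrow> Q y \<Longrightarrow> Q (x + y)"
  shows "Q x"
  using assms(1) unfolding NA_def
proof (induction rule: generate.induct)
  case one
  show ?case unfolding FA_simps(2) by (rule assms(2))
next
  case (incl h)
  then show ?case by (rule assms(3))
next
  case (inv h)
  then have "inv\<^bsub>FA\<^esub> h = - h" using relations_closed by (intro inv_FA) auto
  then show ?case using assms(4)[OF inv assms(3)[OF inv]] by simp
next
  case (eng h1 h2)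
  then show ?case unfolding FA_simps(1) NA_def[symmetric] by (intro assms(5))
qed

lemma scale_frag_NA: "x \<in> NA \<Longrightarrow> scale_frag q x \<in> NA"
proof (induction rule: NA_induct)
  case zero
  show ?case using subgroup.one_closed[OF subgroup_NA] by (simp add: FA_simps scale_frag_simps)
next
  case (relation x)
  then show ?case unfolding NA_def by (intro generate.incl scale_frag_relations)
next
  case (minus x)
  have "scale_frag q x \<in> carrier FA" using minus(2) subgroup.subset[OF subgroup_NA] by auto
  then show ?case using subgroup.m_inv_closed[OF subgroup_NA minus(2)] by (simp add: scale_frag_simps inv_FA)
next
  case (add x y)
  show ?case using subgroup.m_closed[OF subgroup_NA add(3,4)] by (simp add: FA_simps(1) scale_frag_simps)
qed

lemma V_simps: "carrier V = carrier (FA Mod NA)" "\<zero>\<^bsub>V\<^esub> = NA" "x \<oplus>\<^bsub>V\<^esub> y = x <#>\<^bsub>FA\<^esub> y"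
    "q \<odot>\<^bsub>V\<^esub> x = (\<Union>z\<in>x. NA #>\<^bsub>FA\<^esub> scale_frag q z)"
  unfolding rat_tensor_def Let_def FA_def[symmetric] NA_def[symmetric] scale_frag_def
  by (simp_all add: FactGroup_def)

lemma carrier_V: "c \<in> carrier V \<longleftrightarrow> (\<exists>x\<in>carrier FA. c = NA #>\<^bsub>FA\<^esub> x)"
  by (auto simp: V_simps FactGroup_def RCOSETS_def)

lemma add_V: "x \<in> carrier FA \<Longrightarrow> y \<in> carrier FA \<Longrightarrow>
  (NA #>\<^bsub>FA\<^esub> x) \<oplus>\<^bsub>V\<^esub> (NA #>\<^bsub>FA\<^esub> y) = NA #>\<^bsub>FA\<^esub> (x + y)"
  unfolding V_simps(3) using normal.rcos_sum[OF normal_NA, of x y] by (simp add: FA_simps(1))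

lemma scale_frag_closed:
  assumes "x \<in> carrier FA" shows "scale_frag q x \<in> carrier FA"
  using assms[unfolded FA_simps(3)]
proof (induction rule: frag_induction)
  case zero
  show ?case using FA.one_closed by (simp add: FA_simps scale_frag_simps)
next
  case (one x)
  then show ?case by (cases x) (auto simp: scale_frag_simps FA_closed)
next
  case (diff a b)
  then show ?case by (simp add: scale_frag_simps FA_closed)
qed

lemma smult_V:
  assumes x: "x \<in> carrier FA"
  shows "q \<odot>\<^bsub>V\<^esub> (NA #>\<^bsub>FA\<^esub> x) = NA #>\<^bsub>FA\<^esub> scale_frag q x"
proof -
  have "NA #>\<^bsub>FA\<^esub> scale_frag q z = NA #>\<^bsub>FA\<^esub> scale_frag q x" if z: "z \<in> NA #>\<^bsub>FA\<^esub> x" for z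
  proof -
    obtain n where n: "n \<in> NA" "z = n + x" using z by (auto simp: r_coset_def FA_simps)
    have "z \<in> carrier FA"
      unfolding n(2) by (rule FA_closed(1)[OF subsetD[OF subgroup.subset[OF subgroup_NA] n(1)] x])
    with n x show ?thesis
      by (intro coset_eqI scale_frag_closed) (simp_all add: scale_frag_simps scale_frag_NA)
  qed
  moreover have "x \<in> NA #>\<^bsub>FA\<^esub> x" by (rule FA.rcos_self[OF x subgroup_NA])
  ultimately show ?thesis unfolding V_simps(4) by blast
qed

sublocale V: vectorspace "ring_of_type_algebra :: rat ring" V
  by (rule vectorspace_rat_tensor) (rule comm_group_axioms)

lemma tens_closed: "a \<in> carrier A \<Longrightarrow> tens q a \<in> carrier V"
  unfolding carrier_V tens_def using FA_closed(3) by auto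

lemma smult_tens: "a \<in> carrier A \<Longrightarrow> p \<odot>\<^bsub>V\<^esub> tens q a = tens (p * q) a"
  unfolding tens_def using smult_V[OF FA_closed(3)] by (simp add: scale_frag_simps)

lemma tens_mult: "a \<in> carrier A \<Longrightarrow> b \<in> carrier A \<Longrightarrow> tens q (a \<otimes> b) = tens q a \<oplus>\<^bsub>V\<^esub> tens q b"
proof -
  assume ab: "a \<in> carrier A" "b \<in> carrier A"
  have "frag_of (q, a \<otimes> b) - (frag_of (q, a) + frag_of (q, b)) \<in> tensor_relations A"
    unfolding diff_diff_eq[symmetric] tensor_relations_def using ab by auto
  then have "frag_of (q, a \<otimes> b) - (frag_of (q, a) + frag_of (q, b)) \<in> NA"
    unfolding NA_def by (rule generate.incl)
  then have "tens q (a \<otimes> b) = NA #>\<^bsub>FA\<^esub> (frag_of (q, a) + frag_of (q, b))"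
    unfolding tens_def using ab by (intro coset_eqI FA_closed) auto
  then show ?thesis unfolding tens_def using ab by (simp add: add_V FA_closed)
qed

text \<open>The tensor q \<otimes> a is q times 1 \<otimes> a, and such tensors generate the
  additive group.\<close>

lemma tens_span:
  assumes "submodule ring_of_type_algebra S V" "\<And>a. a \<in> carrier A \<Longrightarrow> tens 1 a \<in> S"
  shows "S = carrier V"
proof
  interpret S: submodule ring_of_type_algebra S V by fact
  show "S \<subseteq> carrier V" by (rule S.subset)
  have "NA #>\<^bsub>FA\<^esub> x \<in> S" if "x \<in> carrier FA" for x
  proof -
    have "x \<in> carrier FA \<and> NA #>\<^bsub>FA\<^esub> x \<in> S" using that[unfolded FA_simps(3)]
    proof (induction rule: frag_induction)
      case zero
      have "NA #>\<^bsub>FA\<^esub> 0 = NA" using FA.coset_join2[OF FA.one_closed subgroup_NA subgroup.one_closed[OF subgroup_NA]]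
        by (simp add: FA_simps)
      then show ?case using S.zero_closed FA.one_closed by (simp add: V_simps FA_simps)
    next
      case (one x)
      then obtain q a where x: "x = (q, a)" "a \<in> carrier A" by auto
      have "q \<odot>\<^bsub>V\<^esub> tens 1 a \<in> S" using S.smult_closed assms(2)[OF x(2)] by simp
      then show ?case unfolding smult_tens[OF x(2)] using x by (simp add: tens_def FA_closed)
    next
      case (diff x y)
      have xy: "x \<in> carrier FA" "y \<in> carrier FA" using diff by auto
      have my: "scale_frag (- 1) y \<in> carrier FA" by (rule scale_frag_closed[OF xy(2)])
      have "(NA #>\<^bsub>FA\<^esub> (x - y)) \<oplus>\<^bsub>V\<^esub> (NA #>\<^bsub>FA\<^esub> y) = NA #>\<^bsub>FA\<^esub> x"
        using xy by (simp add: add_V FA_closed)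
      moreover have c: "NA #>\<^bsub>FA\<^esub> (x - y) \<in> carrier V" "NA #>\<^bsub>FA\<^esub> y \<in> carrier V"
        using xy FA_closed by (auto simp: carrier_V)
      ultimately have "NA #>\<^bsub>FA\<^esub> (x - y) = (NA #>\<^bsub>FA\<^esub> x) \<ominus>\<^bsub>V\<^esub> (NA #>\<^bsub>FA\<^esub> y)"
        using V.M.add.inv_solve_right[of "NA #>\<^bsub>FA\<^esub> (x - y)" "NA #>\<^bsub>FA\<^esub> x" "NA #>\<^bsub>FA\<^esub> y"] xy
        by (simp add: a_minus_def a_inv_def carrier_V) metis
      moreover have "(NA #>\<^bsub>FA\<^esub> x) \<ominus>\<^bsub>V\<^esub> (NA #>\<^bsub>FA\<^esub> y) \<in> S"
      proof -
        have "\<ominus>\<^bsub>V\<^esub> (NA #>\<^bsub>FA\<^esub> y) = (- 1) \<odot>\<^bsub>V\<^esub> (NA #>\<^bsub>FA\<^esub> y)"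
          using V.smult_l_minus[OF _ c(2), of 1] V.smult_one[OF c(2)] by simp
        then show ?thesis
          unfolding a_minus_def using diff S.smult_closed[of "- 1"] S.m_closed by simp
      qed
      ultimately show ?case using xy by (simp add: FA_closed)
    qed
    then show ?thesis ..
  qed
  then show "carrier V \<subseteq> S" by (auto simp: carrier_V)
qed

section \<open>Linear functionals on the tensor product\<close>

definition frag_functional :: "('a \<Rightarrow> rat) \<Rightarrow> ((rat \<times> 'a) \<Rightarrow>\<^sub>0 int) \<Rightarrow> rat"
  where "frag_functional g x = (\<Sum>k\<in>Poly_Mapping.keys x. of_int (Poly_Mapping.lookup x k) * (fst k * g (snd k)))"

lemma frag_functional_superset:
  assumes "finite K" "Poly_Mapping.keys x \<subseteq> K"
  shows "frag_functional g x = (\<Sum>k\<in>K. of_int (Poly_Mapping.lookup x k) * (fst k * g (snd k)))"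
  unfolding frag_functional_def using assms by (intro sum.mono_neutral_left) (auto simp: in_keys_iff)

lemma frag_functional_diff: "frag_functional g (x - y) = frag_functional g x - frag_functional g y"
proof -
  let ?K = "Poly_Mapping.keys x \<union> Poly_Mapping.keys y"
  have fin: "finite ?K" by simp
  have sub: "Poly_Mapping.keys x \<subseteq> ?K" "Poly_Mapping.keys y \<subseteq> ?K" by auto
  show ?thesis
    unfolding frag_functional_superset[OF fin sub(1)] frag_functional_superset[OF fin sub(2)]
      frag_functional_superset[OF fin keys_diff]
    by (simp add: lookup_minus left_diff_distrib sum_subtractf)
qed

lemma frag_functional_0: "frag_functional g 0 = 0"
  by (simp add: frag_functional_def)

lemma frag_functional_minus: "frag_functional g (- x) = - frag_functional g x"
  using frag_functional_diff[of g 0 x] by (simp add: frag_functional_0)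

lemma frag_functional_add: "frag_functional g (x + y) = frag_functional g x + frag_functional g y"
  using frag_functional_diff[of g x "- y"] by (simp add: frag_functional_minus)

lemma frag_functional_of: "frag_functional g (frag_of (q, a)) = q * g a"
  by (simp add: frag_functional_def)

text \<open>The universal property for maps to the rationals: the additive map sending (q, a) to q *
  g a vanishes on the relations, hence descends to cosets.\<close>

lemma functional_exists:
  assumes g: "\<And>a b. a \<in> carrier A \<Longrightarrow> b \<in> carrier A \<Longrightarrow> g (a \<otimes> b) = g a + g b"
  obtains f :: "((rat \<times> 'a) \<Rightarrow>\<^sub>0 int) set \<Rightarrow> rat" where
    "\<And>c d. c \<in> carrier V \<Longrightarrow> d \<in> carrier V \<Longrightarrow> f (c \<oplus>\<^bsub>V\<^esub> d) = f c + f d"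
    "\<And>q c. c \<in> carrier V \<Longrightarrow> f (q \<odot>\<^bsub>V\<^esub> c) = q * f c"
    "\<And>q a. a \<in> carrier A \<Longrightarrow> f (tens q a) = q * g a"
proof -
  have N0: "frag_functional g x = 0" if "x \<in> NA" for x
    using that
  proof (induction rule: NA_induct)
    case (relation x)
    then show ?case unfolding tensor_relations_def
      by (elim UnE CollectE exE conjE) (simp_all add: frag_functional_diff frag_functional_of g distrib_left distrib_right)
  qed (simp_all add: frag_functional_0 frag_functional_minus frag_functional_add)
  define \<Lambda> where "\<Lambda> c = frag_functional g (SOME x. x \<in> carrier FA \<and> c = NA #>\<^bsub>FA\<^esub> x)" for c
  have \<Lambda>: "\<Lambda> (NA #>\<^bsub>FA\<^esub> x) = frag_functional g x" if x: "x \<in> carrier FA" for x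
  proof -
    define y where "y = (SOME y. y \<in> carrier FA \<and> NA #>\<^bsub>FA\<^esub> x = NA #>\<^bsub>FA\<^esub> y)"
    have y: "y \<in> carrier FA \<and> NA #>\<^bsub>FA\<^esub> x = NA #>\<^bsub>FA\<^esub> y"
      unfolding y_def by (rule someI[of _ x]) (simp add: x)
    have "x \<in> NA #>\<^bsub>FA\<^esub> x" by (rule FA.rcos_self[OF x subgroup_NA])
    then have "x \<in> NA #>\<^bsub>FA\<^esub> y" using y by simp
    then obtain n where "n \<in> NA" "x = n + y" by (auto simp: r_coset_def FA_simps)
    then have "frag_functional g x = frag_functional g y" by (simp add: frag_functional_add N0)
    then show ?thesis by (simp add: \<Lambda>_def y_def)
  qed
  have scale: "frag_functional g (scale_frag q x) = q * frag_functional g x" if "x \<in> carrier FA" for q x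
    using that[unfolded FA_simps(3)]
  proof (induction rule: frag_induction)
    case (one x)
    then show ?case by (cases x) (simp add: scale_frag_simps frag_functional_of)
  qed (simp_all add: scale_frag_simps frag_functional_0 frag_functional_diff right_diff_distrib)
  show thesis
  proof (rule that[of \<Lambda>])
    show "\<Lambda> (c \<oplus>\<^bsub>V\<^esub> d) = \<Lambda> c + \<Lambda> d" if "c \<in> carrier V" "d \<in> carrier V" for c d
      using that by (auto simp: carrier_V add_V \<Lambda> FA_closed frag_functional_add)
    show "\<Lambda> (q \<odot>\<^bsub>V\<^esub> c) = q * \<Lambda> c" if "c \<in> carrier V" for q c
      using that by (auto simp: carrier_V smult_V \<Lambda> scale_frag_closed scale)
    show "\<Lambda> (tens q a) = q * g a" if "a \<in> carrier A" for q a
      unfolding tens_def using that by (simp add: \<Lambda> FA_closed frag_functional_of)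
  qed
qed

end

text \<open>The tensors 1 \<otimes> e i form a basis. They span because torsion dies over the
  rationals, and they are independent because the coordinate functionals are dual to them.\<close>

lemma (in subgroup_pair) group_rank_quotient:
  assumes b: "basis_mod (torc H A) A I e"
  shows "group_rank (quotient_group A H) = enat (card I)"
proof -
  let ?Q = "quotient_group A H"
  interpret Q: rat_tensor_space ?Q by (rule rat_tensor_space.intro[OF comm_group_quotient])
  let ?V = "rat_tensor ?Q" and ?R = "ring_of_type_algebra :: rat ring"
  have finI: "finite I" and eA: "\<And>i. i \<in> I \<Longrightarrow> e i \<in> A" using b by (simp_all add: basis_mod_def generates_mod_def)
  have TA: "torc H A \<subseteq> A" by (auto simp: torc_iff)
  obtain c :: "'g \<Rightarrow> nat \<Rightarrow> int" where c:
    "\<And>x. x \<in> A \<Longrightarrow> x - int_comb I (c x) e \<in> torc H A"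
    "\<And>x y i. x \<in> A \<Longrightarrow> y \<in> A \<Longrightarrow> i \<in> I \<Longrightarrow> c (x + y) i = c x i + c y i"
    "\<And>x. x \<in> A \<Longrightarrow> (\<forall>i\<in>I. c x i = 0) \<longleftrightarrow> x \<in> torc H A"
    "\<And>i j. i \<in> I \<Longrightarrow> j \<in> I \<Longrightarrow> c (e i) j = (if j = i then 1 else 0)"
    by (rule basis_mod_coordinates[OF A subgroup_torc TA b]) (rule that)
  define \<theta> where "\<theta> x = Q.tens 1 (H #>\<^bsub>GA\<^esub> x)" for x
  have cl: "H #>\<^bsub>GA\<^esub> x \<in> carrier ?Q" if "x \<in> A" for x unfolding carrier_quotient using that by (rule imageI)
  have \<theta>V: "\<theta> x \<in> carrier ?V" if "x \<in> A" for x unfolding \<theta>_def by (rule Q.tens_closed[OF cl[OF that]])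
  have \<theta>_add: "\<theta> (x + y) = \<theta> x \<oplus>\<^bsub>?V\<^esub> \<theta> y" if "x \<in> A" "y \<in> A" for x y
    unfolding \<theta>_def mult_quotient[OF that, symmetric] by (rule Q.tens_mult[OF cl[OF that(1)] cl[OF that(2)]])
  have \<theta>_0: "\<theta> 0 = \<zero>\<^bsub>?V\<^esub>"
    using \<theta>_add[OF AD(1) AD(1)] \<theta>V[OF AD(1)] by (simp add: Q.V.M.add.l_cancel_one)
  have \<theta>_H: "\<theta> x = \<zero>\<^bsub>?V\<^esub>" if "x \<in> H" for x
  proof -
    have "H #>\<^bsub>GA\<^esub> x = H #>\<^bsub>GA\<^esub> 0"
      using r_coset_eq_iff[of x] r_coset_eq_iff[of 0] that HA HD(1) by auto
    then have "\<theta> x = \<theta> 0" by (simp only: \<theta>_def)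
    then show ?thesis using \<theta>_0 by simp
  qed
  have smR: "of_int k \<odot>\<^bsub>?V\<^esub> \<theta> x = \<theta> (int_scale k x)" if x: "x \<in> A" for k x
  proof (induction k rule: int_induct[where k = 0])
    case base
    then show ?case using Q.V.smult_l_null[OF \<theta>V[OF x]] \<theta>_0 by simp
  next
    case (step1 k)
    have "of_int (k + 1) \<odot>\<^bsub>?V\<^esub> \<theta> x = of_int k \<odot>\<^bsub>?V\<^esub> \<theta> x \<oplus>\<^bsub>?V\<^esub> 1 \<odot>\<^bsub>?V\<^esub> \<theta> x"
      using Q.V.smult_l_distr[of "of_int k" 1 "\<theta> x"] \<theta>V[OF x] by simp
    also have "\<dots> = \<theta> (int_scale k x) \<oplus>\<^bsub>?V\<^esub> \<theta> x" using step1 Q.V.smult_one[OF \<theta>V[OF x]] by simp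
    also have "\<dots> = \<theta> (int_scale (k + 1) x)"
      using \<theta>_add[OF int_scale_mem[OF A x] x] by (simp add: int_scale.scale_left_distrib)
    finally show ?case .
  next
    case (step2 k)
    have "of_int k \<odot>\<^bsub>?V\<^esub> \<theta> x = of_int (k - 1) \<odot>\<^bsub>?V\<^esub> \<theta> x \<oplus>\<^bsub>?V\<^esub> 1 \<odot>\<^bsub>?V\<^esub> \<theta> x"
      using Q.V.smult_l_distr[of "of_int (k - 1)" 1 "\<theta> x"] \<theta>V[OF x] by simp
    then have 1: "\<theta> (int_scale k x) = of_int (k - 1) \<odot>\<^bsub>?V\<^esub> \<theta> x \<oplus>\<^bsub>?V\<^esub> \<theta> x"
      using step2 Q.V.smult_one[OF \<theta>V[OF x]] by simp
    have "\<theta> (int_scale (k - 1) x + x) = \<theta> (int_scale (k - 1) x) \<oplus>\<^bsub>?V\<^esub> \<theta> x"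
      by (rule \<theta>_add[OF int_scale_mem[OF A x] x])
    then have 2: "\<theta> (int_scale k x) = \<theta> (int_scale (k - 1) x) \<oplus>\<^bsub>?V\<^esub> \<theta> x"
      by (simp add: int_scale.scale_left_diff_distrib)
    have c1: "of_int (k - 1) \<odot>\<^bsub>?V\<^esub> \<theta> x \<in> carrier ?V" using Q.V.smult_closed[OF _ \<theta>V[OF x]] by simp
    have c2: "\<theta> (int_scale (k - 1) x) \<in> carrier ?V" by (rule \<theta>V[OF int_scale_mem[OF A x]])
    show ?case by (rule Q.V.M.add.r_cancel[OF trans[OF 1[symmetric] 2] c1 c2 \<theta>V[OF x]])
  qed
  define B where "B = \<theta> ` e ` I"
  have finB: "finite B" unfolding B_def using finI by simp
  have BV: "B \<subseteq> carrier ?V" unfolding B_def using \<theta>V eA by auto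
  have sub: "submodule ?R (Q.V.span B) ?V" by (rule Q.V.span_is_submodule[OF BV])
  interpret S: submodule ?R "Q.V.span B" ?V by (rule sub)
  have comb_span: "\<theta> (int_comb J n e) \<in> Q.V.span B" if "J \<subseteq> I" for J n
    using finite_subset[OF that finI] that
  proof (induction J)
    case empty
    then show ?case using \<theta>_0 S.zero_closed by (simp add: int_comb_def)
  next
    case (insert j J)
    have jI: "j \<in> I" using insert by auto
    have "int_comb (insert j J) n e = int_scale (n j) (e j) + int_comb J n e"
      using insert by (simp add: int_comb_def)
    moreover have eJ: "int_comb J n e \<in> A" using eA insert.prems by (intro int_comb_mem[OF A]) auto
    ultimately have "\<theta> (int_comb (insert j J) n e) = of_int (n j) \<odot>\<^bsub>?V\<^esub> \<theta> (e j) \<oplus>\<^bsub>?V\<^esub> \<theta> (int_comb J n e)"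
      by (simp only: \<theta>_add[OF int_scale_mem[OF A eA[OF jI]] eJ] smR[OF eA[OF jI]])
    moreover have "\<theta> (e j) \<in> Q.V.span B" using jI by (intro Q.V.span_mem BV) (auto simp: B_def)
    ultimately show ?case using insert S.m_closed S.smult_closed by simp
  qed
  have \<theta>_span: "\<theta> x \<in> Q.V.span B" if x: "x \<in> A" for x
  proof -
    define y where "y = x - int_comb I (c x) e"
    have y: "y \<in> torc H A" unfolding y_def by (rule c(1)[OF x])
    then obtain m :: nat where m: "y \<in> A" "m \<ge> 1" "int_scale (int m) y \<in> H" by (auto simp: torc_iff)
    \<comment> \<open>A multiple of y lies in H, so m kills the tensor of y; and m is invertible in
      the rationals.\<close>
    have "of_int (int m) \<odot>\<^bsub>?V\<^esub> \<theta> y = \<zero>\<^bsub>?V\<^esub>" unfolding smR[OF m(1)] by (rule \<theta>_H[OF m(3)])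
    then have "(1 / of_nat m) \<odot>\<^bsub>?V\<^esub> (of_nat m \<odot>\<^bsub>?V\<^esub> \<theta> y) = \<zero>\<^bsub>?V\<^esub>" by (simp add: Q.V.smult_r_null)
    then have "((1 / of_nat m) * of_nat m) \<odot>\<^bsub>?V\<^esub> \<theta> y = \<zero>\<^bsub>?V\<^esub>"
      using Q.V.smult_assoc1[of "1 / of_nat m" "of_nat m" "\<theta> y"] \<theta>V[OF m(1)] by simp
    then have "\<theta> y = \<zero>\<^bsub>?V\<^esub>" using m(2) Q.V.smult_one[OF \<theta>V[OF m(1)]] by simp
    moreover have iA: "int_comb I (c x) e \<in> A" by (rule int_comb_mem[OF A eA])
    have "\<theta> (y + int_comb I (c x) e) = \<theta> y \<oplus>\<^bsub>?V\<^esub> \<theta> (int_comb I (c x) e)" by (rule \<theta>_add[OF m(1) iA])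
    ultimately have "\<theta> x = \<theta> (int_comb I (c x) e)" using \<theta>V[OF iA] by (simp add: y_def)
    then show ?thesis using comb_span[of I] by simp
  qed
  have span: "Q.V.span B = carrier ?V"
  proof (rule Q.tens_span[OF sub])
    fix a assume "a \<in> carrier ?Q"
    then obtain x where "x \<in> A" "a = H #>\<^bsub>GA\<^esub> x" unfolding carrier_quotient by (elim imageE)
    then show "Q.tens 1 a \<in> Q.V.span B" using \<theta>_span[of x] by (simp only: \<theta>_def)
  qed
  have coset_c: "c x i = c y i" if "x \<in> A" "y \<in> A" "i \<in> I" "H #>\<^bsub>GA\<^esub> x = H #>\<^bsub>GA\<^esub> y" for x y i
  proof -
    have "0 + x \<in> H #>\<^bsub>GA\<^esub> x" unfolding r_coset_GA using HD(1) by (rule imageI)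
    then have "x \<in> H #>\<^bsub>GA\<^esub> y" using that(4) by simp
    then obtain h where h: "h \<in> H" "x = h + y" unfolding r_coset_GA by (elim imageE)
    have hA: "h \<in> A" using h(1) HA by auto
    have "h \<in> torc H A" using h(1) torc_superset by auto
    then have "c h i = 0" using c(3)[OF hA] that(3) by auto
    then show ?thesis unfolding h(2) using c(2)[OF hA that(2,3)] by simp
  qed
  \<comment> \<open>A coordinate read off from a chosen representative of the coset; by
    \<open>coset_c\<close> every representative gives the same value.\<close>
  define g where "g i a = (of_int (c (SOME x. x \<in> A \<and> a = H #>\<^bsub>GA\<^esub> x) i) :: rat)" for i a
  have g: "g i (H #>\<^bsub>GA\<^esub> x) = of_int (c x i)" if x: "x \<in> A" and i: "i \<in> I" for x i
  proof -
    define y where "y = (SOME y. y \<in> A \<and> H #>\<^bsub>GA\<^esub> x = H #>\<^bsub>GA\<^esub> y)"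
    have "y \<in> A \<and> H #>\<^bsub>GA\<^esub> x = H #>\<^bsub>GA\<^esub> y" unfolding y_def by (rule someI[of _ x]) (simp add: x)
    then have "c x i = c y i" by (intro coset_c[OF x _ i]) auto
    then show ?thesis by (simp only: g_def y_def)
  qed
  have "\<exists>f. \<forall>i\<in>I. (\<forall>u\<in>carrier ?V. \<forall>v\<in>carrier ?V. f i (u \<oplus>\<^bsub>?V\<^esub> v) = f i u + (f i v :: rat)) \<and>
      (\<forall>q. \<forall>v\<in>carrier ?V. f i (q \<odot>\<^bsub>?V\<^esub> v) = q * f i v) \<and> (\<forall>x\<in>A. f i (\<theta> x) = of_int (c x i))"
  proof (rule bchoice, rule ballI)
    fix i assume i: "i \<in> I"
    have gadd: "g i (a \<otimes>\<^bsub>?Q\<^esub> b) = g i a + g i b" if "a \<in> carrier ?Q" "b \<in> carrier ?Q" for a b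
    proof -
      obtain x where x: "x \<in> A" "a = H #>\<^bsub>GA\<^esub> x" using \<open>a \<in> carrier ?Q\<close> unfolding carrier_quotient by (elim imageE)
      obtain y where y: "y \<in> A" "b = H #>\<^bsub>GA\<^esub> y" using \<open>b \<in> carrier ?Q\<close> unfolding carrier_quotient by (elim imageE)
      show ?thesis
        unfolding x(2) y(2) mult_quotient[OF x(1) y(1)] g[OF x(1) i] g[OF y(1) i] g[OF AD(2)[OF x(1) y(1)] i]
        using c(2)[OF x(1) y(1) i] by simp
    qed
    obtain f where f: "\<And>u v. u \<in> carrier ?V \<Longrightarrow> v \<in> carrier ?V \<Longrightarrow> f (u \<oplus>\<^bsub>?V\<^esub> v) = f u + f v"
      "\<And>q v. v \<in> carrier ?V \<Longrightarrow> f (q \<odot>\<^bsub>?V\<^esub> v) = q * f v"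
      "\<And>q a. a \<in> carrier ?Q \<Longrightarrow> f (Q.tens q a) = q * g i a"
      by (rule Q.functional_exists[OF gadd]) (assumption | rule that)+
    have "f (\<theta> x) = of_int (c x i)" if "x \<in> A" for x
      unfolding \<theta>_def f(3)[OF cl[OF that]] g[OF that i] by simp
    then show "\<exists>f. (\<forall>u\<in>carrier ?V. \<forall>v\<in>carrier ?V. f (u \<oplus>\<^bsub>?V\<^esub> v) = f u + (f v :: rat)) \<and>
      (\<forall>q. \<forall>v\<in>carrier ?V. f (q \<odot>\<^bsub>?V\<^esub> v) = q * f v) \<and> (\<forall>x\<in>A. f (\<theta> x) = of_int (c x i))"
      using f(1,2) by (intro exI[of _ f]) simp
  qed
  then obtain f where ff: "\<forall>i\<in>I. (\<forall>u\<in>carrier ?V. \<forall>v\<in>carrier ?V. f i (u \<oplus>\<^bsub>?V\<^esub> v) = f i u + (f i v :: rat)) \<and>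
      (\<forall>q. \<forall>v\<in>carrier ?V. f i (q \<odot>\<^bsub>?V\<^esub> v) = q * f i v) \<and> (\<forall>x\<in>A. f i (\<theta> x) = of_int (c x i))" by (rule exE)
  have f: "i \<in> I \<Longrightarrow> u \<in> carrier ?V \<Longrightarrow> v \<in> carrier ?V \<Longrightarrow> f i (u \<oplus>\<^bsub>?V\<^esub> v) = f i u + f i v"
    "i \<in> I \<Longrightarrow> v \<in> carrier ?V \<Longrightarrow> f i (q \<odot>\<^bsub>?V\<^esub> v) = q * f i v"
    "i \<in> I \<Longrightarrow> x \<in> A \<Longrightarrow> f i (\<theta> x) = of_int (c x i)" for i u v q x
    using bspec[OF ff, of i] by simp_all
  have f0: "f i \<zero>\<^bsub>?V\<^esub> = 0" if "i \<in> I" for i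
    using f(1)[OF that Q.V.M.zero_closed Q.V.M.zero_closed] by simp
  have f_lincomb: "f i (Q.V.lincomb a C) = (\<Sum>v\<in>C. a v * f i v)" if "finite C" "C \<subseteq> carrier ?V" "i \<in> I" for i a C
    using that
  proof (induction C)
    case empty
    then show ?case using f0 by (simp add: Q.V.lincomb_def)
  next
    case (insert v C)
    have lc: "Q.V.lincomb a C \<in> carrier ?V" using insert by (intro Q.V.lincomb_closed) auto
    have "Q.V.lincomb a (insert v C) = a v \<odot>\<^bsub>?V\<^esub> v \<oplus>\<^bsub>?V\<^esub> Q.V.lincomb a C"
      unfolding Q.V.lincomb_def using insert by (intro Q.V.M.finsum_insert) (auto intro: Q.V.smult_closed)
    then show ?case using insert lc by (simp add: f Q.V.smult_closed)
  qed
  have fe: "f i (\<theta> (e j)) = (if i = j then 1 else 0)" if "i \<in> I" "j \<in> I" for i j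
    using f(3)[OF that(1) eA[OF that(2)]] c(4)[OF that(2,1)] by simp
  have inj: "inj_on (\<lambda>i. \<theta> (e i)) I"
  proof (rule inj_onI)
    fix i j assume ij: "i \<in> I" "j \<in> I" and eq: "\<theta> (e i) = \<theta> (e j)"
    have "f i (\<theta> (e i)) = f i (\<theta> (e j))" by (simp only: eq)
    then show "i = j" using fe[OF ij(1) ij(1)] fe[OF ij] by (simp split: if_splits)
  qed
  have B_eq: "B = (\<lambda>i. \<theta> (e i)) ` I" unfolding B_def by (simp add: image_image)
  have "Q.V.lin_indpt B"
  proof (rule Q.V.finite_lin_indpt2[OF finB BV])
    fix a :: "_ \<Rightarrow> rat" assume z: "Q.V.lincomb a B = \<zero>\<^bsub>?V\<^esub>"
    show "\<forall>v\<in>B. a v = \<zero>\<^bsub>?R\<^esub>"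
    proof
      fix v assume "v \<in> B"
      then obtain i where i: "i \<in> I" "v = \<theta> (e i)" unfolding B_eq by (elim imageE)
      have "0 = (\<Sum>v\<in>B. a v * f i v)" using f_lincomb[OF finB BV i(1), of a] z f0[OF i(1)] by simp
      also have "\<dots> = (\<Sum>j\<in>I. a (\<theta> (e j)) * f i (\<theta> (e j)))" unfolding B_eq by (rule sum.reindex_cong[OF inj]) simp_all
      also have "\<dots> = (\<Sum>j\<in>I. if i = j then a (\<theta> (e j)) else 0)" by (rule sum.cong) (simp_all add: fe[OF i(1)])
      also have "\<dots> = a v" using finI i by simp
      finally show "a v = \<zero>\<^bsub>?R\<^esub>" by simp
    qed
  qed
  then have basis: "Q.V.basis B" unfolding Q.V.basis_def using span BV by simp
  have "Q.V.dim = card I" using Q.V.dim_basis[OF finB basis] card_image[OF inj] unfolding B_eq by simp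
  moreover have "Q.V.fin_dim" unfolding Q.V.fin_dim_def using finB BV span by auto
  ultimately show ?thesis by (simp add: group_rank_def)
qed

section \<open>Transcendence bases of homogeneous elements\<close>

text \<open>Monomials with different exponents have degrees that differ modulo W, so each term of a
  relation vanishes by itself. F is left abstract because the argument is needed both for parts of B
  and for parts of its fraction field.\<close>

lemma algebraically_independent_homogeneous:
  fixes F :: "'g::ab_group_add \<Rightarrow> 'a::idom set" and x :: "nat \<Rightarrow> 'a"
  assumes one: "1 \<in> F 0" and mult: "\<And>g h y z. y \<in> F g \<Longrightarrow> z \<in> F h \<Longrightarrow> y * z \<in> F (g + h)"
    and sep: "\<And>g h y. y \<in> F g \<Longrightarrow> y \<in> F h \<Longrightarrow> g - h \<notin> W \<Longrightarrow> y = 0"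
    and direct: "\<And>(J :: ('a \<Rightarrow>\<^sub>0 nat) set) y g j. finite J \<Longrightarrow> (\<And>j. j \<in> J \<Longrightarrow> y j \<in> F (g j)) \<Longrightarrow>
      (\<And>j k. j \<in> J \<Longrightarrow> k \<in> J \<Longrightarrow> j \<noteq> k \<Longrightarrow> g j - g k \<notin> W) \<Longrightarrow> (\<Sum>j\<in>J. y j) = 0 \<Longrightarrow> j \<in> J \<Longrightarrow> y j = 0"
    and B: "B \<subseteq> F 0" and I: "finite I" and x: "\<And>i. i \<in> I \<Longrightarrow> x i \<in> F (d i) \<and> x i \<noteq> 0"
    and ind: "\<And>n i. int_comb I n d \<in> W \<Longrightarrow> i \<in> I \<Longrightarrow> n i = 0"
  shows "inj_on x I \<and> algebraically_independent B (x ` I)"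
proof
  show inj: "inj_on x I"
  proof (rule inj_onI, rule ccontr)
    fix i j assume ij: "i \<in> I" "j \<in> I" "x i = x j" "i \<noteq> j"
    have "d i - d j \<notin> W"
    proof
      define n :: "nat \<Rightarrow> int" where "n l = (if l = i then 1 else 0) - (if l = j then 1 else 0)" for l
      assume "d i - d j \<in> W"
      moreover have "int_comb I n d = d i - d j"
        unfolding n_def int_comb_diff using int_comb_single[OF I ij(1), of 1 d] int_comb_single[OF I ij(2), of 1 d] by simp
      ultimately have "n i = 0" by (intro ind ij(1)) simp
      then show False using ij(4) by (simp add: n_def)
    qed
    moreover have "x i \<in> F (d j)" using x[OF ij(2)] ij(3) by simp
    ultimately have "x i = 0" using sep[of "x i" "d i" "d j"] x[OF ij(1)] by simp
    then show False using x[OF ij(1)] by simp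
  qed
  have pow: "x i ^ n \<in> F (int_scale (int n) (d i))" if "i \<in> I" for i n
    unfolding int_scale_int using x[OF that] by (induction n) (auto simp: one intro: mult)
  have prodF: "(\<Prod>i\<in>J. x i ^ n i) \<in> F (int_comb J (\<lambda>i. int (n i)) d)" if "J \<subseteq> I" for J n
    using finite_subset[OF that I] that
    by (induction J) (auto simp: one int_comb_def intro!: mult pow)
  show "algebraically_independent B (x ` I)"
    unfolding algebraically_independent_def
  proof (intro allI impI, elim conjE)
    fix p :: "('a \<Rightarrow>\<^sub>0 nat) \<Rightarrow>\<^sub>0 'a"
    assume pB: "\<forall>m. Poly_Mapping.lookup p m \<in> B"
      and pm: "\<forall>m\<in>Poly_Mapping.keys p. Poly_Mapping.keys m \<subseteq> x ` I" and p0: "eval_tautological p = 0"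
    define tm where "tm m = Poly_Mapping.lookup p m * (\<Prod>y\<in>Poly_Mapping.keys m. y ^ Poly_Mapping.lookup m y)" for m
    define dg where "dg m = int_comb I (\<lambda>i. int (Poly_Mapping.lookup m (x i))) d" for m
    have mono: "(\<Prod>y\<in>Poly_Mapping.keys m. y ^ Poly_Mapping.lookup m y) = (\<Prod>i\<in>I. x i ^ Poly_Mapping.lookup m (x i))"
      if "m \<in> Poly_Mapping.keys p" for m
    proof -
      have "(\<Prod>y\<in>Poly_Mapping.keys m. y ^ Poly_Mapping.lookup m y) = (\<Prod>y\<in>x ` I. y ^ Poly_Mapping.lookup m y)"
        using bspec[OF pm that] I by (intro prod.mono_neutral_left) (auto simp: in_keys_iff)
      also have "\<dots> = (\<Prod>i\<in>I. x i ^ Poly_Mapping.lookup m (x i))"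
        by (rule prod.reindex_cong[OF inj]) simp_all
      finally show ?thesis .
    qed
    have tmF: "tm m \<in> F (dg m)" if "m \<in> Poly_Mapping.keys p" for m
    proof -
      have "Poly_Mapping.lookup p m \<in> F 0" using pB B by auto
      from mult[OF this prodF[of I "\<lambda>i. Poly_Mapping.lookup m (x i)"]] show ?thesis
        by (simp add: tm_def dg_def mono[OF that])
    qed
    have tm0: "tm m = 0" if m: "m \<in> Poly_Mapping.keys p" for m
    proof (rule direct[of "Poly_Mapping.keys p" tm dg])
      show "dg j - dg k \<notin> W" if jk: "j \<in> Poly_Mapping.keys p" "k \<in> Poly_Mapping.keys p" "j \<noteq> k" for j k
      proof
        assume "dg j - dg k \<in> W"
        then have "int_comb I (\<lambda>i. int (Poly_Mapping.lookup j (x i)) - int (Poly_Mapping.lookup k (x i))) d \<in> W"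
          by (simp add: dg_def int_comb_diff)
        from ind[OF this] have eq: "Poly_Mapping.lookup j (x i) = Poly_Mapping.lookup k (x i)" if "i \<in> I" for i
          using that by simp
        have "Poly_Mapping.lookup j y = Poly_Mapping.lookup k y" for y
        proof (cases "y \<in> x ` I")
          case True
          then show ?thesis using eq by auto
        next
          case False
          then have "y \<notin> Poly_Mapping.keys j" "y \<notin> Poly_Mapping.keys k" using pm jk by auto
          then show ?thesis by (simp add: in_keys_iff)
        qed
        then have "j = k" by (rule poly_mapping_eqI)
        with jk(3) show False by simp
      qed
      show "(\<Sum>m\<in>Poly_Mapping.keys p. tm m) = 0" using p0 by (simp add: eval_tautological_def tm_def)
    qed (use tmF m in auto)
    have "Poly_Mapping.lookup p m = 0" if "m \<in> Poly_Mapping.keys p" for m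
    proof -
      have "(\<Prod>i\<in>I. x i ^ Poly_Mapping.lookup m (x i)) \<noteq> 0" using x I by auto
      then show ?thesis using tm0[OF that] unfolding tm_def mono[OF that] by simp
    qed
    then have "Poly_Mapping.lookup p m = 0" for m by (cases "m \<in> Poly_Mapping.keys p") (auto simp: in_keys_iff)
    then show "p = 0" by (intro poly_mapping_eqI) simp
  qed
qed

lemma inv_ring_of_type_algebra: "(k::'f::field) \<noteq> 0 \<Longrightarrow> inv\<^bsub>ring_of_type_algebra\<^esub> k = inverse k"
proof -
  interpret cring "ring_of_type_algebra :: 'f ring" by (rule cring_from_type_algebra)
  show "k \<noteq> 0 \<Longrightarrow> inv\<^bsub>ring_of_type_algebra\<^esub> k = inverse k" by (rule comm_inv_char) simp_all
qed

section \<open>The grading by cosets of W and its field of degree 0 fractions\<close>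

locale graded_domain_mod = graded_domain \<B>
  for \<B> :: "'g::ab_group_add \<Rightarrow> 'b::idom set" +
  fixes W :: "'g set"
  assumes W: "subgroup W additive_group" and WA: "W \<subseteq> grading_group \<B>"
begin

lemmas WD = subgroup_additive_groupD[OF W]

text \<open>Indexed by a representative of the coset, so that degrees still add in the original
  group; congruent representatives give the same part.\<close>

definition coset_part :: "'g \<Rightarrow> 'b set"
  where "coset_part g = graded_part \<B> {h. h - g \<in> W}"

lemma coset_part_mult: "y \<in> coset_part g \<Longrightarrow> z \<in> coset_part h \<Longrightarrow> y * z \<in> coset_part (g + h)"
proof -
  assume "y \<in> coset_part g" "z \<in> coset_part h"
  then show ?thesis unfolding coset_part_def
  proof (rule graded_part_mult)
    fix i j assume "i \<in> {i. i - g \<in> W}" "j \<in> {j. j - h \<in> W}"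
    then have "(i - g) + (j - h) \<in> W" by (intro WD(2)) simp_all
    then show "i + j \<in> {k. k - (g + h) \<in> W}" by (simp add: algebra_simps)
  qed
qed

lemma coset_part_0: "coset_part 0 = graded_part \<B> W"
  by (simp add: coset_part_def)

lemma homogeneous_coset_part: assumes "x \<in> \<B> i" shows "x \<in> coset_part i"
  unfolding coset_part_def
proof (rule homogeneous_graded_part[OF assms], rule CollectI)
  show "i - i \<in> W" unfolding diff_self by (rule WD(1))
qed

lemma coset_part_add: "y \<in> coset_part g \<Longrightarrow> z \<in> coset_part g \<Longrightarrow> y + z \<in> coset_part g"
  unfolding coset_part_def by (rule graded_part_add)

lemma coset_part_minus: "y \<in> coset_part g \<Longrightarrow> - y \<in> coset_part g"
  unfolding coset_part_def by (rule graded_part_minus)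

lemma coset_part_cong: "g - h \<in> W \<Longrightarrow> coset_part g = coset_part h"
proof -
  assume gh: "g - h \<in> W"
  have "k - g \<in> W \<longleftrightarrow> k - h \<in> W" for k
    using WD(2)[OF _ gh, of "k - g"] WD(4)[OF _ gh, of "k - h"] by auto
  then show ?thesis by (simp add: coset_part_def)
qed

lemma coset_part_independent:
  assumes "finite J" "\<And>j. j \<in> J \<Longrightarrow> y j \<in> coset_part (g j)"
    "\<And>j k. j \<in> J \<Longrightarrow> k \<in> J \<Longrightarrow> j \<noteq> k \<Longrightarrow> g j - g k \<notin> W" "(\<Sum>j\<in>J. y j) = 0" "j \<in> J"
  shows "y j = 0"
proof (rule graded_part_independent[where f = y and H = "\<lambda>j. {h. h - g j \<in> W}"])
  show "{h. h - g j \<in> W} \<inter> {h. h - g k \<in> W} = {}" if "j \<in> J" "k \<in> J" "j \<noteq> k" for j k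
  proof (rule ccontr)
    assume "\<not> ?thesis"
    then obtain h where "h - g j \<in> W" "h - g k \<in> W" by auto
    from WD(4)[OF this(2,1)] have "g j - g k \<in> W" by simp
    then show False using assms(3) that by simp
  qed
qed (use assms in \<open>simp_all add: coset_part_def\<close>)

lemma coset_part_sep: "y \<in> coset_part g \<Longrightarrow> y \<in> coset_part h \<Longrightarrow> g - h \<notin> W \<Longrightarrow> y = 0"
proof -
  assume y: "y \<in> coset_part g" "y \<in> coset_part h" "g - h \<notin> W"
  have "h - g \<notin> W" using WD(3)[of "h - g"] y(3) by auto
  \<comment> \<open>The family of y and - y, indexed by the booleans, has sum 0 and incongruent
    degrees.\<close>
  then show "y = 0"
    using coset_part_independent[of "{True, False}" "\<lambda>b. if b then y else - y" "\<lambda>b. if b then g else h" True]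
      y coset_part_minus by auto
qed

text \<open>The degree g part of B localised at the nonzero elements homogeneous for the coset
  grading. Its part of degree 0 is a field and becomes the K of the theorem.\<close>

definition fract_part :: "'g \<Rightarrow> 'b fract set"
  where "fract_part g = {to_fract a / to_fract b |a b k. a \<in> coset_part (g + k) \<and> b \<in> coset_part k \<and> b \<noteq> 0}"

lemma fract_partI: "a \<in> coset_part (g + k) \<Longrightarrow> b \<in> coset_part k \<Longrightarrow> b \<noteq> 0 \<Longrightarrow> to_fract a / to_fract b \<in> fract_part g"
  unfolding fract_part_def by blast

lemma fract_partE:
  assumes "y \<in> fract_part g"
  obtains a b k where "y = to_fract a / to_fract b" "a \<in> coset_part (g + k)" "b \<in> coset_part k" "b \<noteq> 0"
  using assms unfolding fract_part_def by auto

lemma to_fract_fract_part: "a \<in> coset_part g \<Longrightarrow> to_fract a \<in> fract_part g"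
  using fract_partI[of a g 0 1] homogeneous_coset_part[OF one_mem] by simp

lemma fract_part_mult:
  assumes "y \<in> fract_part g" "z \<in> fract_part h" shows "y * z \<in> fract_part (g + h)"
proof -
  obtain a b k where y: "y = to_fract a / to_fract b" "a \<in> coset_part (g + k)" "b \<in> coset_part k" "b \<noteq> 0"
    using assms(1) by (rule fract_partE)
  obtain a' b' k' where z: "z = to_fract a' / to_fract b'" "a' \<in> coset_part (h + k')" "b' \<in> coset_part k'" "b' \<noteq> 0"
    using assms(2) by (rule fract_partE)
  have "a * a' \<in> coset_part ((g + h) + (k + k'))" using coset_part_mult[OF y(2) z(2)] by (simp add: ac_simps)
  from fract_partI[OF this coset_part_mult[OF y(3) z(3)]] show ?thesis using y z by simp
qed

lemma fract_part_add:
  assumes "y \<in> fract_part g" "z \<in> fract_part g" shows "y + z \<in> fract_part g"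
proof -
  obtain a b k where y: "y = to_fract a / to_fract b" "a \<in> coset_part (g + k)" "b \<in> coset_part k" "b \<noteq> 0"
    using assms(1) by (rule fract_partE)
  obtain a' b' k' where z: "z = to_fract a' / to_fract b'" "a' \<in> coset_part (g + k')" "b' \<in> coset_part k'" "b' \<noteq> 0"
    using assms(2) by (rule fract_partE)
  have "a * b' \<in> coset_part (g + (k + k'))" "a' * b \<in> coset_part (g + (k + k'))"
    using coset_part_mult[OF y(2) z(3)] coset_part_mult[OF z(2) y(3)] by (simp_all add: ac_simps)
  then have "a * b' + a' * b \<in> coset_part (g + (k + k'))" by (rule coset_part_add)
  from fract_partI[OF this coset_part_mult[OF y(3) z(3)]] show ?thesis using y z by (simp add: add_frac_eq)
qed

lemma fract_part_minus:
  assumes "y \<in> fract_part g" shows "- y \<in> fract_part g"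
proof -
  obtain a b k where y: "y = to_fract a / to_fract b" "a \<in> coset_part (g + k)" "b \<in> coset_part k" "b \<noteq> 0"
    using assms(1) by (rule fract_partE)
  from fract_partI[OF coset_part_minus[OF y(2)] y(3,4)] show ?thesis using y by simp
qed

lemma fract_part_inverse:
  assumes "y \<in> fract_part g" "y \<noteq> 0" shows "inverse y \<in> fract_part (- g)"
proof -
  obtain a b k where y: "y = to_fract a / to_fract b" "a \<in> coset_part (g + k)" "b \<in> coset_part k" "b \<noteq> 0"
    using assms(1) by (rule fract_partE)
  have "a \<noteq> 0" using y(1) assms(2) by auto
  moreover have "b \<in> coset_part (- g + (g + k))" using y(3) by (simp add: algebra_simps)
  ultimately have "to_fract b / to_fract a \<in> fract_part (- g)" using y(2) by (intro fract_partI)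
  then show ?thesis using y(1) by simp
qed

lemma fract_part_cong: "g - h \<in> W \<Longrightarrow> fract_part g = fract_part h"
proof -
  assume gh: "g - h \<in> W"
  have "coset_part (g + k) = coset_part (h + k)" for k by (rule coset_part_cong) (simp add: gh)
  then show ?thesis by (simp add: fract_part_def)
qed

text \<open>The denominator is itself homogeneous, so it shifts all degrees equally and independence
  of fractions reduces to independence in B.\<close>

lemma fract_part_common_denominator:
  assumes "finite J" "\<And>j. j \<in> J \<Longrightarrow> y j \<in> fract_part (g j)"
  shows "\<exists>b k. b \<in> coset_part k \<and> b \<noteq> 0 \<and> (\<forall>j\<in>J. \<exists>a\<in>coset_part (g j + k). y j = to_fract a / to_fract b)"
  using assms
proof (induction J)
  case empty
  then show ?case using homogeneous_coset_part[OF one_mem] by (intro exI[of _ 1] exI[of _ 0]) simp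
next
  case (insert i J)
  have "\<exists>b k. b \<in> coset_part k \<and> b \<noteq> 0 \<and> (\<forall>j\<in>J. \<exists>a\<in>coset_part (g j + k). y j = to_fract a / to_fract b)"
    using insert.prems by (intro insert.IH) simp
  then obtain b k where b: "b \<in> coset_part k" "b \<noteq> 0"
    "\<forall>j\<in>J. \<exists>a\<in>coset_part (g j + k). y j = to_fract a / to_fract b" by (elim exE conjE)
  obtain a' b' k' where z: "y i = to_fract a' / to_fract b'" "a' \<in> coset_part (g i + k')" "b' \<in> coset_part k'" "b' \<noteq> 0"
    using insert.prems[of i] by (auto elim: fract_partE)
  have "\<exists>a\<in>coset_part (g j + (k + k')). y j = to_fract a / to_fract (b * b')" if j: "j \<in> insert i J" for j
  proof (cases "j = i")
    case True
    have "a' * b \<in> coset_part (g j + (k + k'))" using coset_part_mult[OF z(2) b(1)] True by (simp add: ac_simps)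
    moreover have "y j = to_fract (a' * b) / to_fract (b * b')" using z b(2) True by simp
    ultimately show ?thesis by (rule bexI[rotated])
  next
    case False
    then obtain a where a: "a \<in> coset_part (g j + k)" "y j = to_fract a / to_fract b" using b(3) j by auto
    have "a * b' \<in> coset_part (g j + (k + k'))" using coset_part_mult[OF a(1) z(3)] by (simp add: ac_simps)
    moreover have "y j = to_fract (a * b') / to_fract (b * b')" using a(2) z(4) by simp
    ultimately show ?thesis by (rule bexI[rotated])
  qed
  then show ?case using coset_part_mult[OF b(1) z(3)] b(2) z(4)
    by (intro exI[of _ "b * b'"] exI[of _ "k + k'"]) simp
qed

lemma fract_part_independent:
  assumes J: "finite J" "\<And>j. j \<in> J \<Longrightarrow> y j \<in> fract_part (g j)"
    and g: "\<And>j k. j \<in> J \<Longrightarrow> k \<in> J \<Longrightarrow> j \<noteq> k \<Longrightarrow> g j - g k \<notin> W" and s: "(\<Sum>j\<in>J. y j) = 0" and j: "j \<in> J"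
  shows "y j = 0"
proof -
  obtain b k where b: "b \<in> coset_part k" "b \<noteq> 0" "\<forall>j\<in>J. \<exists>a\<in>coset_part (g j + k). y j = to_fract a / to_fract b"
  proof -
    have "\<exists>b k. b \<in> coset_part k \<and> b \<noteq> 0 \<and> (\<forall>j\<in>J. \<exists>a\<in>coset_part (g j + k). y j = to_fract a / to_fract b)"
      using J by (rule fract_part_common_denominator)
    then show thesis using that by (elim exE conjE)
  qed
  obtain a where a: "\<And>j. j \<in> J \<Longrightarrow> a j \<in> coset_part (g j + k) \<and> y j = to_fract (a j) / to_fract b"
    using b(3) by metis
  have "0 = (\<Sum>j\<in>J. to_fract (a j) / to_fract b)" using s a by simp
  also have "\<dots> = to_fract (\<Sum>j\<in>J. a j) / to_fract b" by (simp add: to_fract_hom.hom_sum sum_divide_distrib)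
  finally have "to_fract (\<Sum>j\<in>J. a j) = to_fract 0"
    using b(2) by (metis divide_eq_0_iff to_fract_0 to_fract_eq_0_iff)
  then have "(\<Sum>j\<in>J. a j) = 0" by (simp only: to_fract_eq_iff)
  then have "a j = 0"
    using coset_part_independent[of J a "\<lambda>j. g j + k" j] J(1) a g j by simp
  then show ?thesis using a[OF j] by simp
qed

lemma fract_part_sep: "y \<in> fract_part g \<Longrightarrow> y \<in> fract_part h \<Longrightarrow> g - h \<notin> W \<Longrightarrow> y = 0"
proof -
  assume y: "y \<in> fract_part g" "y \<in> fract_part h" "g - h \<notin> W"
  have "h - g \<notin> W" using WD(3)[of "h - g"] y(3) by auto
  then show "y = 0"
    using fract_part_independent[of "{True, False}" "\<lambda>b. if b then y else - y" "\<lambda>b. if b then g else h" True]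
      y fract_part_minus by auto
qed

lemma one_fract_part: "1 \<in> fract_part 0"
  using to_fract_fract_part[OF homogeneous_coset_part[OF one_mem]] by simp

lemma subfield_fract_part: "subfield (fract_part 0) (ring_of_type_algebra :: 'b fract ring)"
proof -
  interpret R: Ring.field "ring_of_type_algebra :: 'b fract ring" by (rule field_from_type_algebra)
  have "subring (fract_part 0) (ring_of_type_algebra :: 'b fract ring)"
    using one_fract_part fract_part_minus[of _ 0] fract_part_mult[of _ 0 _ 0] fract_part_add[of _ 0]
    by (intro R.subringI) simp_all
  then show ?thesis
  proof (rule R.subfieldI')
    fix k assume "k \<in> fract_part 0 - {\<zero>\<^bsub>ring_of_type_algebra\<^esub>}"
    then have "k \<in> fract_part 0" "k \<noteq> 0" by simp_all
    then show "inv\<^bsub>ring_of_type_algebra\<^esub> k \<in> fract_part 0"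
      using fract_part_inverse[of k 0] by (simp add: inv_ring_of_type_algebra)
  qed
qed

text \<open>Each e i is a difference of degrees that occur, hence the degree of a quotient x i of
  homogeneous elements. Over the degree 0 field, one nonzero element of a given degree yields all
  others, so for generation only the degrees have to be reached.\<close>

lemma fract_part_transcendence_basis:
  assumes b: "basis_mod W (grading_group \<B>) I e"
  shows "purely_transcendental_over (fract_part 0) (enat (card I))"
proof -
  let ?R = "ring_of_type_algebra :: 'b fract ring"
  have finI: "finite I" and eA: "\<And>i. i \<in> I \<Longrightarrow> e i \<in> grading_group \<B>"
    and sp: "\<And>x. x \<in> grading_group \<B> \<Longrightarrow> \<exists>n. x - int_comb I n e \<in> W"
    and ind: "\<And>n i. int_comb I n e \<in> W \<Longrightarrow> i \<in> I \<Longrightarrow> n i = 0"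
    using b by (simp_all add: basis_mod_def generates_mod_def)
  have "\<exists>y. y \<in> fract_part (e i) \<and> y \<noteq> 0" if i: "i \<in> I" for i
  proof -
    obtain j k where jk: "\<B> j \<noteq> {0}" "\<B> k \<noteq> {0}" "e i = j - k" by (rule grading_group_diff[OF eA[OF i]])
    obtain a where a: "a \<in> \<B> j" "a \<noteq> 0" using degree_nonzero[OF jk(1)] by auto
    obtain b where b: "b \<in> \<B> k" "b \<noteq> 0" using degree_nonzero[OF jk(2)] by auto
    have "to_fract a / to_fract b \<in> fract_part (e i)"
      using homogeneous_coset_part[OF a(1)] homogeneous_coset_part[OF b(1)] b(2) jk(3) by (intro fract_partI[of _ _ k]) auto
    moreover have "to_fract a / to_fract b \<noteq> 0" using a(2) b(2) by simp
    ultimately show ?thesis by auto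
  qed
  then obtain x where x: "\<And>i. i \<in> I \<Longrightarrow> x i \<in> fract_part (e i) \<and> x i \<noteq> 0" by metis
  have "inj_on x I \<and> algebraically_independent (fract_part 0) (x ` I)"
  proof (rule algebraically_independent_homogeneous[where F = fract_part and W = W and d = e])
    show "1 \<in> fract_part 0" by (rule one_fract_part)
    show "y * z \<in> fract_part (g + h)" if "y \<in> fract_part g" "z \<in> fract_part h" for g h y z
      using that by (rule fract_part_mult)
    show "y = 0" if "y \<in> fract_part g" "y \<in> fract_part h" "g - h \<notin> W" for g h y
      using that by (rule fract_part_sep)
    show "y j = 0" if "finite J" "\<And>j. j \<in> J \<Longrightarrow> y j \<in> fract_part (g j)"
      "\<And>j k. j \<in> J \<Longrightarrow> k \<in> J \<Longrightarrow> j \<noteq> k \<Longrightarrow> g j - g k \<notin> W" "(\<Sum>j\<in>J. y j) = 0" "j \<in> J"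
      for J :: "('b fract \<Rightarrow>\<^sub>0 nat) set" and y g j
      using fract_part_independent[of J y g j] that by simp
    show "fract_part 0 \<subseteq> fract_part 0" by (rule subset_refl)
    show "x i \<in> fract_part (e i) \<and> x i \<noteq> 0" if "i \<in> I" for i using that by (rule x)
    show "n i = 0" if "int_comb I n e \<in> W" "i \<in> I" for n i using that by (rule ind)
  qed (rule finI)
  then have inj: "inj_on x I" and indep: "algebraically_independent (fract_part 0) (x ` I)" by simp_all
  define L where "L = generate_field ?R (fract_part 0 \<union> x ` I)"
  have L_one: "1 \<in> L" using generate_field.one[of ?R] by (simp add: L_def)
  have L_minus: "- y \<in> L" if "y \<in> L" for y
    using generate_field.a_inv[of y ?R] that by (simp add: L_def)
  have L_inv: "inverse y \<in> L" if "y \<in> L" for y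
    using generate_field.m_inv[of y ?R] that by (cases "y = 0") (simp_all add: L_def inv_ring_of_type_algebra)
  have L_add: "y + z \<in> L" if "y \<in> L" "z \<in> L" for y z
    using generate_field.eng_add[of y ?R _ z] that by (simp add: L_def)
  have L_mult: "y * z \<in> L" if "y \<in> L" "z \<in> L" for y z
    using generate_field.eng_mult[of y ?R _ z] that by (simp add: L_def)
  have L_K: "y \<in> L" if "y \<in> fract_part 0" for y
    unfolding L_def using that by (intro generate_field.incl) simp
  have L_x: "x i \<in> L" if "i \<in> I" for i
    unfolding L_def using that by (intro generate_field.incl) simp
  have L_0: "0 \<in> L" using L_add[OF L_one L_minus[OF L_one]] by simp
  \<comment> \<open>The degrees reached by L form a subgroup. It contains W and every e i, hence the
    whole grading group.\<close>
  define U where "U = {g. \<exists>y\<in>L. y \<in> fract_part g \<and> y \<noteq> 0}"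
  have U: "subgroup U additive_group"
    unfolding subgroup_additive_group_iff
  proof (intro conjI ballI)
    show "0 \<in> U" using L_one one_fract_part by (auto simp: U_def)
    fix g assume "g \<in> U"
    then obtain y where y: "y \<in> L" "y \<in> fract_part g" "y \<noteq> 0" by (auto simp: U_def)
    then show "- g \<in> U" unfolding U_def using L_inv fract_part_inverse by (intro CollectI bexI[of _ "inverse y"]) auto
    fix h assume "h \<in> U"
    then obtain z where z: "z \<in> L" "z \<in> fract_part h" "z \<noteq> 0" by (auto simp: U_def)
    show "g + h \<in> U" unfolding U_def using y z L_mult fract_part_mult by (intro CollectI bexI[of _ "y * z"]) auto
  qed
  note UD = subgroup_additive_groupD[OF U]
  have eU: "e i \<in> U" if "i \<in> I" for i using L_x x that by (auto simp: U_def)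
  have WU: "g \<in> U" if "g \<in> W" for g
    using L_one one_fract_part fract_part_cong[of g 0] that by (auto simp: U_def)
  have AU: "g \<in> U" if g: "g \<in> grading_group \<B>" for g
  proof -
    obtain n where n: "g - int_comb I n e \<in> W" using sp[OF g] by auto
    have "(g - int_comb I n e) + int_comb I n e \<in> U" by (rule UD(2)[OF WU[OF n] int_comb_mem[OF U eU]])
    then show ?thesis by simp
  qed
  \<comment> \<open>Divided by an element of L of its own degree, b lands in the degree 0
    field.\<close>
  have hom: "to_fract b \<in> L" if b: "b \<in> \<B> i" for b i
  proof (cases "b = 0")
    case False
    have "\<B> i \<noteq> {0}" using b False by auto
    then have "i \<in> U" by (intro AU degree_in_grading_group)
    then obtain y where y: "y \<in> L" "y \<in> fract_part i" "y \<noteq> 0" by (auto simp: U_def)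
    have "to_fract b * inverse y \<in> fract_part (i + - i)"
      by (rule fract_part_mult[OF to_fract_fract_part[OF homogeneous_coset_part[OF b]] fract_part_inverse[OF y(2,3)]])
    then have "to_fract b * inverse y \<in> L" by (intro L_K) simp
    then have "(to_fract b * inverse y) * y \<in> L" using y(1) by (rule L_mult)
    then show ?thesis using y(3) by (simp add: mult.assoc)
  qed (simp add: L_0)
  have allB: "to_fract b \<in> L" for b
  proof -
    have "(\<Sum>i\<in>T. to_fract (component b i)) \<in> L" if "finite T" for T
      using that by (induction T) (auto simp: L_0 intro!: L_add hom[OF component_mem])
    from this[OF finite_support[of b]] have "to_fract (\<Sum>i\<in>support b. component b i) \<in> L"
      by (simp add: to_fract_hom.hom_sum)
    then show ?thesis using sum_component[of b] by simp
  qed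
  have "z \<in> L" for z
  proof -
    obtain a b where ab: "z = Fract a b" "b \<noteq> 0" by (cases z) auto
    then have "z = to_fract a * inverse (to_fract b)" by (simp add: to_fract_def)
    then show ?thesis using allB L_inv L_mult by simp
  qed
  then have "L = UNIV" by auto
  moreover have "ecard (x ` I) = enat (card I)" using finI card_image[OF inj] by (simp add: ecard_def)
  ultimately show ?thesis unfolding purely_transcendental_over_def L_def using indep by metis
qed

text \<open>\<open>trdeg\<close> counts independent elements of B itself, whereas the transcendence
  basis of the fraction field consists of quotients. So the e i are moved to degrees that occur in
  B, without losing independence modulo W.\<close>

lemma trdeg_ge_card_basis:
  assumes b: "basis_mod W (grading_group \<B>) I e" and R: "R \<subseteq> graded_part \<B> W"
  shows "enat (card I) \<le> trdeg (UNIV :: 'b set) R"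
proof -
  let ?A = "grading_group \<B>"
  note A = subgroup_grading_group
  have finI: "finite I" and eA: "\<And>i. i \<in> I \<Longrightarrow> e i \<in> ?A"
    and sp: "\<And>x. x \<in> ?A \<Longrightarrow> \<exists>n. x - int_comb I n e \<in> W"
    and ind: "\<And>n i. int_comb I n e \<in> W \<Longrightarrow> i \<in> I \<Longrightarrow> n i = 0"
    using b by (simp_all add: basis_mod_def generates_mod_def)
  have "\<forall>i\<in>I. \<exists>p. \<B> (fst p) \<noteq> {0} \<and> \<B> (snd p) \<noteq> {0} \<and> e i = fst p - snd p"
  proof
    fix i assume i: "i \<in> I"
    obtain j k where "\<B> j \<noteq> {0}" "\<B> k \<noteq> {0}" "e i = j - k" by (rule grading_group_diff[OF eA[OF i]])
    then show "\<exists>p. \<B> (fst p) \<noteq> {0} \<and> \<B> (snd p) \<noteq> {0} \<and> e i = fst p - snd p" by (intro exI[of _ "(j, k)"]) simp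
  qed
  from bchoice[OF this] obtain p where p: "\<forall>i\<in>I. \<B> (fst (p i)) \<noteq> {0} \<and> \<B> (snd (p i)) \<noteq> {0} \<and>
    e i = fst (p i) - snd (p i)" by (rule exE)
  \<comment> \<open>The sum of all degrees subtracted in the e i: adding it to any e i cancels the
    subtraction and leaves a sum of degrees that occur.\<close>
  define N where "N = (\<Sum>i\<in>I. snd (p i))"
  have sum_deg: "\<B> (\<Sum>i\<in>J. snd (p i)) \<noteq> {0}" if "J \<subseteq> I" for J
    using finite_subset[OF that finI] that
  proof (induction J)
    case empty
    show ?case using one_degree by simp
  next
    case (insert j J)
    have "\<B> (snd (p j) + (\<Sum>i\<in>J. snd (p i))) \<noteq> {0}"
      using insert.prems bspec[OF p, of j] by (intro homogeneous_mult_degree insert.IH) simp_all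
    then show ?case using insert.hyps by simp
  qed
  have NA: "N \<in> ?A" unfolding N_def by (rule degree_in_grading_group[OF sum_deg]) simp
  obtain \<nu> where \<nu>: "N - int_comb I \<nu> e \<in> W" using sp[OF NA] by auto
  define \<sigma> where "\<sigma> = (\<Sum>i\<in>I. \<nu> i)"
  \<comment> \<open>The vectors \<open>e i + \<kappa> * N\<close> are degrees of elements of \<open>B\<close>; in coordinates with respect to \<open>e\<close> their
    determinant is \<open>1 + \<kappa> * \<sigma>\<close>.\<close>
  define \<kappa> :: int where "\<kappa> = (if \<sigma> = - 1 then 2 else 1)"
  have \<kappa>: "1 + \<kappa> * \<sigma> \<noteq> 0" by (auto simp: \<kappa>_def)
  define d where "d i = e i + int_scale \<kappa> N" for i
  have "\<B> (d i) \<noteq> {0}" if i: "i \<in> I" for i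
  proof -
    have N_split: "N = snd (p i) + (\<Sum>j\<in>I - {i}. snd (p j))" unfolding N_def by (rule sum.remove[OF finI i])
    have 1: "\<B> (fst (p i) + (\<Sum>j\<in>I - {i}. snd (p j))) \<noteq> {0}"
      using bspec[OF p i] sum_deg[of "I - {i}"] by (intro homogeneous_mult_degree) simp_all
    have 2: "fst (p i) + (\<Sum>j\<in>I - {i}. snd (p j)) = e i + N" using bspec[OF p i] N_split by simp
    have 3: "\<B> N \<noteq> {0}" unfolding N_def by (rule sum_deg) simp
    have 4: "\<B> (e i + N) \<noteq> {0}" using 1 unfolding 2 .
    show ?thesis
    proof (cases "\<sigma> = - 1")
      case True
      have "int_scale 2 N = N + N" using int_scale.scale_left_distrib[of 1 1 N] by simp
      then have "d i = (e i + N) + N" using True by (simp add: d_def \<kappa>_def add.assoc)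
      then show ?thesis using homogeneous_mult_degree[OF 4 3] by (simp only: not_False_eq_True)
    next
      case False
      then have "d i = e i + N" by (simp add: d_def \<kappa>_def)
      then show ?thesis using 4 by (simp only: not_False_eq_True)
    qed
  qed
  then have "\<forall>i\<in>I. \<exists>y. y \<in> \<B> (d i) \<and> y \<noteq> 0" using degree_nonzero by (metis (no_types))
  from bchoice[OF this] obtain x where x: "\<forall>i\<in>I. x i \<in> \<B> (d i) \<and> x i \<noteq> 0" by (rule exE)
  \<comment> \<open>If s is the sum of the coefficients of a relation, adding up its coordinates
    gives s * (1 + \<kappa> * \<sigma>) = 0. Hence s = 0, and the coordinates are the coefficients
    themselves.\<close>
  have ind_d: "n i = 0" if n: "int_comb I n d \<in> W" and i: "i \<in> I" for n i
  proof -
    define s where "s = (\<Sum>i\<in>I. n i)"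
    have "int_comb I n d = int_comb I n e + int_scale (s * \<kappa>) N"
    proof -
      have "int_scale s (int_scale \<kappa> N) = (\<Sum>i\<in>I. int_scale (n i) (int_scale \<kappa> N))"
        unfolding s_def by (rule int_scale.scale_sum_left)
      then have "(\<Sum>i\<in>I. int_scale (n i) (int_scale \<kappa> N)) = int_scale (s * \<kappa>) N"
        by (simp only: int_scale.scale_scale)
      then show ?thesis
        unfolding int_comb_def d_def int_scale.scale_right_distrib sum.distrib by (simp only:)
    qed
    moreover have "int_comb I (\<lambda>i. (s * \<kappa>) * \<nu> i) e = int_scale (s * \<kappa>) (int_comb I \<nu> e)"
      unfolding int_comb_def by (simp add: int_scale.scale_sum_right)
    ultimately have "int_comb I (\<lambda>i. n i + (s * \<kappa>) * \<nu> i) e = int_comb I n d - int_scale (s * \<kappa>) (N - int_comb I \<nu> e)"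
      unfolding int_comb_add[of I n "\<lambda>i. (s * \<kappa>) * \<nu> i"] int_scale.scale_right_diff_distrib
      by (simp only: add_diff_cancel_right diff_diff_eq2 add.commute[of "int_comb I n e"]) simp
    also have "\<dots> \<in> W" by (rule WD(4)[OF n int_scale_mem[OF W \<nu>]])
    finally have cW: "int_comb I (\<lambda>i. n i + (s * \<kappa>) * \<nu> i) e \<in> W" .
    have z: "n i + (s * \<kappa>) * \<nu> i = 0" if "i \<in> I" for i by (rule ind[OF cW that])
    have "(\<Sum>i\<in>I. n i + (s * \<kappa>) * \<nu> i) = 0" by (rule sum.neutral, rule ballI, rule z)
    then have "s + (s * \<kappa>) * \<sigma> = 0" by (simp only: sum.distrib s_def[symmetric] \<sigma>_def sum_distrib_left)
    then have "s * (1 + \<kappa> * \<sigma>) = 0" by (simp add: algebra_simps)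
    then have "s = 0" using \<kappa> by simp
    then show ?thesis using z[OF i] by simp
  qed
  have xF: "x i \<in> coset_part (d i) \<and> x i \<noteq> 0" if "i \<in> I" for i using bspec[OF x that] homogeneous_coset_part by simp
  have RF: "R \<subseteq> coset_part 0" using R by (simp add: coset_part_0)
  have "inj_on x I \<and> algebraically_independent R (x ` I)"
  proof (rule algebraically_independent_homogeneous[where F = coset_part and W = W and d = d])
    show "1 \<in> coset_part 0" by (rule homogeneous_coset_part[OF one_mem])
    show "y * z \<in> coset_part (g + h)" if "y \<in> coset_part g" "z \<in> coset_part h" for g h y z
      using that by (rule coset_part_mult)
    show "y = 0" if "y \<in> coset_part g" "y \<in> coset_part h" "g - h \<notin> W" for g h y
      using that by (rule coset_part_sep)
    show "y j = 0" if "finite J" "\<And>j. j \<in> J \<Longrightarrow> y j \<in> coset_part (g j)"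
      "\<And>j k. j \<in> J \<Longrightarrow> k \<in> J \<Longrightarrow> j \<noteq> k \<Longrightarrow> g j - g k \<notin> W" "(\<Sum>j\<in>J. y j) = 0" "j \<in> J"
      for J :: "('b \<Rightarrow>\<^sub>0 nat) set" and y g j
      using coset_part_independent[of J y g j] that by simp
    show "R \<subseteq> coset_part 0" by (rule RF)
    show "x i \<in> coset_part (d i) \<and> x i \<noteq> 0" if "i \<in> I" for i using that by (rule xF)
    show "n i = 0" if "int_comb I n d \<in> W" "i \<in> I" for n i using that by (rule ind_d)
  qed (rule finI)
  then have inj: "inj_on x I" and indep: "algebraically_independent R (x ` I)" by simp_all
  have "ecard (x ` I) = enat (card I)" using finI card_image[OF inj] by (simp add: ecard_def)
  then show ?thesis unfolding trdeg_def using indep by (intro Sup_upper image_eqI[of _ _ "x ` I"]) simp_all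
qed

end

text \<open>Finiteness is essential: for infinitely many subgroups the required multiples of x may
  be unbounded.\<close>

lemma common_multiple_in_subgroups:
  assumes "finite \<M>" "\<And>M. M \<in> \<M> \<Longrightarrow> subgroup M (additive_group :: 'g::ab_group_add monoid)"
    "\<And>M. M \<in> \<M> \<Longrightarrow> \<exists>n::nat. n \<ge> 1 \<and> int_scale (int n) x \<in> M"
  shows "\<exists>n::nat. n \<ge> 1 \<and> (\<forall>M\<in>\<M>. int_scale (int n) x \<in> M)"
  using assms
proof (induction \<M>)
  case (insert M \<M>)
  obtain n :: nat where n: "n \<ge> 1" "\<forall>M\<in>\<M>. int_scale (int n) x \<in> M"
    using insert.IH insert.prems by auto
  obtain m :: nat where m: "m \<ge> 1" "int_scale (int m) x \<in> M" using insert.prems(2)[of M] by auto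
  have "int_scale (int (n * m)) x \<in> M'" if "M' \<in> insert M \<M>" for M'
  proof (cases "M' = M")
    case True
    have "int_scale (int n) (int_scale (int m) x) \<in> M" by (rule int_scale_mem[OF insert.prems(1) m(2)]) simp
    then show ?thesis using True by simp
  next
    case False
    then have M': "M' \<in> \<M>" using that by simp
    have "int_scale (int m) (int_scale (int n) x) \<in> M'"
      by (rule int_scale_mem[OF insert.prems(1)]) (use that n(2) M' in simp_all)
    then show ?thesis by (simp add: mult.commute)
  qed
  moreover have "n * m \<ge> 1" using n(1) m(1) by simp
  ultimately show ?case by (intro exI[of _ "n * m"]) simp
qed (auto intro: exI[of _ 1])

section \<open>Intersections of kernels over the height one primes\<close>

context graded_domain
begin

lemma degree_group_off_pair:
  assumes "P \<in> prime_spectrum" shows "subgroup_pair (grading_group \<B>) (degree_group_off \<B> P)"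
  by (rule subgroup_pair.intro[OF subgroup_grading_group subgroup_degree_group_off
        degree_group_off_subset[OF prime_spectrumD(4)[OF assms]]])

text \<open>The set \<Delta> belonging to P. Taking all derivations with such a kernel avoids
  choosing one for each H.\<close>

definition cocyclic_LNDs :: "'b set \<Rightarrow> ('b \<Rightarrow> 'b) set"
  where "cocyclic_LNDs P = {D \<in> LND UNIV. \<exists>H \<in> cocyclic_overgroups (degree_group_off \<B> P) (grading_group \<B>).
    derivation_ker D = graded_part \<B> H}"

text \<open>Every cocyclic overgroup is realised by a kernel, so the intersection of the kernels is
  the part of B over the intersection of these overgroups.\<close>

lemma Inter_ker_cocyclic_LNDs:
  fixes \<iota> :: "'k::field_char_0 \<Rightarrow> 'b"
  assumes aff: "affine_algebra \<iota>" and \<iota>0: "range \<iota> \<subseteq> \<B> 0" and normal: "normal_domain TYPE('b)"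
    and P: "P \<in> Spec1" and nt: "\<not> torsion_group (quotient_group (grading_group \<B>) (degree_group_off \<B> P))"
  shows "(\<Inter>D\<in>cocyclic_LNDs P. derivation_ker D) =
    graded_part \<B> (torc (degree_group_off \<B> P) (grading_group \<B>))"
proof (rule Set.set_eqI)
  fix x
  let ?C = "cocyclic_overgroups (degree_group_off \<B> P) (grading_group \<B>)"
  interpret subgroup_pair "grading_group \<B>" "degree_group_off \<B> P"
    by (rule degree_group_off_pair[OF Spec1_prime[OF P]])
  obtain E where E: "finite E" "grading_group \<B> = generate additive_group E"
    by (rule grading_group_finitely_generated[OF aff \<iota>0]) (rule that)
  have "x \<in> (\<Inter>D\<in>cocyclic_LNDs P. derivation_ker D) \<longleftrightarrow> (\<forall>H\<in>?C. x \<in> graded_part \<B> H)"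
  proof
    assume l: "x \<in> (\<Inter>D\<in>cocyclic_LNDs P. derivation_ker D)"
    show "\<forall>H\<in>?C. x \<in> graded_part \<B> H"
    proof
      fix H assume H: "H \<in> ?C"
      obtain D where D: "D \<in> LND UNIV" "derivation_ker D = graded_part \<B> H"
        using LND_kernel_cocyclic[OF aff \<iota>0 normal P H] by (rule bexE)
      then have "D \<in> cocyclic_LNDs P" using H by (auto simp: cocyclic_LNDs_def)
      with l have "x \<in> derivation_ker D" by (rule INT_D)
      then show "x \<in> graded_part \<B> H" by (simp only: D(2))
    qed
  next
    assume r: "\<forall>H\<in>?C. x \<in> graded_part \<B> H"
    show "x \<in> (\<Inter>D\<in>cocyclic_LNDs P. derivation_ker D)"
    proof (rule INT_I)
      fix D assume "D \<in> cocyclic_LNDs P"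
      then obtain H where "H \<in> ?C" "derivation_ker D = graded_part \<B> H" by (auto simp: cocyclic_LNDs_def)
      then show "x \<in> derivation_ker D" using bspec[OF r] by simp
    qed
  qed
  also have "\<dots> \<longleftrightarrow> support x \<subseteq> \<Inter> ?C" by (auto simp: graded_part_iff)
  also have "\<dots> \<longleftrightarrow> x \<in> graded_part \<B> (torc (degree_group_off \<B> P) (grading_group \<B>))"
    unfolding Inter_cocyclic_overgroups(2)[OF E(2,1) nt] graded_part_iff ..
  finally show "x \<in> (\<Inter>D\<in>cocyclic_LNDs P. derivation_ker D) \<longleftrightarrow>
    x \<in> graded_part \<B> (torc (degree_group_off \<B> P) (grading_group \<B>))" .
qed

end

theorem theorem11p4:
  fixes \<iota> :: "'k::field_char_0 \<Rightarrow> 'b::idom"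
    and \<B> :: "'g::ab_group_add \<Rightarrow> 'b set"
    and r :: enat
    and W :: "'g set"
  assumes affine: "affine_algebra \<iota>"
    and normal: "normal_domain TYPE('b)"
    and grading: "ring_grading \<B>"
    and graded_over: "range \<iota> \<subseteq> \<B> 0"
    and not_torsion: "\<not> torsion_group (quotient_group (grading_group \<B>) (bar_grading_group \<B>))"
    and r_def: "r = group_rank (quotient_group (grading_group \<B>) (bar_grading_group \<B>))"
    and W_def: "W = torc (bar_grading_group \<B>) (grading_group \<B>)"
  shows
    "((\<exists>\<pp>\<in>Spec1. \<not> torsion_group (quotient_group (grading_group \<B>) (degree_group_off \<B> \<pp>))) \<and>
      (\<forall>\<pp>\<in>Spec1. \<not> torsion_group (quotient_group (grading_group \<B>) (degree_group_off \<B> \<pp>)) \<longrightarrow>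
         cocyclic_overgroups (degree_group_off \<B> \<pp>) (grading_group \<B>) \<noteq> {} \<and>
         (\<forall>H \<in> cocyclic_overgroups (degree_group_off \<B> \<pp>) (grading_group \<B>).
            \<exists>D \<in> LND UNIV. derivation_ker D = graded_part \<B> H) \<and>
         (\<exists>\<Delta> \<subseteq> LND UNIV. (\<Inter>D\<in>\<Delta>. derivation_ker D) =
            graded_part \<B> (torc (degree_group_off \<B> \<pp>) (grading_group \<B>))))) \<and>
     (\<exists>\<Delta> \<subseteq> LND UNIV. (\<Inter>D\<in>\<Delta>. derivation_ker D) = graded_part \<B> W) \<and>
     ((\<exists>K. subfield K (ring_of_type_algebra :: 'b fract ring) \<and>
           makar_limanov \<subseteq> graded_part \<B> W \<and> to_fract ` graded_part \<B> W \<subseteq> K \<and>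
           purely_transcendental_over K r) \<and>
      trdeg (UNIV :: 'b set) makar_limanov \<ge> r) \<and>
     (\<not> rigid (UNIV :: 'b set) \<and>
      (torsion_free_group (additive_group :: 'g monoid) \<longrightarrow>
         nonrigid_subgroups \<B> = cotorsion_subgroups \<B>))"
proof -
  have one: "1 \<in> \<B> 0" using graded_over affine_algebra_hom(3)[OF affine] by (metis rangeI subsetD)
  interpret graded_domain \<B> by unfold_locales (rule grading one)+
  let ?A = "grading_group \<B>" and ?M = "degree_group_off \<B>"
  note A = subgroup_grading_group
  define nt where "nt P \<longleftrightarrow> P \<in> Spec1 \<and> \<not> torsion_group (quotient_group ?A (?M P))" for P
  have pair: "subgroup_pair ?A (?M P)" if "P \<in> Spec1" for P
    by (rule degree_group_off_pair[OF Spec1_prime[OF that]])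
  obtain E where E: "finite E" "?A = generate additive_group E"
    by (rule grading_group_finitely_generated[OF affine graded_over]) (rule that)
  \<comment> \<open>Without height one primes the bar group would be the grading group, and the
    trivial quotient is torsion.\<close>
  have ne: "(Spec1 :: 'b set set) \<noteq> {}"
  proof
    assume "(Spec1 :: 'b set set) = {}"
    then have "bar_grading_group \<B> = ?A" by (simp add: bar_grading_group_def)
    moreover have "torsion_group (quotient_group ?A ?A)"
      unfolding subgroup_pair.torsion_quotient_iff[OF subgroup_pair.intro[OF A A subset_refl]]
      by (auto intro!: exI[of _ 1])
    ultimately show False using not_torsion by simp
  qed
  have bar: "bar_grading_group \<B> = (\<Inter>P\<in>Spec1. ?M P)" using ne by (simp add: bar_grading_group_def)
  have barG: "subgroup (bar_grading_group \<B>) additive_group"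
    unfolding bar subgroup_additive_group_iff
    using subgroup_additive_groupD[OF subgroup_degree_group_off] by auto
  have barA: "bar_grading_group \<B> \<subseteq> ?A"
    unfolding bar using ne degree_group_off_subset[OF prime_spectrumD(4)[OF Spec1_prime]] by auto
  interpret bar: subgroup_pair ?A "bar_grading_group \<B>"
    by (rule subgroup_pair.intro[OF A barG barA])
  have common: "\<exists>n::nat. n \<ge> 1 \<and> int_scale (int n) x \<in> bar_grading_group \<B>"
    if "\<And>P. P \<in> Spec1 \<Longrightarrow> \<exists>n::nat. n \<ge> 1 \<and> int_scale (int n) x \<in> ?M P" for x
  proof -
    have "\<exists>n::nat. n \<ge> 1 \<and> (\<forall>M\<in>?M ` Spec1. int_scale (int n) x \<in> M)"
      by (rule common_multiple_in_subgroups[OF finite_degree_groups_off[OF affine graded_over]])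
        (use that subgroup_degree_group_off in auto)
    then show ?thesis unfolding bar by simp
  qed
  \<comment> \<open>The torsion closure of the intersection is the intersection of the torsion
    closures, since \<open>common\<close> finds one multiple for all primes.\<close>
  have W_iff: "x \<in> W \<longleftrightarrow> x \<in> ?A \<and> (\<forall>P\<in>Spec1. x \<in> torc (?M P) ?A)" for x
  proof
    assume "x \<in> W"
    then obtain m :: nat where m: "x \<in> ?A" "m \<ge> 1" "int_scale (int m) x \<in> bar_grading_group \<B>"
      unfolding W_def torc_iff by (elim conjE exE) (rule that)
    have "int_scale (int m) x \<in> ?M P" if "P \<in> Spec1" for P using m(3) that unfolding bar by (rule INT_D)
    then show "x \<in> ?A \<and> (\<forall>P\<in>Spec1. x \<in> torc (?M P) ?A)" using m(1,2) unfolding torc_iff by metis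
  next
    assume "x \<in> ?A \<and> (\<forall>P\<in>Spec1. x \<in> torc (?M P) ?A)"
    then have x: "x \<in> ?A" "\<And>P. P \<in> Spec1 \<Longrightarrow> \<exists>n::nat. n \<ge> 1 \<and> int_scale (int n) x \<in> ?M P"
      by (simp_all add: torc_iff)
    show "x \<in> W" unfolding W_def torc_iff using x(1) common[OF x(2)] by (rule conjI)
  qed
  \<comment> \<open>A prime with torsion quotient imposes no condition, so W is cut out by the
    primes satisfying \<open>nt\<close>. If there were none, W would be the whole grading
    group.\<close>
  have tors_torc: "torc (?M P) ?A = ?A" if "P \<in> Spec1" "\<not> nt P" for P
    using that subgroup_pair.torsion_quotient_torc[OF pair[OF that(1)]] by (simp add: nt_def)
  have ex_nt: "\<exists>P. nt P"
  proof (rule ccontr)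
    assume "\<nexists>P. nt P"
    then have "W = ?A" using W_iff tors_torc by auto
    then show False using not_torsion unfolding bar.torsion_quotient_torc W_def by (rule notE[rotated])
  qed
  have a: "cocyclic_overgroups (?M P) ?A \<noteq> {} \<and>
      (\<forall>H \<in> cocyclic_overgroups (?M P) ?A. \<exists>D \<in> LND UNIV. derivation_ker D = graded_part \<B> H) \<and>
      (\<exists>\<Delta> \<subseteq> LND UNIV. (\<Inter>D\<in>\<Delta>. derivation_ker D) = graded_part \<B> (torc (?M P) ?A))"
    if P: "nt P" for P
  proof (intro conjI ballI)
    have PS: "P \<in> Spec1" and tP: "\<not> torsion_group (quotient_group ?A (?M P))" using P by (simp_all add: nt_def)
    show "cocyclic_overgroups (?M P) ?A \<noteq> {}"
      by (rule subgroup_pair.Inter_cocyclic_overgroups(1)[OF pair[OF PS] E(2,1) tP])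
    show "\<exists>D\<in>LND UNIV. derivation_ker D = graded_part \<B> H" if "H \<in> cocyclic_overgroups (?M P) ?A" for H
      by (rule LND_kernel_cocyclic[OF affine graded_over normal PS that])
    have "cocyclic_LNDs P \<subseteq> LND UNIV" by (auto simp: cocyclic_LNDs_def)
    with Inter_ker_cocyclic_LNDs[OF affine graded_over normal PS tP]
    show "\<exists>\<Delta> \<subseteq> LND UNIV. (\<Inter>D\<in>\<Delta>. derivation_ker D) = graded_part \<B> (torc (?M P) ?A)"
      by (intro exI[of _ "cocyclic_LNDs P"] conjI)
  qed
  define \<Delta> where "\<Delta> = (\<Union>P\<in>{P. nt P}. cocyclic_LNDs P)"
  have \<Delta>: "\<Delta> \<subseteq> LND UNIV" by (auto simp: \<Delta>_def cocyclic_LNDs_def)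
  have \<Delta>_ker: "(\<Inter>D\<in>\<Delta>. derivation_ker D) = graded_part \<B> W"
  proof (rule Set.set_eqI)
    fix x
    have "x \<in> (\<Inter>D\<in>\<Delta>. derivation_ker D) \<longleftrightarrow> (\<forall>P. nt P \<longrightarrow> x \<in> (\<Inter>D\<in>cocyclic_LNDs P. derivation_ker D))"
      by (auto simp: \<Delta>_def)
    also have "\<dots> \<longleftrightarrow> (\<forall>P. nt P \<longrightarrow> x \<in> graded_part \<B> (torc (?M P) ?A))"
      using Inter_ker_cocyclic_LNDs[OF affine graded_over normal] by (simp add: nt_def)
    also have "\<dots> \<longleftrightarrow> (\<forall>i\<in>support x. \<forall>P. nt P \<longrightarrow> i \<in> torc (?M P) ?A)"
      by (auto simp: graded_part_iff)
    also have "\<dots> \<longleftrightarrow> (\<forall>i\<in>support x. i \<in> W)"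
    proof (rule ball_cong[OF refl])
      fix i assume "i \<in> support x"
      then have "i \<in> ?A" by (rule support_in_grading_group)
      then show "(\<forall>P. nt P \<longrightarrow> i \<in> torc (?M P) ?A) \<longleftrightarrow> i \<in> W"
      proof -
        assume iA: "i \<in> ?A"
        have "i \<in> W \<longleftrightarrow> (\<forall>P\<in>Spec1. i \<in> torc (?M P) ?A)" using W_iff[of i] iA by simp
        also have "\<dots> \<longleftrightarrow> (\<forall>P. nt P \<longrightarrow> i \<in> torc (?M P) ?A)"
        proof (intro iffI allI ballI impI)
          fix P assume "\<forall>P\<in>Spec1. i \<in> torc (?M P) ?A" "nt P"
          then show "i \<in> torc (?M P) ?A" by (simp add: nt_def)
        next
          fix P assume r: "\<forall>P. nt P \<longrightarrow> i \<in> torc (?M P) ?A" and P: "P \<in> (Spec1 :: 'b set set)"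
          show "i \<in> torc (?M P) ?A"
          proof (cases "nt P")
            case True
            then show ?thesis using r by simp
          next
            case False
            show ?thesis unfolding tors_torc[OF P False] by (rule iA)
          qed
        qed
        finally show ?thesis by simp
      qed
    qed
    finally show "x \<in> (\<Inter>D\<in>\<Delta>. derivation_ker D) \<longleftrightarrow> x \<in> graded_part \<B> W"
      by (simp add: graded_part_iff subset_iff Ball_def)
  qed
  have MLW: "makar_limanov \<subseteq> graded_part \<B> W"
    unfolding \<Delta>_ker[symmetric] makar_limanov_def using \<Delta> by (rule INF_superset_mono) simp
  have WG: "subgroup W additive_group" unfolding W_def by (rule bar.subgroup_torc)
  have WA: "W \<subseteq> ?A" using W_iff by auto
  interpret graded_domain_mod \<B> W
    by (intro graded_domain_mod.intro graded_domain_axioms graded_domain_mod_axioms.intro WG WA)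
  obtain I e where basis: "basis_mod W ?A I e"
  proof -
    have "\<exists>I e. basis_mod W ?A I e"
      unfolding W_def by (rule basis_mod_exists[OF E(2,1) bar.subgroup_torc bar.torc_torsion_free])
    then show thesis using that by (elim exE)
  qed
  have r: "r = enat (card I)" unfolding r_def by (rule bar.group_rank_quotient[OF basis[unfolded W_def]])
  have frac: "to_fract ` graded_part \<B> W \<subseteq> fract_part 0"
    using to_fract_fract_part[of _ 0] unfolding coset_part_0 by auto
  obtain P where P: "nt P" using ex_nt by auto
  then have PS: "P \<in> Spec1" and tP: "\<not> torsion_group (quotient_group ?A (?M P))" by (simp_all add: nt_def)
  obtain H where H: "H \<in> cocyclic_overgroups (?M P) ?A" using a[OF P] by auto
  \<comment> \<open>Rigidity would make the derivation with kernel B^(H) zero, so that B^(H) = B and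
    every degree lies in H, although H is proper.\<close>
  have nonrigid: "\<not> rigid (UNIV :: 'b set)"
  proof
    assume rigid: "rigid (UNIV :: 'b set)"
    obtain D where D: "D \<in> LND UNIV" "derivation_ker D = graded_part \<B> H" using LND_kernel_cocyclic[OF affine graded_over normal PS H] by (rule bexE)
    then have "D = (\<lambda>_. 0)" using rigid by (simp add: rigid_def)
    then have all: "graded_part \<B> H = UNIV" using D(2) by (auto simp: derivation_ker_def)
    have Hsub: "subgroup H (additive_group\<lparr>carrier := ?A\<rparr>)" "H \<subset> ?A" using H by (simp_all add: cocyclic_overgroups_def)
    have HG: "subgroup H additive_group" by (rule group.incl_subgroup[OF group_additive_group A Hsub(1)])
    have "?A \<subseteq> H"
      unfolding grading_group_def
    proof (rule generate_additive_least[OF _ HG], rule subsetI)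
      fix i assume "i \<in> {i. \<B> i \<noteq> {0}}"
      then obtain x where "x \<in> \<B> i" "x \<noteq> 0" using degree_nonzero by auto
      then have "i \<in> support x" by (rule homogeneous_in_support)
      moreover have "support x \<subseteq> H" unfolding graded_part_iff[symmetric] all by simp
      ultimately show "i \<in> H" by auto
    qed
    with Hsub(2) show False by auto
  qed
  have "nonrigid_subgroups \<B> = cotorsion_subgroups \<B>"
    unfolding nonrigid_subgroups_def using HLND_nontrivial[OF affine graded_over normal PS H] by auto
  moreover have "\<exists>P\<in>Spec1. \<not> torsion_group (quotient_group ?A (?M P))"
    using PS tP by (rule bexI[rotated])
  moreover have "\<exists>\<Delta> \<subseteq> LND UNIV. (\<Inter>D\<in>\<Delta>. derivation_ker D) = graded_part \<B> W"
    using \<Delta> \<Delta>_ker by (intro exI[of _ \<Delta>] conjI)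
  moreover have "\<exists>K. subfield K (ring_of_type_algebra :: 'b fract ring) \<and>
      makar_limanov \<subseteq> graded_part \<B> W \<and> to_fract ` graded_part \<B> W \<subseteq> K \<and> purely_transcendental_over K r"
    unfolding r using subfield_fract_part MLW frac fract_part_transcendence_basis[OF basis]
    by (intro exI[of _ "fract_part 0"] conjI)
  moreover have "r \<le> trdeg (UNIV :: 'b set) makar_limanov"
    unfolding r by (rule trdeg_ge_card_basis[OF basis MLW])
  ultimately show ?thesis using nonrigid a unfolding nt_def by (intro conjI ballI impI) simp_all
qed

end
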